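(* Let $X$ be a closed subanalytic subset of $\mathbb{R}^n$, let $k$ be the dimension of $X$, let $\Gamma:=(X',\varphi,U)$ be a global smoothing section of $X\subset\mathbb{R}^n$ and let $W$ be a connected component of $U$. If $W$ contains a nonbounding equator of $X$ (that is, there is a nonbounding equator $Y$ of $X$ with $Y\subset W$), then the degree of $\Gamma$ over $W$ is even.
   Context: The term "analytic" means "real analytic". Smooth points. Let $X$ be a subanalytic subset of $\mathbb{R}^n$ and $k\in\mathbb{N}$. A point $x\in X$ is smooth of dimension $k$ if there is an open neighborhood $N$ of $x$ in $\mathbb{R}^n$ such that $X\cap N$ is an analytic submanifold of $\mathbb{R}^n$ of dimension $k$. The smooth part of $X$ of dimension $k$ is the set of all smooth points of $X$ of dimension $k$; it is an open subanalytic subset of $X$, hence an analytic submanifold of $\mathbb{R}^n$ of pure dimension $k$. Global smoothing section. Let $X$ be a closed subanalytic subset of $\mathbb{R}^n$ of dimension $k$. A global smoothing section of $X\subset\mathbb{R}^n$ is a triple $\Gamma=(X',\varphi,U)$ where $X'$ is an analytic manifold (without boundary) of pure dimension $k$, $\varphi:X'\to\mathbb{R}^n$ is a proper analytic mapping, and $U$ is an open subanalytic subset of the smooth part of $X$ of dimension $k$, such that: $\varphi(X')\subset X$; $\dim(X\setminus U)<k$; $\varphi^{-1}(X\setminus U)$ is a simple normal crossings hypersurface of $X'$; and for each connected component $W$ of $U$, $\varphi^{-1}(W)$ is a finite union of subsets open and closed in $\varphi^{-1}(U)$, each mapped isomorphically (as analytic manifolds) onto $W$ by $\varphi$. For a connected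 component $W$ of $U$, the degree of $\Gamma$ over $W$ is the finite positive number of these subsets open and closed in $\varphi^{-1}(U)$, each mapped isomorphically onto $W$ by $\varphi$. Nonbounding equator. Let $X$ be a closed subanalytic subset of $\mathbb{R}^n$ of dimension $k$ and let $Y$ be a subset of the smooth part of $X$ of dimension $k$. Then $Y$ is a nonbounding equator of $X$ if: (i) $Y$ is a compact $\mathscr{C}^\infty$ submanifold of $\mathbb{R}^n$ of dimension $k-1$. (ii) $Y$ does not bound, that is, it is not the boundary of a compact $\mathscr{C}^\infty$ manifold with boundary. (iii) $Y$ has a collar in $X$, that is, there exists a $\mathscr{C}^\infty$ map $\psi:Y\times(-1,1)\to X$ such that the image $T:=\psi(Y\times(-1,1))$ is an open neighborhood of $Y$ in the set of smooth points of $X$ of dimension $k$, the restriction $\psi:Y\times(-1,1)\to T$ is a $\mathscr{C}^\infty$ diffeomorphism and $\psi(Y\times\{0\})=Y$. (iv) There exists a relatively compact open subset $K$ of $X$ such that $\partial K:=\overline{K}\setminus K=Y$ and $K\cap T=\psi(Y\times(-1,0))$, where $\overline{K}$ is the closure of $K$ in $X$. *)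

theory Defs
  imports "HOL-Analysis.Analysis"
begin

text \<open>Throughout, $\mathbb{R}^n$ is the library's \<open>Euclidean_space n\<close>, carried by the
  functions \<open>nat \<Rightarrow> real\<close> vanishing at all indices \<open>i \<ge> n\<close>. In particular
  $\mathbb{R}^k \subseteq \mathbb{R}^n$ (first \<open>k\<close> coordinates) whenever \<open>k \<le> n\<close>.\<close>

abbreviation RR :: "nat \<Rightarrow> (nat \<Rightarrow> real) set"
  where "RR n \<equiv> topspace (Euclidean_space n)"

section \<open>Real analytic and smooth maps\<close>

text \<open>Local expansion into a power series in \<open>m\<close> variables. The index set consists of the
  multi-indices of length \<open>m\<close>; \<open>has_sum\<close> is unconditional (hence absolute) convergence.\<close>

definition analytic_fun :: "nat \<Rightarrow> (nat \<Rightarrow> real) set \<Rightarrow> ((nat \<Rightarrow> real) \<Rightarrow> real) \<Rightarrow> bool" where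
  "analytic_fun m N f \<longleftrightarrow>
     (\<forall>a\<in>N. \<exists>r>0. \<exists>c :: (nat \<Rightarrow> nat) \<Rightarrow> real. \<forall>x\<in>N. (\<forall>i<m. \<bar>x i - a i\<bar> < r) \<longrightarrow>
        ((\<lambda>\<alpha>. c \<alpha> * (\<Prod>i<m. (x i - a i) ^ \<alpha> i)) has_sum f x) {\<alpha>. \<forall>i\<ge>m. \<alpha> i = 0})"

text \<open>\<open>Ck_fun m N r f\<close>: all partial derivatives of order at most \<open>r\<close> exist and are continuous.\<close>

primrec Ck_fun ::
    "nat \<Rightarrow> (nat \<Rightarrow> real) set \<Rightarrow> nat \<Rightarrow> ((nat \<Rightarrow> real) \<Rightarrow> real) \<Rightarrow> bool" where
  "Ck_fun m N 0 f \<longleftrightarrow> continuous_map (subtopology (Euclidean_space m) N) euclideanreal f"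
| "Ck_fun m N (Suc r) f \<longleftrightarrow>
     continuous_map (subtopology (Euclidean_space m) N) euclideanreal f \<and>
     (\<forall>i<m. \<exists>g. Ck_fun m N r g \<and>
        (\<forall>x\<in>N. ((\<lambda>t. f (x(i := t))) has_real_derivative g x) (at (x i))))"

datatype regularity = Analytic | Smooth

text \<open>Only meant for sets \<open>N\<close> that are open in $\mathbb{R}^m$.\<close>

fun regular_fun ::
    "regularity \<Rightarrow> nat \<Rightarrow> (nat \<Rightarrow> real) set \<Rightarrow> ((nat \<Rightarrow> real) \<Rightarrow> real) \<Rightarrow> bool" where
  "regular_fun Analytic m N f \<longleftrightarrow> analytic_fun m N f"
| "regular_fun Smooth m N f \<longleftrightarrow> (\<forall>r. Ck_fun m N r f)"

text \<open>A map from an arbitrary subset \<open>S\<close> of $\mathbb{R}^m$ to $\mathbb{R}^n$ is analytic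
  (resp. \<open>C\<^sup>\<infinity>\<close>) if around each point of \<open>S\<close> it extends to such a map on an open subset of
  $\mathbb{R}^m$. For submanifolds and for open subsets of a half-space this is the usual
  notion.\<close>

definition regular_map ::
    "regularity \<Rightarrow> nat \<Rightarrow> nat \<Rightarrow> (nat \<Rightarrow> real) set \<Rightarrow> ((nat \<Rightarrow> real) \<Rightarrow> nat \<Rightarrow> real) \<Rightarrow> bool" where
  "regular_map \<rho> m n S f \<longleftrightarrow>
     S \<subseteq> RR m \<and> f ` S \<subseteq> RR n \<and>
     (\<forall>a\<in>S. \<exists>N g. openin (Euclidean_space m) N \<and> a \<in> N \<and>
        (\<forall>i<n. regular_fun \<rho> m N (\<lambda>x. g x i)) \<and> (\<forall>x\<in>S \<inter> N. \<forall>i<n. f x i = g x i))"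

definition regular_iso ::
    "regularity \<Rightarrow> nat \<Rightarrow> nat \<Rightarrow> (nat \<Rightarrow> real) set \<Rightarrow> (nat \<Rightarrow> real) set
       \<Rightarrow> ((nat \<Rightarrow> real) \<Rightarrow> nat \<Rightarrow> real) \<Rightarrow> bool" where
  "regular_iso \<rho> m n S S' f \<longleftrightarrow>
     bij_betw f S S' \<and> regular_map \<rho> m n S f \<and> regular_map \<rho> n m S' (inv_into S f)"

section \<open>Submanifolds of Euclidean space\<close>

definition submanifold :: "regularity \<Rightarrow> nat \<Rightarrow> nat \<Rightarrow> (nat \<Rightarrow> real) set \<Rightarrow> bool" where
  "submanifold \<rho> n k S \<longleftrightarrow>
     k \<le> n \<and> S \<subseteq> RR n \<and>
     (\<forall>a\<in>S. \<exists>N N' h. openin (Euclidean_space n) N \<and> openin (Euclidean_space n) N' \<and> a \<in> N \<and>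
        regular_iso \<rho> n n N N' h \<and> h ` (S \<inter> N) = N' \<inter> RR k)"

section \<open>Semianalytic and subanalytic sets\<close>

definition semianalytic :: "nat \<Rightarrow> (nat \<Rightarrow> real) set \<Rightarrow> bool" where
  "semianalytic n A \<longleftrightarrow>
     A \<subseteq> RR n \<and>
     (\<forall>a\<in>RR n. \<exists>N. openin (Euclidean_space n) N \<and> a \<in> N \<and>
        (\<exists>\<F>. finite \<F> \<and>
           (\<forall>(P, Q)\<in>\<F>. finite P \<and> finite Q \<and> (\<forall>f\<in>P \<union> Q. analytic_fun n N f)) \<and>
           A \<inter> N = (\<Union>(P, Q)\<in>\<F>. {x\<in>N. (\<forall>f\<in>P. f x = 0) \<and> (\<forall>f\<in>Q. 0 < f x)})))"

text \<open>The projection $\mathbb{R}^{n+m} = \mathbb{R}^n \times \mathbb{R}^m \to \mathbb{R}^n$.\<close>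

definition proj_first :: "nat \<Rightarrow> (nat \<Rightarrow> real) \<Rightarrow> nat \<Rightarrow> real" where
  "proj_first n x = (\<lambda>i. if i < n then x i else 0)"

text \<open>Locally a projection of a relatively compact semianalytic set.\<close>

definition subanalytic :: "nat \<Rightarrow> (nat \<Rightarrow> real) set \<Rightarrow> bool" where
  "subanalytic n A \<longleftrightarrow>
     A \<subseteq> RR n \<and>
     (\<forall>a\<in>RR n. \<exists>N. openin (Euclidean_space n) N \<and> a \<in> N \<and>
        (\<exists>m B. semianalytic (n + m) B \<and>
           compactin (Euclidean_space (n + m)) (Euclidean_space (n + m) closure_of B) \<and>
           A \<inter> N = proj_first n ` B))"

definition smooth_point :: "nat \<Rightarrow> nat \<Rightarrow> (nat \<Rightarrow> real) set \<Rightarrow> (nat \<Rightarrow> real) \<Rightarrow> bool" where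
  "smooth_point n k X x \<longleftrightarrow>
     x \<in> X \<and>
     (\<exists>N. openin (Euclidean_space n) N \<and> x \<in> N \<and> submanifold Analytic n k (X \<inter> N))"

definition smooth_part :: "nat \<Rightarrow> nat \<Rightarrow> (nat \<Rightarrow> real) set \<Rightarrow> (nat \<Rightarrow> real) set" where
  "smooth_part n k X = {x. smooth_point n k X x}"

text \<open>The dimension of a subanalytic set is the largest dimension of its smooth points; the
  empty set gets dimension \<open>-1\<close>. The maximum is over a subset of \<open>{-1..int n}\<close>.\<close>

definition subanalytic_dim :: "nat \<Rightarrow> (nat \<Rightarrow> real) set \<Rightarrow> int" where
  "subanalytic_dim n X = Max (insert (-1) {int j | j. smooth_part n j X \<noteq> {}})"

section \<open>Abstract manifolds\<close>

text \<open>A manifold is given by a topology and an atlas, not necessarily maximal; a chart is a pair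
  consisting of its domain and the coordinate map. The model \<open>H\<close> is \<open>RR k\<close> or a half-space.\<close>

type_synonym 'p chart = "'p set \<times> ('p \<Rightarrow> nat \<Rightarrow> real)"

definition chart_on :: "nat \<Rightarrow> (nat \<Rightarrow> real) set \<Rightarrow> 'p topology \<Rightarrow> 'p chart \<Rightarrow> bool" where
  "chart_on k H T = (\<lambda>(D, c).
     openin T D \<and> openin (subtopology (Euclidean_space k) H) (c ` D) \<and>
     homeomorphic_map (subtopology T D) (subtopology (Euclidean_space k) (c ` D)) c)"

definition compatible_charts :: "regularity \<Rightarrow> nat \<Rightarrow> 'p chart \<Rightarrow> 'p chart \<Rightarrow> bool" where
  "compatible_charts \<rho> k = (\<lambda>(D, c) (D', c').
     regular_map \<rho> k k (c ` (D \<inter> D')) (c' \<circ> inv_into D c) \<and>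
     regular_map \<rho> k k (c' ` (D \<inter> D')) (c \<circ> inv_into D' c'))"

definition manifold_modelled_on ::
    "regularity \<Rightarrow> nat \<Rightarrow> (nat \<Rightarrow> real) set \<Rightarrow> 'p topology \<Rightarrow> 'p chart set \<Rightarrow> bool" where
  "manifold_modelled_on \<rho> k H T \<A> \<longleftrightarrow>
     Hausdorff_space T \<and> second_countable T \<and>
     (\<forall>C\<in>\<A>. chart_on k H T C) \<and>
     (\<Union>(D, c)\<in>\<A>. D) = topspace T \<and>
     (\<forall>C\<in>\<A>. \<forall>C'\<in>\<A>. compatible_charts \<rho> k C C')"

definition analytic_manifold :: "nat \<Rightarrow> 'p topology \<Rightarrow> 'p chart set \<Rightarrow> bool" where
  "analytic_manifold k T \<A> \<longleftrightarrow> manifold_modelled_on Analytic k (RR k) T \<A>"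

text \<open>The dimension is written \<open>Suc j\<close> since the half-space is only meaningful in positive
  dimension.\<close>

definition smooth_manifold_with_boundary :: "nat \<Rightarrow> 'p topology \<Rightarrow> 'p chart set \<Rightarrow> bool" where
  "smooth_manifold_with_boundary j T \<A> \<longleftrightarrow>
     manifold_modelled_on Smooth (Suc j) {x\<in>RR (Suc j). 0 \<le> x 0} T \<A>"

definition manifold_boundary :: "'p chart set \<Rightarrow> 'p set" where
  "manifold_boundary \<A> = (\<Union>(D, c)\<in>\<A>. {p\<in>D. c p 0 = 0})"

definition regular_on_manifold ::
    "regularity \<Rightarrow> nat \<Rightarrow> 'p topology \<Rightarrow> 'p chart set \<Rightarrow> nat \<Rightarrow> ('p \<Rightarrow> nat \<Rightarrow> real) \<Rightarrow> bool" where
  "regular_on_manifold \<rho> k T \<A> n f \<longleftrightarrow>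
     f ` topspace T \<subseteq> RR n \<and>
     (\<forall>(D, c)\<in>\<A>. regular_map \<rho> k n (c ` D) (f \<circ> inv_into D c))"

text \<open>\<open>f\<close> restricts to an isomorphism from \<open>S\<close> onto \<open>Z\<close>, where \<open>S\<close> is an open subset or the
  boundary of the manifold and \<open>Z\<close> is a submanifold of $\mathbb{R}^n$.\<close>

definition manifold_iso_onto ::
    "regularity \<Rightarrow> nat \<Rightarrow> 'p topology \<Rightarrow> 'p chart set \<Rightarrow> 'p set
       \<Rightarrow> nat \<Rightarrow> (nat \<Rightarrow> real) set \<Rightarrow> ('p \<Rightarrow> nat \<Rightarrow> real) \<Rightarrow> bool" where
  "manifold_iso_onto \<rho> k T \<A> S n Z f \<longleftrightarrow>
     homeomorphic_map (subtopology T S) (subtopology (Euclidean_space n) Z) f \<and>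
     (\<forall>(D, c)\<in>\<A>.
        regular_map \<rho> k n (c ` (S \<inter> D)) (f \<circ> inv_into D c) \<and>
        regular_map \<rho> n k (f ` (S \<inter> D)) (c \<circ> inv_into S f))"

text \<open>\<open>\<H>\<close> is the family of smooth components of the hypersurface. Near each point there are
  analytic coordinates in which those components that pass through the point are distinct
  coordinate hyperplanes, and no other component is present.\<close>

definition snc_hypersurface :: "nat \<Rightarrow> 'p topology \<Rightarrow> 'p chart set \<Rightarrow> 'p set \<Rightarrow> bool" where
  "snc_hypersurface k T \<A> E \<longleftrightarrow>
     (\<exists>\<H>. E = \<Union>\<H> \<and> E \<subseteq> topspace T \<and>
        (\<forall>p\<in>topspace T. \<exists>D c \<iota>.
           p \<in> D \<and> chart_on k (RR k) T (D, c) \<and>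
           (\<forall>C\<in>\<A>. compatible_charts Analytic k (D, c) C) \<and>
           inj_on \<iota> {H\<in>\<H>. p \<in> H} \<and>
           (\<forall>H\<in>\<H>. if p \<in> H then \<iota> H < k \<and> H \<inter> D = {q\<in>D. c q (\<iota> H) = 0}
                    else H \<inter> D = {})))"

section \<open>Global smoothing sections\<close>

definition preimage_on :: "'p topology \<Rightarrow> ('p \<Rightarrow> nat \<Rightarrow> real) \<Rightarrow> (nat \<Rightarrow> real) set \<Rightarrow> 'p set" where
  "preimage_on T \<phi> S = {p\<in>topspace T. \<phi> p \<in> S}"

definition sheets ::
    "nat \<Rightarrow> nat \<Rightarrow> 'p topology \<Rightarrow> 'p chart set \<Rightarrow> ('p \<Rightarrow> nat \<Rightarrow> real)
       \<Rightarrow> (nat \<Rightarrow> real) set \<Rightarrow> (nat \<Rightarrow> real) set \<Rightarrow> 'p set set" where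
  "sheets n k T \<A> \<phi> U W =
     {S. openin (subtopology T (preimage_on T \<phi> U)) S \<and>
         closedin (subtopology T (preimage_on T \<phi> U)) S \<and>
         manifold_iso_onto Analytic k T \<A> S n W \<phi>}"

text \<open>The triple $(X', \varphi, U)$, where $X'$ is the manifold with topology \<open>T\<close> and atlas \<open>\<A>\<close>.\<close>

definition global_smoothing_section ::
    "nat \<Rightarrow> nat \<Rightarrow> (nat \<Rightarrow> real) set
       \<Rightarrow> 'p topology \<Rightarrow> 'p chart set \<Rightarrow> ('p \<Rightarrow> nat \<Rightarrow> real) \<Rightarrow> (nat \<Rightarrow> real) set \<Rightarrow> bool" where
  "global_smoothing_section n k X T \<A> \<phi> U \<longleftrightarrow>
     analytic_manifold k T \<A> \<and>
     regular_on_manifold Analytic k T \<A> n \<phi> \<and>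
     proper_map T (Euclidean_space n) \<phi> \<and>
     openin (subtopology (Euclidean_space n) (smooth_part n k X)) U \<and>
     subanalytic n U \<and>
     \<phi> ` topspace T \<subseteq> X \<and>
     subanalytic_dim n (X - U) < int k \<and>
     snc_hypersurface k T \<A> (preimage_on T \<phi> (X - U)) \<and>
     (\<forall>W\<in>connected_components_of (subtopology (Euclidean_space n) U).
        \<exists>\<S>. finite \<S> \<and> \<S> \<noteq> {} \<and> \<S> \<subseteq> sheets n k T \<A> \<phi> U W \<and> preimage_on T \<phi> W = \<Union>\<S>)"

text \<open>Since \<open>W\<close> is connected, the sheets over \<open>W\<close> are the connected components of
  $\varphi^{-1}(W)$; so there is exactly one family \<open>\<S>\<close> as above, the family of all sheets.\<close>

definition degree_over ::
    "nat \<Rightarrow> nat \<Rightarrow> 'p topology \<Rightarrow> 'p chart set \<Rightarrow> ('p \<Rightarrow> nat \<Rightarrow> real)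
       \<Rightarrow> (nat \<Rightarrow> real) set \<Rightarrow> (nat \<Rightarrow> real) set \<Rightarrow> nat" where
  "degree_over n k T \<A> \<phi> U W = card (sheets n k T \<A> \<phi> U W)"

section \<open>Nonbounding equators\<close>

text \<open>\<open>Y\<close> (of dimension \<open>j\<close>) is diffeomorphic to the boundary of a compact manifold of dimension
  \<open>Suc j\<close>. The points of that manifold may be taken in \<open>nat \<Rightarrow> real\<close> without loss of
  generality, as a compact manifold has at most continuum many points; its topology \<open>T\<close> is
  arbitrary, unrelated to the one of the type \<open>nat \<Rightarrow> real\<close>.\<close>

definition bounds :: "nat \<Rightarrow> nat \<Rightarrow> (nat \<Rightarrow> real) set \<Rightarrow> bool" where
  "bounds n j Y \<longleftrightarrow>
     (\<exists>(T :: (nat \<Rightarrow> real) topology) \<A> f.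
        smooth_manifold_with_boundary j T \<A> \<and> compact_space T \<and>
        manifold_iso_onto Smooth (Suc j) T \<A> (manifold_boundary \<A>) n Y f)"

text \<open>\<open>cylinder n Y I\<close> is \<open>Y \<times> I\<close> as a subset of $\mathbb{R}^{n+1}$, for
  $Y \subseteq \mathbb{R}^n$.\<close>

definition cylinder :: "nat \<Rightarrow> (nat \<Rightarrow> real) set \<Rightarrow> real set \<Rightarrow> (nat \<Rightarrow> real) set" where
  "cylinder n Y I = {y(n := t) | y t. y \<in> Y \<and> t \<in> I}"

text \<open>For \<open>k = 0\<close> there is no nonbounding equator: \<open>Y\<close> would have dimension \<open>-1\<close>, hence be
  empty, and the empty set bounds.\<close>

definition nonbounding_equator ::
    "nat \<Rightarrow> nat \<Rightarrow> (nat \<Rightarrow> real) set \<Rightarrow> (nat \<Rightarrow> real) set \<Rightarrow> bool" where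
  "nonbounding_equator n k X Y \<longleftrightarrow>
     Y \<subseteq> smooth_part n k X \<and>
     (\<exists>j. k = Suc j \<and>
        compactin (Euclidean_space n) Y \<and> submanifold Smooth n j Y \<and>
        \<not> bounds n j Y) \<and>
     (\<exists>\<psi> T K.
        T = \<psi> ` cylinder n Y {-1<..<1} \<and>
        openin (subtopology (Euclidean_space n) (smooth_part n k X)) T \<and> Y \<subseteq> T \<and>
        regular_iso Smooth (Suc n) n (cylinder n Y {-1<..<1}) T \<psi> \<and>
        \<psi> ` cylinder n Y {0} = Y \<and>
        openin (subtopology (Euclidean_space n) X) K \<and>
        compactin (subtopology (Euclidean_space n) X)
          ((subtopology (Euclidean_space n) X) closure_of K) \<and>
        ((subtopology (Euclidean_space n) X) closure_of K) - K = Y \<and>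
        K \<inter> T = \<psi> ` cylinder n Y {-1<..<0})"

end

theory Submission
  imports Defs
begin

text \<open>Suppose that the degree \<open>d\<close> of the section over \<open>W\<close> is odd, and let \<open>K\<close> be the relatively
  compact open subset of \<open>X\<close> with \<open>\<partial>K = Y\<close>. As \<open>\<phi>\<close> is proper, \<open>M\<^sub>0 = \<phi>\<^sup>-\<^sup>1(K \<union> Y)\<close> is compact. It is a
  smooth manifold with boundary: its interior is the open subset \<open>\<phi>\<^sup>-\<^sup>1(K)\<close> of the analytic manifold
  \<open>X'\<close>, and since \<open>Y \<subseteq> W\<close>, near the boundary \<open>\<phi>\<^sup>-\<^sup>1(Y)\<close> it consists of \<open>d\<close> copies, one in each sheet
  over \<open>W\<close>, of the inner half of the collar of \<open>Y\<close>. So \<open>\<partial>M\<^sub>0\<close> is \<open>d\<close> disjoint copies of \<open>Y\<close>. Match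
  the sheets in pairs, with one sheet \<open>A\<^sub>0\<close> left over, and glue the two copies of \<open>Y\<close> in each pair:
  the result is a compact smooth manifold whose boundary is the single copy of \<open>Y\<close> in \<open>A\<^sub>0\<close>. Thus
  \<open>Y\<close> bounds, a contradiction.

  The gluing is encoded by an involution \<open>\<tau>\<close> of \<open>\<phi>\<^sup>-\<^sup>1(Y)\<close> that exchanges the sheets of each pair and
  satisfies \<open>\<phi> \<circ> \<tau> = \<phi>\<close>; on \<open>A\<^sub>0\<close> it is the identity. The lemma \<open>glue_along_involution\<close> forms
  the quotient and realises its points as sequences of zeros and ones, so that they lie in the type
  that the definition of bounding asks for. Charts of the quotient are described upstairs, by
  saturated open subsets of \<open>M\<^sub>0\<close> with coordinates that respect the gluing (locale
  \<open>chart_descent\<close>). There are two kinds: translates of analytic charts of \<open>X'\<close> on \<open>\<phi>\<^sup>-\<^sup>1(K)\<close>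
  (\<open>interior_chart\<close>), and charts around \<open>\<phi>\<^sup>-\<^sup>1(Y)\<close> (\<open>collar_chart\<close>) whose coordinates
  are the collar parameter, followed by coordinates of \<open>Y\<close>; on a glued pair the
  collar parameter runs in opposite directions on the two sheets.

  Since the transition maps between the two kinds mix analytic and \<open>C\<^sup>\<infinity>\<close> data, two facts of calculus
  are needed: smooth maps compose (\<open>regular_map_compose\<close>, from the chain rule
  \<open>curve_chain_rule\<close>), and a function with local power series expansions has continuous
  partial derivatives of all orders (\<open>analytic_imp_Ck\<close>, by termwise differentiation).\<close>

section \<open>Smooth functions of several variables\<close>

text \<open>The product topology on \<open>nat \<Rightarrow> real\<close> is the topology of the type class, which makes the
  notions of continuity, limit and open set for type classes available on \<open>RR m\<close>.\<close>

lemma Euclidean_space_top_of_set: "Euclidean_space m = top_of_set {x. \<forall>i\<ge>m. x i = 0}"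
  by (simp add: Euclidean_space_def euclidean_product_topology)

lemma RR_iff: "x \<in> RR m \<longleftrightarrow> (\<forall>i\<ge>m. x i = 0)"
  by (simp add: topspace_Euclidean_space)

lemma RR_mono: "m \<le> n \<Longrightarrow> RR m \<subseteq> RR n"
  by simp

lemma openin_RR: "openin (Euclidean_space m) N \<longleftrightarrow> (\<exists>G. open G \<and> N = RR m \<inter> G)"
  unfolding Euclidean_space_top_of_set by (simp add: openin_open)

lemma subtopology_RR: "subtopology (Euclidean_space m) S = top_of_set (RR m \<inter> S)"
  unfolding Euclidean_space_top_of_set by (simp add: subtopology_subtopology)

text \<open>Only the first \<open>m\<close> coordinates vary on \<open>RR m\<close>, so finitely many of the conditions that
  define a basic open set of the product are effective, and one radius serves them all.\<close>

lemma open_box: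
  assumes "openin (Euclidean_space m) N" "x \<in> N"
  obtains r where "r > 0" "\<And>y. y \<in> RR m \<Longrightarrow> (\<And>i. i < m \<Longrightarrow> \<bar>y i - x i\<bar> < r) \<Longrightarrow> y \<in> N"
proof -
  obtain G where G: "open G" "N = RR m \<inter> G" using assms openin_RR by blast
  have "openin (powertop_real UNIV) G" using G by (simp add: euclidean_product_topology)
  then obtain U where U: "\<And>i. open (U i)" "x \<in> Pi\<^sub>E UNIV U" "Pi\<^sub>E UNIV U \<subseteq> G"
    using assms(2) G(2) unfolding openin_product_topology_alt by (auto, metis)
  have "\<exists>r>0. \<forall>t. \<bar>t - x i\<bar> < r \<longrightarrow> t \<in> U i" for i
    using U(1)[of i] U(2) by (auto simp: open_dist dist_real_def PiE_UNIV_domain)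
  then obtain r where r: "\<And>i. r i > 0" "\<And>i t. \<bar>t - x i\<bar> < r i \<Longrightarrow> t \<in> U i" by metis
  define R where "R = Min (insert 1 (r ` {..<m}))"
  have "R > 0" unfolding R_def using r(1) by (subst Min_gr_iff) auto
  moreover have "y \<in> N" if y: "y \<in> RR m" "\<And>i. i < m \<Longrightarrow> \<bar>y i - x i\<bar> < R" for y
  proof -
    have "y i \<in> U i" for i
    proof (cases "i < m")
      case True
      then have "R \<le> r i" unfolding R_def by (intro Min_le) auto
      then show ?thesis using y(2)[OF True] r(2) by force
    next
      case False
      have "x \<in> RR m" using assms(2) G by blast
      then have "y i = x i" using y(1) False by (simp add: RR_iff)
      then show ?thesis using U(2) by (metis PiE_E UNIV_I)
    qed
    then have "y \<in> G" using U(3) by (auto simp: PiE_UNIV_domain)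
    then show ?thesis using G y by auto
  qed
  ultimately show ?thesis using that by blast
qed

lemma Ck_continuous:
  assumes "Ck_fun m N r f" "N \<subseteq> RR m" shows "continuous_on N f"
proof -
  have "continuous_map (subtopology (Euclidean_space m) N) euclideanreal f"
    using assms by (cases r) auto
  then show ?thesis using assms(2) by (simp add: subtopology_RR Int_absorb1)
qed

lemma Ck_0_iff: "N \<subseteq> RR m \<Longrightarrow> Ck_fun m N 0 f \<longleftrightarrow> continuous_on N f"
  by (simp add: subtopology_RR Int_absorb1)

lemma Ck_Suc_iff: "N \<subseteq> RR m \<Longrightarrow> Ck_fun m N (Suc r) f \<longleftrightarrow> continuous_on N f \<and>
     (\<forall>i<m. \<exists>g. Ck_fun m N r g \<and>
        (\<forall>x\<in>N. ((\<lambda>t. f (x(i := t))) has_real_derivative g x) (at (x i))))"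
  by (simp add: subtopology_RR Int_absorb1)

declare Ck_fun.simps [simp del]

lemma Ck_subset:
  assumes "Ck_fun m N r f" "N' \<subseteq> N" "N \<subseteq> RR m" shows "Ck_fun m N' r f"
  using assms(1)
proof (induction r arbitrary: f)
  case 0
  then show ?case using assms(2,3) Ck_0_iff continuous_on_subset by (metis order_trans)
next
  case (Suc r)
  have N': "N' \<subseteq> RR m" using assms by blast
  show ?case using Suc.prems Suc.IH assms(2) unfolding Ck_Suc_iff[OF N'] Ck_Suc_iff[OF assms(3)]
    by (meson continuous_on_subset subsetD)
qed

lemma Ck_Suc_imp: "Ck_fun m N (Suc r) f \<Longrightarrow> Ck_fun m N r f"
proof (induction r arbitrary: f)
  case 0
  then show ?case by (simp add: Ck_fun.simps)
next
  case (Suc r)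
  then show ?case unfolding Ck_fun.simps(2)[of m N "Suc r"] Ck_fun.simps(2)[of m N r] by blast
qed

lemma Ck_const: "N \<subseteq> RR m \<Longrightarrow> Ck_fun m N r (\<lambda>x. c)"
proof (induction r arbitrary: c)
  case 0
  then show ?case by (simp add: Ck_0_iff)
next
  case (Suc r)
  then show ?case unfolding Ck_Suc_iff[OF Suc.prems]
    by (auto intro!: exI[of _ "\<lambda>x. 0"])
qed

lemma Ck_coord: assumes "N \<subseteq> RR m" shows "Ck_fun m N r (\<lambda>x. x l)"
proof (cases r)
  case 0
  then show ?thesis using assms by (auto simp: Ck_0_iff intro!: continuous_on_product_then_coordinatewise[OF continuous_on_id])
next
  case (Suc r')
  show ?thesis unfolding Suc Ck_Suc_iff[OF assms]
  proof (intro conjI allI impI)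
    show "continuous_on N (\<lambda>x. x l)" by (rule continuous_on_product_then_coordinatewise[OF continuous_on_id])
    fix i
    show "\<exists>g. Ck_fun m N r' g \<and> (\<forall>x\<in>N. ((\<lambda>t. (x(i := t)) l) has_real_derivative g x) (at (x i)))"
      by (intro exI[of _ "\<lambda>x. if l = i then 1 else 0"]) (auto intro!: Ck_const assms)
  qed
qed

lemma Ck_add:
  assumes "N \<subseteq> RR m" "Ck_fun m N r f" "Ck_fun m N r g" shows "Ck_fun m N r (\<lambda>x. f x + g x)"
  using assms(2,3)
proof (induction r arbitrary: f g)
  case 0
  then show ?case using assms(1) by (simp add: Ck_0_iff continuous_on_add)
next
  case (Suc r)
  show ?case unfolding Ck_Suc_iff[OF assms(1)]
  proof (intro conjI allI impI)
    show "continuous_on N (\<lambda>x. f x + g x)" using Suc.prems assms(1) Ck_continuous continuous_on_add by blast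
    fix i assume "i < m"
    then obtain f' g' where "Ck_fun m N r f'" "Ck_fun m N r g'"
       "\<forall>x\<in>N. ((\<lambda>t. f (x(i := t))) has_real_derivative f' x) (at (x i))"
       "\<forall>x\<in>N. ((\<lambda>t. g (x(i := t))) has_real_derivative g' x) (at (x i))"
      using Suc.prems unfolding Ck_Suc_iff[OF assms(1)] by meson
    then show "\<exists>h. Ck_fun m N r h \<and> (\<forall>x\<in>N. ((\<lambda>t. f (x(i := t)) + g (x(i := t))) has_real_derivative h x) (at (x i)))"
      using Suc.IH by (intro exI[of _ "\<lambda>x. f' x + g' x"]) (auto intro: DERIV_add)
  qed
qed

lemma Ck_mult:
  assumes "N \<subseteq> RR m" "Ck_fun m N r f" "Ck_fun m N r g" shows "Ck_fun m N r (\<lambda>x. f x * g x)"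
  using assms(2,3)
proof (induction r arbitrary: f g)
  case 0
  then show ?case using assms(1) by (simp add: Ck_0_iff continuous_on_mult)
next
  case (Suc r)
  show ?case unfolding Ck_Suc_iff[OF assms(1)]
  proof (intro conjI allI impI)
    show "continuous_on N (\<lambda>x. f x * g x)" using Suc.prems assms(1) Ck_continuous continuous_on_mult by blast
    fix i assume "i < m"
    then obtain f' g' where fg: "Ck_fun m N r f'" "Ck_fun m N r g'"
       "\<forall>x\<in>N. ((\<lambda>t. f (x(i := t))) has_real_derivative f' x) (at (x i))"
       "\<forall>x\<in>N. ((\<lambda>t. g (x(i := t))) has_real_derivative g' x) (at (x i))"
      using Suc.prems unfolding Ck_Suc_iff[OF assms(1)] by meson
    have "Ck_fun m N r (\<lambda>x. f' x * g x + g' x * f x)"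
      using Ck_add[OF assms(1) Suc.IH[OF fg(1) Ck_Suc_imp[OF Suc.prems(2)]] Suc.IH[OF fg(2) Ck_Suc_imp[OF Suc.prems(1)]]] .
    moreover have "((\<lambda>t. f (x(i := t)) * g (x(i := t))) has_real_derivative f' x * g x + g' x * f x) (at (x i))"
      if "x \<in> N" for x using DERIV_mult[OF fg(3)[rule_format, OF that] fg(4)[rule_format, OF that]] by simp
    ultimately show "\<exists>h. Ck_fun m N r h \<and> (\<forall>x\<in>N. ((\<lambda>t. f (x(i := t)) * g (x(i := t))) has_real_derivative h x) (at (x i)))"
      by (intro exI[of _ "\<lambda>x. f' x * g x + g' x * f x"]) auto
  qed
qed

lemma Ck_sum:
  fixes L :: nat
  assumes "N \<subseteq> RR m" "\<And>l. l < L \<Longrightarrow> Ck_fun m N r (f l)" shows "Ck_fun m N r (\<lambda>x. \<Sum>l<L. f l x)"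
  using assms(2) by (induction L) (auto intro!: Ck_const Ck_add assms(1))

lemma MVT_abs:
  fixes f :: "real \<Rightarrow> real"
  assumes "\<And>u. \<bar>u - a\<bar> \<le> \<bar>b - a\<bar> \<Longrightarrow> (f has_real_derivative f' u) (at u)"
  shows "\<exists>s. \<bar>s - a\<bar> \<le> \<bar>b - a\<bar> \<and> f b - f a = (b - a) * f' s"
proof -
  consider "a = b" | "a < b" | "b < a" by linarith
  then show ?thesis
  proof cases
    case 2
    then obtain z where "a < z" "z < b" "f b - f a = (b - a) * f' z" using MVT2[of a b f f'] assms by auto
    then show ?thesis by (intro exI[of _ z]) auto
  next
    case 3
    then obtain z where "b < z" "z < a" "f a - f b = (a - b) * f' z" using MVT2[of b a f f'] assms by auto
    then show ?thesis by (intro exI[of _ z]) (auto simp: algebra_simps)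
  qed auto
qed

lemma tendsto_coordinatewise:
  fixes f :: "'a \<Rightarrow> nat \<Rightarrow> real"
  assumes "\<And>i. ((\<lambda>t. f t i) \<longlongrightarrow> l i) F" shows "(f \<longlongrightarrow> l) F"
proof -
  have "limitin (product_topology (\<lambda>i. euclideanreal) UNIV) f l F"
    using assms by (subst limitin_componentwise) (auto simp: extensional_def)
  then show ?thesis by (simp add: euclidean_product_topology)
qed

text \<open>The increment of \<open>F\<close> along the curve is split into \<open>n\<close> steps, each changing one coordinate.
  By the mean value theorem a step contributes a partial derivative at an intermediate point
  times the increment of a coordinate; continuity of the partial derivatives gives the limit
  of the quotients.\<close>

lemma curve_chain_rule:
  assumes N: "openin (Euclidean_space n) N"
    and D: "\<And>l. l < n \<Longrightarrow> continuous_on N (D l)"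
      "\<And>l x. l < n \<Longrightarrow> x \<in> N \<Longrightarrow> ((\<lambda>t. F (x(l := t))) has_real_derivative D l x) (at (x l))"
    and \<gamma>: "\<gamma> t0 \<in> N" "\<And>t. \<gamma> t \<in> RR n"
      "\<And>l. l < n \<Longrightarrow> ((\<lambda>t. \<gamma> t l) has_real_derivative v l) (at t0)"
  shows "((\<lambda>t. F (\<gamma> t)) has_real_derivative (\<Sum>l<n. D l (\<gamma> t0) * v l)) (at t0)"
proof -
  \<comment> \<open>The point whose first \<open>l\<close> coordinates have already moved from \<open>\<gamma> t0\<close> to \<open>\<gamma> t\<close>.\<close>
  define z where "z l t = (\<lambda>i. if i < l then \<gamma> t i else \<gamma> t0 i)" for l :: nat and t
  obtain r where r: "r > 0" "\<And>y. y \<in> RR n \<Longrightarrow> (\<And>i. i < n \<Longrightarrow> \<bar>y i - \<gamma> t0 i\<bar> < r) \<Longrightarrow> y \<in> N"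
    using open_box N \<gamma>(1) by metis
  have lim: "((\<lambda>t. \<gamma> t l) \<longlongrightarrow> \<gamma> t0 l) (at t0)" if "l < n" for l
    using \<gamma>(3)[OF that] DERIV_isCont isCont_def by blast
  have "eventually (\<lambda>t. \<bar>\<gamma> t l - \<gamma> t0 l\<bar> < r) (at t0)" if "l < n" for l
    using lim[OF that] r(1) unfolding tendsto_iff dist_real_def by blast
  then have ev: "eventually (\<lambda>t. \<forall>l<n. \<bar>\<gamma> t l - \<gamma> t0 l\<bar> < r) (at t0)"
    using eventually_ball_finite[of "{..<n}" "\<lambda>t l. \<bar>\<gamma> t l - \<gamma> t0 l\<bar> < r" "at t0"]
    by (simp add: Ball_def)
  have "((\<lambda>t. F (z l t)) has_real_derivative (\<Sum>i<l. D i (\<gamma> t0) * v i)) (at t0)" if "l \<le> n" for l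
    using that
  proof (induction l)
    case 0
    then show ?case by (simp add: z_def)
  next
    case (Suc l)
    then have l: "l < n" by simp
    have zS: "z (Suc l) t = (z l t)(l := \<gamma> t l)" "z l t = (z l t)(l := \<gamma> t0 l)" for t
      by (auto simp: z_def fun_eq_iff less_Suc_eq)
    have inN: "(z l t)(l := u) \<in> N" if "\<forall>l<n. \<bar>\<gamma> t l - \<gamma> t0 l\<bar> < r" "\<bar>u - \<gamma> t0 l\<bar> \<le> \<bar>\<gamma> t l - \<gamma> t0 l\<bar>" for t u
    proof (rule r(2))
      show "(z l t)(l := u) \<in> RR n" using \<gamma>(2) l by (auto simp: RR_iff z_def)
      show "\<bar>((z l t)(l := u)) i - \<gamma> t0 i\<bar> < r" if "i < n" for i
        using that \<open>\<forall>l<n. \<bar>\<gamma> t l - \<gamma> t0 l\<bar> < r\<close> \<open>\<bar>u - \<gamma> t0 l\<bar> \<le> _\<close> r(1) l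
        by (auto simp: z_def intro: le_less_trans)
    qed
    have "\<exists>s. (\<forall>l<n. \<bar>\<gamma> t l - \<gamma> t0 l\<bar> < r) \<longrightarrow> \<bar>s - \<gamma> t0 l\<bar> \<le> \<bar>\<gamma> t l - \<gamma> t0 l\<bar> \<and>
        F (z (Suc l) t) - F (z l t) = (\<gamma> t l - \<gamma> t0 l) * D l ((z l t)(l := s))" for t
    proof (cases "\<forall>l<n. \<bar>\<gamma> t l - \<gamma> t0 l\<bar> < r")
      case True
      have "((\<lambda>s. F ((z l t)(l := s))) has_real_derivative D l ((z l t)(l := u))) (at u)"
        if "\<bar>u - \<gamma> t0 l\<bar> \<le> \<bar>\<gamma> t l - \<gamma> t0 l\<bar>" for u
        using D(2)[OF l inN[OF True that]] by simp
      from MVT_abs[of "\<gamma> t0 l" "\<gamma> t l" "\<lambda>s. F ((z l t)(l := s))", OF this]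
      show ?thesis using zS by metis
    qed auto
    then obtain s where s: "\<And>t. (\<forall>l<n. \<bar>\<gamma> t l - \<gamma> t0 l\<bar> < r) \<Longrightarrow> \<bar>s t - \<gamma> t0 l\<bar> \<le> \<bar>\<gamma> t l - \<gamma> t0 l\<bar>"
        "\<And>t. (\<forall>l<n. \<bar>\<gamma> t l - \<gamma> t0 l\<bar> < r) \<Longrightarrow> F (z (Suc l) t) - F (z l t) = (\<gamma> t l - \<gamma> t0 l) * D l ((z l t)(l := s t))"
      by metis
    have slim: "(s \<longlongrightarrow> \<gamma> t0 l) (at t0)"
    proof (rule Lim_transform_bound[of _ "\<lambda>t. \<gamma> t l - \<gamma> t0 l", THEN Lim_null[THEN iffD2]])
      show "\<forall>\<^sub>F t in at t0. norm (s t - \<gamma> t0 l) \<le> norm (\<gamma> t l - \<gamma> t0 l)"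
        using ev by eventually_elim (use s(1) in auto)
      show "((\<lambda>t. \<gamma> t l - \<gamma> t0 l) \<longlongrightarrow> 0) (at t0)" using tendsto_diff[OF lim[OF l] tendsto_const[of "\<gamma> t0 l"]] by simp
    qed
    have wlim: "((\<lambda>t. (z l t)(l := s t)) \<longlongrightarrow> \<gamma> t0) (at t0)"
    proof (rule tendsto_coordinatewise)
      fix i
      show "((\<lambda>t. ((z l t)(l := s t)) i) \<longlongrightarrow> \<gamma> t0 i) (at t0)"
        using slim lim[of i] l by (cases "i = l"; cases "i < l") (auto simp: z_def)
    qed
    have "((\<lambda>t. D l ((z l t)(l := s t))) \<longlongrightarrow> D l (\<gamma> t0)) (at t0)"
    proof (rule continuous_on_tendsto_compose[OF D(1)[OF l] wlim \<gamma>(1)])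
      show "\<forall>\<^sub>F t in at t0. (z l t)(l := s t) \<in> N"
        using ev by eventually_elim (use s(1) inN in auto)
    qed
    moreover have "((\<lambda>t. (\<gamma> t l - \<gamma> t0 l) / (t - t0)) \<longlongrightarrow> v l) (at t0)"
      using \<gamma>(3)[OF l] by (simp add: has_field_derivative_iff)
    ultimately have "((\<lambda>t. D l ((z l t)(l := s t)) * ((\<gamma> t l - \<gamma> t0 l) / (t - t0))) \<longlongrightarrow> D l (\<gamma> t0) * v l) (at t0)"
      by (rule tendsto_mult)
    moreover have "\<forall>\<^sub>F t in at t0. D l ((z l t)(l := s t)) * ((\<gamma> t l - \<gamma> t0 l) / (t - t0))
        = ((F (z (Suc l) t) - F (z l t)) - (F (z (Suc l) t0) - F (z l t0))) / (t - t0)"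
      using ev
    proof eventually_elim
      case (elim t)
      have "F (z (Suc l) t0) - F (z l t0) = 0" by (simp add: z_def)
      then show ?case using s(2)[OF elim] by simp
    qed
    ultimately have "((\<lambda>t. F (z (Suc l) t) - F (z l t)) has_real_derivative D l (\<gamma> t0) * v l) (at t0)"
      unfolding has_field_derivative_iff by (rule Lim_transform_eventually)
    from DERIV_add[OF Suc.IH this] show ?case using Suc.prems by simp
  qed
  from this[of n] have "((\<lambda>t. F (z n t)) has_real_derivative (\<Sum>l<n. D l (\<gamma> t0) * v l)) (at t0)" by simp
  moreover have "z n t = \<gamma> t" for t using \<gamma>(2)[of t] \<gamma>(2)[of t0] by (auto simp: z_def RR_iff fun_eq_iff)
  ultimately show ?thesis by simp
qed

text \<open>Only the first \<open>n\<close> components of a local extension of a map into \<open>RR n\<close> are prescribed;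
  padding puts its values into \<open>RR n\<close>, so that functions defined there can be applied to them.\<close>

definition pad :: "nat \<Rightarrow> (nat \<Rightarrow> real) \<Rightarrow> nat \<Rightarrow> real" where
  "pad n x = (\<lambda>i. if i < n then x i else 0)"

lemma pad_in_RR: "pad n x \<in> RR n" by (simp add: pad_def RR_iff)

text \<open>By induction on the order: the chain rule expresses the partial derivatives of the composite
  through sums and products of composites of lower order.\<close>

lemma Ck_compose:
  assumes N: "openin (Euclidean_space m) N" and N': "openin (Euclidean_space n) N'"
    and G: "\<And>l. l < n \<Longrightarrow> Ck_fun m N r (\<lambda>x. G x l)" "\<And>x. x \<in> N \<Longrightarrow> pad n (G x) \<in> N'"
    and F: "Ck_fun n N' r F"
  shows "Ck_fun m N r (\<lambda>x. F (pad n (G x)))"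
  using G(1) F
proof (induction r arbitrary: F)
  have sub: "N \<subseteq> RR m" "N' \<subseteq> RR n" using N N' openin_subset by blast+
  have cont: "continuous_on N (\<lambda>x. F (pad n (G x)))"
    if "continuous_on N' F" "\<And>l. l < n \<Longrightarrow> continuous_on N (\<lambda>x. G x l)" for F
  proof (rule continuous_on_compose2[OF that(1)])
    show "continuous_on N (\<lambda>x. pad n (G x))"
    proof (rule continuous_on_coordinatewise_then_product)
      fix i show "continuous_on N (\<lambda>x. pad n (G x) i)"
        using that(2)[of i] by (cases "i < n") (auto simp: pad_def)
    qed
  qed (use G(2) in auto)
  {
    case 0
    then show ?case using cont sub by (simp add: Ck_0_iff)
  next
    case (Suc r)
    show ?case unfolding Ck_Suc_iff[OF sub(1)]
    proof (intro conjI allI impI)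
      show "continuous_on N (\<lambda>x. F (pad n (G x)))"
        by (rule cont) (use Suc.prems sub Ck_continuous in blast)+
      fix i assume i: "i < m"
      have "\<exists>g. Ck_fun m N r g \<and> (\<forall>x\<in>N. ((\<lambda>t. G (x(i := t)) l) has_real_derivative g x) (at (x i)))"
        if "l < n" for l
        using Suc.prems(1)[OF that] i unfolding Ck_Suc_iff[OF sub(1)] by blast
      then obtain g where g: "\<And>l. l < n \<Longrightarrow> Ck_fun m N r (g l)"
          "\<And>l x. l < n \<Longrightarrow> x \<in> N \<Longrightarrow> ((\<lambda>t. G (x(i := t)) l) has_real_derivative g l x) (at (x i))"
        by metis
      have "\<exists>D. Ck_fun n N' r D \<and> (\<forall>x\<in>N'. ((\<lambda>t. F (x(l := t))) has_real_derivative D x) (at (x l)))"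
        if "l < n" for l
        using Suc.prems(2) that unfolding Ck_Suc_iff[OF sub(2)] by blast
      then obtain D where D: "\<And>l. l < n \<Longrightarrow> Ck_fun n N' r (D l)"
          "\<And>l x. l < n \<Longrightarrow> x \<in> N' \<Longrightarrow> ((\<lambda>t. F (x(l := t))) has_real_derivative D l x) (at (x l))"
        by metis
      have "Ck_fun m N r (\<lambda>x. \<Sum>l<n. D l (pad n (G x)) * g l x)"
        by (intro Ck_sum sub Ck_mult Suc.IH g(1) D(1)) (simp_all add: Ck_Suc_imp Suc.prems(1))
      moreover have "((\<lambda>t. F (pad n (G (x(i := t))))) has_real_derivative (\<Sum>l<n. D l (pad n (G x)) * g l x)) (at (x i))"
        if x: "x \<in> N" for x
      proof -
        have 1: "pad n (G (x(i := x i))) \<in> N'" using G(2)[OF x] by simp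
        have 2: "((\<lambda>t. pad n (G (x(i := t))) l) has_real_derivative g l x) (at (x i))" if "l < n" for l
          using g(2)[OF that x] that by (simp add: pad_def)
        show ?thesis
          using curve_chain_rule[OF N' Ck_continuous[OF D(1) sub(2)] D(2) 1 pad_in_RR 2] by simp
      qed
      ultimately show "\<exists>h. Ck_fun m N r h \<and>
          (\<forall>x\<in>N. ((\<lambda>t. F (pad n (G (x(i := t))))) has_real_derivative h x) (at (x i)))" by blast
    qed
  }
qed

section \<open>Real analytic functions are smooth\<close>

lemma has_sum_abs_le:
  fixes f g :: "'a \<Rightarrow> real"
  assumes "(f has_sum x) A" "(g has_sum y) A" "\<And>a. a \<in> A \<Longrightarrow> \<bar>f a\<bar> \<le> g a"
  shows "\<bar>x\<bar> \<le> y"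
proof -
  have "x \<le> y" by (rule has_sum_mono[OF assms(1,2)]) (use assms(3) in force)
  moreover have "- x \<le> y"
    by (rule has_sum_mono[OF has_sum_uminusI[OF assms(1)] assms(2)]) (use assms(3) in force)
  ultimately show ?thesis by linarith
qed

abbreviation multi_indices :: "nat \<Rightarrow> (nat \<Rightarrow> nat) set" where
  "multi_indices m \<equiv> {\<alpha>. \<forall>i\<ge>m. \<alpha> i = 0}"

text \<open>Evaluating the series at the corner of a box inside its domain gives absolute convergence,
  and hence one summable majorant for all points of the box.\<close>

lemma analytic_expansion:
  assumes "analytic_fun m N f" "openin (Euclidean_space m) N" "a \<in> N"
  obtains \<rho> c S where "\<rho> > 0"
    "((\<lambda>\<alpha>. \<bar>c \<alpha>\<bar> * (\<Prod>i<m. \<rho> ^ \<alpha> i)) has_sum S) (multi_indices m)"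
    "\<forall>x\<in>RR m. (\<forall>i<m. \<bar>x i - a i\<bar> \<le> \<rho>) \<longrightarrow> x \<in> N \<and>
        ((\<lambda>\<alpha>. c \<alpha> * (\<Prod>i<m. (x i - a i) ^ \<alpha> i)) has_sum f x) (multi_indices m)"
proof -
  obtain r c where r: "r > 0" "\<forall>x\<in>N. (\<forall>i<m. \<bar>x i - a i\<bar> < r) \<longrightarrow>
      ((\<lambda>\<alpha>. c \<alpha> * (\<Prod>i<m. (x i - a i) ^ \<alpha> i)) has_sum f x) (multi_indices m)"
    using assms(1,3) unfolding analytic_fun_def by blast
  obtain r0 where r0: "r0 > 0" "\<And>y. y \<in> RR m \<Longrightarrow> (\<And>i. i < m \<Longrightarrow> \<bar>y i - a i\<bar> < r0) \<Longrightarrow> y \<in> N"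
    using open_box[OF assms(2,3)] by metis
  define \<rho> where "\<rho> = min r r0 / 2"
  have \<rho>: "\<rho> > 0" "\<rho> < r" "\<rho> < r0" using r(1) r0(1) by (auto simp: \<rho>_def)
  have *: "x \<in> N \<and> ((\<lambda>\<alpha>. c \<alpha> * (\<Prod>i<m. (x i - a i) ^ \<alpha> i)) has_sum f x) (multi_indices m)"
    if "x \<in> RR m" "\<And>i. i < m \<Longrightarrow> \<bar>x i - a i\<bar> \<le> \<rho>" for x
  proof -
    have "\<bar>x i - a i\<bar> < r" "\<bar>x i - a i\<bar> < r0" if "i < m" for i
      using \<open>\<And>i. i < m \<Longrightarrow> \<bar>x i - a i\<bar> \<le> \<rho>\<close>[OF that] \<rho> by linarith+
    then show ?thesis using r(2) r0(2)[OF that(1)] by blast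
  qed
  define p where "p j = (if j < m then a j + \<rho> else 0)" for j
  have "((\<lambda>\<alpha>. c \<alpha> * (\<Prod>i<m. (p i - a i) ^ \<alpha> i)) has_sum f p) (multi_indices m)"
    using *[of p] \<rho> by (simp add: p_def RR_iff)
  then have "(\<lambda>\<alpha>. c \<alpha> * (\<Prod>i<m. \<rho> ^ \<alpha> i)) summable_on (multi_indices m)"
    by (simp add: p_def has_sum_imp_summable)
  then have "(\<lambda>\<alpha>. \<bar>c \<alpha> * (\<Prod>i<m. \<rho> ^ \<alpha> i)\<bar>) summable_on (multi_indices m)"
    by (subst (asm) summable_on_iff_abs_summable_on_real) simp
  moreover have "\<bar>c \<alpha> * (\<Prod>i<m. \<rho> ^ \<alpha> i)\<bar> = \<bar>c \<alpha>\<bar> * (\<Prod>i<m. \<rho> ^ \<alpha> i)" for \<alpha>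
    using \<rho>(1) by (simp add: abs_mult abs_prod)
  ultimately have "(\<lambda>\<alpha>. \<bar>c \<alpha>\<bar> * (\<Prod>i<m. \<rho> ^ \<alpha> i)) summable_on (multi_indices m)" by simp
  then show ?thesis using that \<rho>(1) * has_sum_infsum by blast
qed

text \<open>A point is the centre of its own expansion. At distance \<open>\<delta>\<close> from the centre every monomial
  except the constant one is at most \<open>\<delta> / \<rho>\<close> times its value at the corner of the box of
  radius \<open>\<rho>\<close>.\<close>

lemma analytic_continuous_on:
  assumes "analytic_fun m N f" "openin (Euclidean_space m) N"
  shows "continuous_on N f"
  unfolding continuous_on_def
proof (intro ballI tendstoI)
  fix a and e :: real assume a: "a \<in> N" and e: "e > 0"
  obtain \<rho> c S where \<rho>: "\<rho> > 0"
    and S: "((\<lambda>\<alpha>. \<bar>c \<alpha>\<bar> * (\<Prod>i<m. \<rho> ^ \<alpha> i)) has_sum S) (multi_indices m)"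
    and c: "\<forall>x\<in>RR m. (\<forall>i<m. \<bar>x i - a i\<bar> \<le> \<rho>) \<longrightarrow> x \<in> N \<and>
        ((\<lambda>\<alpha>. c \<alpha> * (\<Prod>i<m. (x i - a i) ^ \<alpha> i)) has_sum f x) (multi_indices m)"
    using analytic_expansion[OF assms a] by blast
  have N: "N \<subseteq> RR m" using assms(2) openin_subset by blast
  have Lip: "\<bar>f x - f a\<bar> \<le> \<delta> / \<rho> * S"
    if x: "x \<in> N" "\<And>i. i < m \<Longrightarrow> \<bar>x i - a i\<bar> \<le> \<delta>" and \<delta>: "0 < \<delta>" "\<delta> \<le> \<rho>" for x \<delta>
  proof (rule has_sum_abs_le)
    have sx: "((\<lambda>\<alpha>. c \<alpha> * (\<Prod>i<m. (x i - a i) ^ \<alpha> i)) has_sum f x) (multi_indices m)"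
      using c[rule_format, of x] x \<delta> N by force
    have sa: "((\<lambda>\<alpha>. c \<alpha> * (\<Prod>i<m. (a i - a i) ^ \<alpha> i)) has_sum f a) (multi_indices m)"
      using c[rule_format, of a] a N \<rho> by auto
    show "((\<lambda>\<alpha>. c \<alpha> * (\<Prod>i<m. (x i - a i) ^ \<alpha> i) + - (c \<alpha> * (\<Prod>i<m. (a i - a i) ^ \<alpha> i))) has_sum f x - f a) (multi_indices m)"
      using has_sum_add[OF sx has_sum_uminusI[OF sa]] by simp
    show "((\<lambda>\<alpha>. \<delta> / \<rho> * (\<bar>c \<alpha>\<bar> * (\<Prod>i<m. \<rho> ^ \<alpha> i))) has_sum \<delta> / \<rho> * S) (multi_indices m)"
      by (rule has_sum_cmult_right[OF S])
    fix \<alpha> assume \<alpha>: "\<alpha> \<in> multi_indices m"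
    show "\<bar>c \<alpha> * (\<Prod>i<m. (x i - a i) ^ \<alpha> i) + - (c \<alpha> * (\<Prod>i<m. (a i - a i) ^ \<alpha> i))\<bar>
        \<le> \<delta> / \<rho> * (\<bar>c \<alpha>\<bar> * (\<Prod>i<m. \<rho> ^ \<alpha> i))"
    proof (cases "\<forall>j<m. \<alpha> j = 0")
      case True
      then show ?thesis using \<delta> \<rho> by simp
    next
      case False
      then obtain j where j: "j < m" "\<alpha> j \<noteq> 0" by blast
      have "(\<Prod>i<m. \<bar>x i - a i\<bar> ^ \<alpha> i) = \<bar>x j - a j\<bar> ^ \<alpha> j * (\<Prod>i\<in>{..<m}-{j}. \<bar>x i - a i\<bar> ^ \<alpha> i)"
        using j by (subst prod.remove[of _ j]) auto
      also have "\<dots> \<le> (\<delta> / \<rho> * \<rho> ^ \<alpha> j) * (\<Prod>i\<in>{..<m}-{j}. \<rho> ^ \<alpha> i)"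
      proof (rule mult_mono)
        have "\<bar>x j - a j\<bar> ^ \<alpha> j = \<bar>x j - a j\<bar> * \<bar>x j - a j\<bar> ^ (\<alpha> j - 1)"
          using j(2) by (simp add: power_eq_if)
        also have "\<dots> \<le> \<delta> * \<rho> ^ (\<alpha> j - 1)"
          using x(2)[OF j(1)] \<delta> by (intro mult_mono power_mono) auto
        also have "\<dots> = \<delta> / \<rho> * \<rho> ^ \<alpha> j" using j(2) \<rho> by (simp add: power_eq_if)
        finally show "\<bar>x j - a j\<bar> ^ \<alpha> j \<le> \<delta> / \<rho> * \<rho> ^ \<alpha> j" .
        show "(\<Prod>i\<in>{..<m}-{j}. \<bar>x i - a i\<bar> ^ \<alpha> i) \<le> (\<Prod>i\<in>{..<m}-{j}. \<rho> ^ \<alpha> i)"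
          by (intro prod_mono conjI power_mono) (use x(2) \<delta> in \<open>force+\<close>)
      qed (use \<delta> \<rho> in \<open>auto intro!: prod_nonneg\<close>)
      also have "\<dots> = \<delta> / \<rho> * (\<Prod>i<m. \<rho> ^ \<alpha> i)"
        using j by (subst (2) prod.remove[of _ j]) auto
      finally have le: "\<bar>\<Prod>i<m. (x i - a i) ^ \<alpha> i\<bar> \<le> \<delta> / \<rho> * (\<Prod>i<m. \<rho> ^ \<alpha> i)"
        by (simp add: abs_prod power_abs)
      have z: "(\<Prod>i<m. (a i - a i) ^ \<alpha> i) = 0" using j by (auto intro!: bexI[of _ j])
      show ?thesis unfolding z
        using mult_left_mono[OF le abs_ge_zero[of "c \<alpha>"]] by (simp add: abs_mult mult_ac)
    qed
  qed
  define \<delta> where "\<delta> = min \<rho> (e * \<rho> / (2 * (\<bar>S\<bar> + 1)))"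
  have \<delta>: "\<delta> > 0" "\<delta> \<le> \<rho>" using \<rho> e by (auto simp: \<delta>_def)
  have "\<delta> / \<rho> * S \<le> \<delta> / \<rho> * (\<bar>S\<bar> + 1)" using \<delta> \<rho> by (intro mult_left_mono) auto
  also have "\<dots> \<le> (e * \<rho> / (2 * (\<bar>S\<bar> + 1))) / \<rho> * (\<bar>S\<bar> + 1)"
    using \<rho> by (intro mult_right_mono divide_right_mono) (auto simp: \<delta>_def)
  also have "\<dots> = e / 2"
  proof -
    have *: "(e * \<rho> / (2 * q)) / \<rho> * q = e / 2" if "q > 0" for q using \<rho> that by (simp add: field_simps)
    show ?thesis by (rule *) linarith
  qed
  also have "\<dots> < e" using e by simp
  finally have small: "\<delta> / \<rho> * S < e" .
  have "eventually (\<lambda>x. \<bar>x i - a i\<bar> < \<delta>) (at a within N)" for i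
  proof -
    have "((\<lambda>x. x i) \<longlongrightarrow> a i) (at a within N)"
      using continuous_on_product_then_coordinatewise[OF continuous_on_id, of N i] a
      by (simp add: continuous_on_def)
    then show ?thesis using \<delta>(1) by (simp add: tendsto_iff dist_real_def)
  qed
  then have "eventually (\<lambda>x. \<forall>i\<in>{..<m}. \<bar>x i - a i\<bar> < \<delta>) (at a within N)"
    by (intro eventually_ball_finite) auto
  moreover have "eventually (\<lambda>x. x \<in> N) (at a within N)" by (simp add: eventually_at_filter)
  ultimately show "\<forall>\<^sub>F x in at a within N. dist (f x) (f a) < e"
  proof eventually_elim
    case (elim x)
    then have "\<bar>f x - f a\<bar> \<le> \<delta> / \<rho> * S" by (intro Lip \<delta>) (auto simp: less_imp_le)
    then show ?case using small by (simp add: dist_real_def)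
  qed
qed

lemma pred_times_le: "real k * real (k - 1) \<le> 2 * 2 ^ k"
proof (induction k)
  case (Suc k)
  show ?case
  proof (cases "k \<ge> 3")
    case True
    then have "real (Suc k) * real k \<le> 2 * (real k * real (k - 1))"
      by (simp add: of_nat_diff algebra_simps)
    then show ?thesis using Suc by simp
  next
    case False
    then have "k = 0 \<or> k = 1 \<or> k = 2" by auto
    then show ?thesis by auto
  qed
qed simp

text \<open>Halving the radius makes room for the factor \<open>k \<le> 2 ^ k\<close> that comes from differentiation.\<close>

lemma power_derivative_bound:
  fixes v \<rho> :: real
  assumes "\<bar>v\<bar> \<le> \<rho> / 2" "\<rho> > 0"
  shows "\<bar>real k * v ^ (k - 1)\<bar> \<le> 2 / \<rho> * \<rho> ^ k"
proof (cases k)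
  case (Suc k')
  have "\<bar>real k * v ^ (k - 1)\<bar> \<le> 2 ^ k * (\<rho> / 2) ^ (k - 1)"
    unfolding abs_mult power_abs using assms less_exp[of k]
    by (intro mult_mono power_mono) (auto simp: of_nat_less_two_power less_imp_le)
  also have "\<dots> = 2 / \<rho> * \<rho> ^ k" using assms(2) by (simp add: Suc power_divide)
  finally show ?thesis .
qed (use assms in simp)

text \<open>Again the radius is halved, now to absorb the factor \<open>k * (k - 1)\<close> in the second order
  remainder.\<close>

lemma power_taylor_bound:
  fixes v w \<rho> :: real
  assumes "\<bar>v\<bar> \<le> \<rho> / 2" "\<bar>w\<bar> \<le> \<rho> / 2" "\<rho> > 0"
  shows "\<bar>w ^ k - v ^ k - (w - v) * (real k * v ^ (k - 1))\<bar> \<le> 8 / \<rho>\<^sup>2 * (w - v)\<^sup>2 * \<rho> ^ k"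
proof (cases "w = v \<or> k < 2")
  case True
  then have "w = v \<or> k = 0 \<or> k = 1" by auto
  then show ?thesis using assms(3) by auto
next
  case False
  define h where "h = w - v"
  have h: "h \<noteq> 0" "v + h = w" using False by (auto simp: h_def)
  have "norm (((v + h) ^ k - v ^ k) / h - of_nat k * v ^ (k - Suc 0))
      \<le> of_nat k * of_nat (k - Suc 0) * (\<rho> / 2) ^ (k - 2) * norm h"
    by (rule lemma_termdiff3) (use h assms in auto)
  also have "\<dots> \<le> 2 * 2 ^ k * (\<rho> / 2) ^ (k - 2) * norm h"
    using pred_times_le[of k] assms(3) by (intro mult_right_mono) auto
  also have "2 * 2 ^ k * (\<rho> / 2) ^ (k - 2) = 8 / \<rho>\<^sup>2 * \<rho> ^ k"
  proof -
    obtain k' where "k = k' + 2" using False by (metis add.commute le_add_diff_inverse not_less)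
    then show ?thesis using assms(3) by (simp add: power_divide power_add power2_eq_square)
  qed
  finally have *: "\<bar>(w ^ k - v ^ k) / h - real k * v ^ (k - 1)\<bar> \<le> 8 / \<rho>\<^sup>2 * \<rho> ^ k * \<bar>h\<bar>"
    using h by simp
  have "w ^ k - v ^ k - h * (real k * v ^ (k - 1)) = h * ((w ^ k - v ^ k) / h - real k * v ^ (k - 1))"
    using h by (simp add: field_simps)
  then have "\<bar>w ^ k - v ^ k - h * (real k * v ^ (k - 1))\<bar> = \<bar>h\<bar> * \<bar>(w ^ k - v ^ k) / h - real k * v ^ (k - 1)\<bar>"
    by (simp only: abs_mult)
  also have "\<dots> \<le> \<bar>h\<bar> * (8 / \<rho>\<^sup>2 * \<rho> ^ k * \<bar>h\<bar>)"
    by (rule mult_left_mono[OF * abs_ge_zero])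
  also have "\<dots> = 8 / \<rho>\<^sup>2 * h\<^sup>2 * \<rho> ^ k" by (simp add: power2_eq_square abs_mult_self_eq mult_ac)
  finally show ?thesis by (simp add: h_def)
qed

lemma real_derivative_if_quadratic_remainder:
  fixes f :: "real \<Rightarrow> real"
  assumes "eventually (\<lambda>t. \<bar>f t - f x - (t - x) * s\<bar> \<le> C * (t - x)\<^sup>2) (at x)"
  shows "(f has_real_derivative s) (at x)"
proof -
  have "((\<lambda>t. (f t - f x) / (t - x) - s) \<longlongrightarrow> 0) (at x)"
  proof (rule Lim_null_comparison)
    show "\<forall>\<^sub>F t in at x. norm ((f t - f x) / (t - x) - s) \<le> C * \<bar>t - x\<bar>"
      using assms eventually_neq_at_within[of x]
    proof eventually_elim
      case (elim t)
      have "(f t - f x) / (t - x) - s = (f t - f x - (t - x) * s) / (t - x)"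
        using elim(2) by (simp add: field_simps)
      then have "\<bar>(f t - f x) / (t - x) - s\<bar> \<le> C * (t - x)\<^sup>2 / \<bar>t - x\<bar>"
        using elim by (simp add: divide_right_mono)
      also have "\<dots> = C * \<bar>t - x\<bar>"
        using elim(2) by (simp add: power2_eq_square field_simps flip: abs_mult)
      finally show ?case by simp
    qed
    have "((\<lambda>t. C * \<bar>t - x\<bar>) \<longlongrightarrow> C * \<bar>x - x\<bar>) (at x)" by (intro tendsto_intros)
    then show "((\<lambda>t. C * \<bar>t - x\<bar>) \<longlongrightarrow> 0) (at x)" by simp
  qed
  then show ?thesis by (simp add: has_field_derivative_iff LIM_zero_iff)
qed

text \<open>The termwise derivative converges on half the box, and the remainders of the monomials sum
  to at most a constant times the square of the increment. Shifting the exponent of the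
  differentiated variable turns the derived series into a power series, so the derivative is
  analytic again.\<close>

lemma analytic_partial_derivative:
  assumes f: "analytic_fun m N f" and N: "openin (Euclidean_space m) N" and i: "i < m"
  obtains g where "analytic_fun m N g"
    "\<And>x. x \<in> N \<Longrightarrow> ((\<lambda>t. f (x(i := t))) has_real_derivative g x) (at (x i))"
proof -
  \<comment> \<open>The local computation at different points must yield one function on \<open>N\<close>; hence the
    definite description.\<close>
  define g where "g x = (THE d. ((\<lambda>t. f (x(i := t))) has_real_derivative d) (at (x i)))" for x
  have NR: "N \<subseteq> RR m" using N openin_subset by blast
  have main: "\<exists>r>0. \<exists>d. \<forall>x\<in>N. (\<forall>j<m. \<bar>x j - a j\<bar> < r) \<longrightarrow>
      ((\<lambda>\<beta>. d \<beta> * (\<Prod>j<m. (x j - a j) ^ \<beta> j)) has_sum g x) (multi_indices m) \<and>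
      ((\<lambda>t. f (x(i := t))) has_real_derivative g x) (at (x i))" if a: "a \<in> N" for a
  proof -
    obtain \<rho> c S where \<rho>: "\<rho> > 0"
      and S: "((\<lambda>\<alpha>. \<bar>c \<alpha>\<bar> * (\<Prod>i<m. \<rho> ^ \<alpha> i)) has_sum S) (multi_indices m)"
      and c: "\<forall>x\<in>RR m. (\<forall>i<m. \<bar>x i - a i\<bar> \<le> \<rho>) \<longrightarrow> x \<in> N \<and>
          ((\<lambda>\<alpha>. c \<alpha> * (\<Prod>i<m. (x i - a i) ^ \<alpha> i)) has_sum f x) (multi_indices m)"
      using analytic_expansion[OF f N a] by blast
    define d where "d \<beta> = c (\<beta>(i := Suc (\<beta> i))) * real (Suc (\<beta> i))" for \<beta>
    have "((\<lambda>\<beta>. d \<beta> * (\<Prod>j<m. (x j - a j) ^ \<beta> j)) has_sum g x) (multi_indices m) \<and>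
      ((\<lambda>t. f (x(i := t))) has_real_derivative g x) (at (x i))"
      if x: "x \<in> N" "\<forall>j<m. \<bar>x j - a j\<bar> < \<rho> / 2" for x
    proof -
      have xi: "\<bar>x i - a i\<bar> < \<rho> / 2" using x(2) i by blast
      define M where "M \<alpha> = (\<Prod>j\<in>{..<m}-{i}. (x j - a j) ^ \<alpha> j)" for \<alpha>
      define R where "R \<alpha> = (\<Prod>j\<in>{..<m}-{i}. \<rho> ^ \<alpha> j)" for \<alpha> :: "nat \<Rightarrow> nat"
      have MR: "\<bar>M \<alpha>\<bar> \<le> R \<alpha>" for \<alpha>
        unfolding M_def R_def abs_prod power_abs
        by (intro prod_mono conjI power_mono) (use x(2) \<rho> in \<open>force+\<close>)
      have R0: "R \<alpha> \<ge> 0" for \<alpha> using \<rho> by (auto simp: R_def intro!: prod_nonneg)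
      have Req: "(\<Prod>j<m. \<rho> ^ \<alpha> j) = \<rho> ^ \<alpha> i * R \<alpha>" for \<alpha> :: "nat \<Rightarrow> nat"
        unfolding R_def using i by (subst prod.remove[of _ i]) auto
      have sf: "((\<lambda>\<alpha>. c \<alpha> * ((t - a i) ^ \<alpha> i * M \<alpha>)) has_sum f (x(i := t))) (multi_indices m)"
        if "\<bar>t - a i\<bar> \<le> \<rho>" for t
      proof -
        have "((\<lambda>\<alpha>. c \<alpha> * (\<Prod>j<m. ((x(i := t)) j - a j) ^ \<alpha> j)) has_sum f (x(i := t))) (multi_indices m)"
        proof (rule c[rule_format, THEN conjunct2])
          show "x(i := t) \<in> RR m" using x(1) NR i by (force simp: RR_iff)
          show "\<bar>(x(i := t)) j - a j\<bar> \<le> \<rho>" if "j < m" for j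
            using that \<open>\<bar>t - a i\<bar> \<le> \<rho>\<close> x(2) \<rho> by force
        qed
        moreover have "(\<Prod>j<m. ((x(i := t)) j - a j) ^ \<alpha> j) = (t - a i) ^ \<alpha> i * M \<alpha>" for \<alpha>
        proof -
          have "(\<Prod>j\<in>{..<m}-{i}. ((x(i := t)) j - a j) ^ \<alpha> j) = M \<alpha>"
            unfolding M_def by (intro prod.cong) auto
          then show ?thesis using i by (subst prod.remove[of _ i]) auto
        qed
        ultimately show ?thesis by simp
      qed
      define T where "T \<alpha> = c \<alpha> * (real (\<alpha> i) * (x i - a i) ^ (\<alpha> i - 1)) * M \<alpha>" for \<alpha>
      have Tle: "\<bar>T \<alpha>\<bar> \<le> 2 / \<rho> * (\<bar>c \<alpha>\<bar> * (\<Prod>j<m. \<rho> ^ \<alpha> j))" for \<alpha>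
      proof -
        have "\<bar>T \<alpha>\<bar> = \<bar>c \<alpha>\<bar> * (\<bar>real (\<alpha> i) * (x i - a i) ^ (\<alpha> i - 1)\<bar> * \<bar>M \<alpha>\<bar>)"
          by (simp add: T_def abs_mult)
        also have "\<dots> \<le> \<bar>c \<alpha>\<bar> * ((2 / \<rho> * \<rho> ^ \<alpha> i) * R \<alpha>)"
          using MR xi \<rho> by (intro mult_left_mono mult_mono power_derivative_bound) auto
        finally show ?thesis by (simp add: Req mult_ac)
      qed
      have "(\<lambda>\<alpha>. norm (T \<alpha>)) summable_on (multi_indices m)"
        by (rule Infinite_Sum.abs_summable_on_comparison_test'[OF summable_on_cmult_right[OF has_sum_imp_summable[OF S], of "2 / \<rho>"]])
          (use Tle in simp)
      then obtain s where s: "(T has_sum s) (multi_indices m)"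
        using Infinite_Sum.abs_summable_summable has_sum_infsum by blast
      have "eventually (\<lambda>t. \<bar>t - a i\<bar> < \<rho> / 2) (at (x i))"
      proof (rule order_tendstoD(2))
        show "((\<lambda>t. \<bar>t - a i\<bar>) \<longlongrightarrow> \<bar>x i - a i\<bar>) (at (x i))" by (intro tendsto_intros)
      qed (rule xi)
      then have "eventually (\<lambda>t. \<bar>f (x(i := t)) - f (x(i := x i)) - (t - x i) * s\<bar> \<le> (8 / \<rho>\<^sup>2 * S) * (t - x i)\<^sup>2) (at (x i))"
      proof eventually_elim
        case (elim t)
        show ?case
        proof (rule has_sum_abs_le)
          show "((\<lambda>\<alpha>. c \<alpha> * ((t - a i) ^ \<alpha> i * M \<alpha>) + - (c \<alpha> * ((x i - a i) ^ \<alpha> i * M \<alpha>)) + - ((t - x i) * T \<alpha>))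
              has_sum f (x(i := t)) - f (x(i := x i)) - (t - x i) * s) (multi_indices m)"
            using has_sum_add[OF has_sum_add[OF sf has_sum_uminusI[OF sf]] has_sum_uminusI[OF has_sum_cmult_right[OF s]], of t "x i" "t - x i"]
              elim xi \<rho> by simp
          show "((\<lambda>\<alpha>. (8 / \<rho>\<^sup>2 * (t - x i)\<^sup>2) * (\<bar>c \<alpha>\<bar> * (\<Prod>j<m. \<rho> ^ \<alpha> j))) has_sum 8 / \<rho>\<^sup>2 * S * (t - x i)\<^sup>2) (multi_indices m)"
            using has_sum_cmult_right[OF S, of "8 / \<rho>\<^sup>2 * (t - x i)\<^sup>2"] by (simp add: mult_ac)
          fix \<alpha> :: "nat \<Rightarrow> nat"
          have "c \<alpha> * ((t - a i) ^ \<alpha> i * M \<alpha>) + - (c \<alpha> * ((x i - a i) ^ \<alpha> i * M \<alpha>)) + - ((t - x i) * T \<alpha>)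
             = c \<alpha> * (((t - a i) ^ \<alpha> i - (x i - a i) ^ \<alpha> i - ((t - a i) - (x i - a i)) * (real (\<alpha> i) * (x i - a i) ^ (\<alpha> i - 1))) * M \<alpha>)"
            by (simp add: T_def algebra_simps)
          also have "\<bar>\<dots>\<bar> \<le> \<bar>c \<alpha>\<bar> * ((8 / \<rho>\<^sup>2 * ((t - a i) - (x i - a i))\<^sup>2 * \<rho> ^ \<alpha> i) * R \<alpha>)"
            unfolding abs_mult[of "c \<alpha>"] abs_mult[of _ "M \<alpha>"]
            using MR xi \<rho> elim by (intro mult_left_mono mult_mono power_taylor_bound) auto
          finally show "\<bar>c \<alpha> * ((t - a i) ^ \<alpha> i * M \<alpha>) + - (c \<alpha> * ((x i - a i) ^ \<alpha> i * M \<alpha>)) + - ((t - x i) * T \<alpha>)\<bar>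
              \<le> 8 / \<rho>\<^sup>2 * (t - x i)\<^sup>2 * (\<bar>c \<alpha>\<bar> * (\<Prod>j<m. \<rho> ^ \<alpha> j))"
            by (simp add: Req mult_ac)
        qed
      qed
      then have der: "((\<lambda>t. f (x(i := t))) has_real_derivative s) (at (x i))"
        by (rule real_derivative_if_quadratic_remainder)
      then have gs: "g x = s" unfolding g_def using DERIV_unique by (intro the_equality) auto
      have "((\<lambda>\<beta>. d \<beta> * (\<Prod>j<m. (x j - a j) ^ \<beta> j)) has_sum s) (multi_indices m)
          \<longleftrightarrow> (T has_sum s) {\<alpha> \<in> multi_indices m. \<alpha> i \<noteq> 0}"
      proof (rule has_sum_reindex_bij_witness[where j = "\<lambda>\<beta>. \<beta>(i := Suc (\<beta> i))" and i = "\<lambda>\<alpha>. \<alpha>(i := \<alpha> i - 1)"])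
        fix \<beta> :: "nat \<Rightarrow> nat"
        have "M (\<beta>(i := Suc (\<beta> i))) = M \<beta>" unfolding M_def by (intro prod.cong) auto
        moreover have "(\<Prod>j<m. (x j - a j) ^ \<beta> j) = (x i - a i) ^ \<beta> i * M \<beta>"
          unfolding M_def using i by (subst prod.remove[of _ i]) auto
        ultimately show "T (\<beta>(i := Suc (\<beta> i))) = d \<beta> * (\<Prod>j<m. (x j - a j) ^ \<beta> j)"
          by (simp add: T_def d_def)
      qed (use i in \<open>auto simp: fun_eq_iff\<close>)
      also have "\<dots> \<longleftrightarrow> (T has_sum s) (multi_indices m)"
        by (rule has_sum_cong_neutral) (auto simp: T_def)
      finally show ?thesis using s der gs by simp
    qed
    then show ?thesis using \<rho> by (intro exI[of _ "\<rho> / 2"] conjI exI[of _ d]) auto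
  qed
  have "analytic_fun m N g" unfolding analytic_fun_def using main by meson
  moreover have "((\<lambda>t. f (x(i := t))) has_real_derivative g x) (at (x i))" if x: "x \<in> N" for x
  proof -
    obtain r d where "r > 0" "\<forall>y\<in>N. (\<forall>j<m. \<bar>y j - x j\<bar> < r) \<longrightarrow>
      ((\<lambda>\<beta>. d \<beta> * (\<Prod>j<m. (y j - x j) ^ \<beta> j)) has_sum g y) (multi_indices m) \<and>
      ((\<lambda>t. f (y(i := t))) has_real_derivative g y) (at (y i))" using main[OF x] by blast
    then show ?thesis using x by simp
  qed
  ultimately show ?thesis using that by blast
qed

lemma analytic_imp_Ck:
  assumes "analytic_fun m N f" "openin (Euclidean_space m) N" shows "Ck_fun m N r f"
proof -
  have N: "N \<subseteq> RR m" using assms(2) openin_subset by blast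
  show ?thesis using assms(1)
  proof (induction r arbitrary: f)
    case 0
    then show ?case using analytic_continuous_on assms(2) Ck_0_iff[OF N] by blast
  next
    case (Suc r)
    show ?case unfolding Ck_Suc_iff[OF N]
      using Suc analytic_continuous_on[OF Suc.prems assms(2)] analytic_partial_derivative[OF Suc.prems assms(2)]
      by metis
  qed
qed

section \<open>Smooth maps between subsets of Euclidean spaces\<close>

lemma regular_map_subset:
  assumes "regular_map \<rho> m n S f" "S' \<subseteq> S" shows "regular_map \<rho> m n S' f"
  unfolding regular_map_def
proof (intro conjI ballI)
  fix a assume "a \<in> S'"
  then obtain N g where "openin (Euclidean_space m) N" "a \<in> N"
      "\<forall>i<n. regular_fun \<rho> m N (\<lambda>x. g x i)" "\<forall>x\<in>S \<inter> N. \<forall>i<n. f x i = g x i"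
    using assms unfolding regular_map_def by blast
  then show "\<exists>N g. openin (Euclidean_space m) N \<and> a \<in> N \<and>
      (\<forall>i<n. regular_fun \<rho> m N (\<lambda>x. g x i)) \<and> (\<forall>x\<in>S' \<inter> N. \<forall>i<n. f x i = g x i)"
    using assms(2) by (intro exI[of _ N] exI[of _ g]) auto
qed (use assms in \<open>auto simp: regular_map_def\<close>)

lemma regular_map_analytic_imp_smooth:
  assumes "regular_map Analytic m n S f" shows "regular_map Smooth m n S f"
  unfolding regular_map_def
proof (intro conjI ballI)
  fix a assume "a \<in> S"
  then obtain N g where N: "openin (Euclidean_space m) N" "a \<in> N"
      "\<forall>i<n. regular_fun Analytic m N (\<lambda>x. g x i)" "\<forall>x\<in>S \<inter> N. \<forall>i<n. f x i = g x i"
    using assms unfolding regular_map_def by blast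
  then have "\<forall>i<n. regular_fun Smooth m N (\<lambda>x. g x i)" using analytic_imp_Ck by simp
  then show "\<exists>N g. openin (Euclidean_space m) N \<and> a \<in> N \<and>
      (\<forall>i<n. regular_fun Smooth m N (\<lambda>x. g x i)) \<and> (\<forall>x\<in>S \<inter> N. \<forall>i<n. f x i = g x i)"
    using N by blast
qed (use assms in \<open>auto simp: regular_map_def\<close>)

text \<open>A map into \<open>RR n\<close> is smooth if and only if each of its components is, which reduces the
  smoothness of maps to this notion.\<close>

definition smooth_on :: "nat \<Rightarrow> (nat \<Rightarrow> real) set \<Rightarrow> ((nat \<Rightarrow> real) \<Rightarrow> real) \<Rightarrow> bool" where
  "smooth_on m S f \<longleftrightarrow> (\<forall>a\<in>S. \<exists>N g. openin (Euclidean_space m) N \<and> a \<in> N \<and>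
      (\<forall>r. Ck_fun m N r g) \<and> (\<forall>x\<in>S \<inter> N. f x = g x))"

lemma smooth_on_cong:
  assumes "smooth_on m S f" "\<And>x. x \<in> S \<Longrightarrow> f x = g x" shows "smooth_on m S g"
  using assms(1) unfolding smooth_on_def by (simp add: assms(2))

lemma smooth_on_subset:
  assumes "smooth_on m S f" "S' \<subseteq> S" shows "smooth_on m S' f"
  unfolding smooth_on_def
proof
  fix a assume "a \<in> S'"
  then have "a \<in> S" using assms(2) by blast
  from bspec[OF assms(1)[unfolded smooth_on_def] this]
  obtain N g where "openin (Euclidean_space m) N" "a \<in> N" "\<forall>r. Ck_fun m N r g" "\<forall>x\<in>S \<inter> N. f x = g x"
    by (elim exE conjE)
  then show "\<exists>N g. openin (Euclidean_space m) N \<and> a \<in> N \<and> (\<forall>r. Ck_fun m N r g) \<and> (\<forall>x\<in>S' \<inter> N. f x = g x)"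
    using assms(2) by (intro exI[of _ N] exI[of _ g]) auto
qed

lemma regular_map_smooth_iff:
  "regular_map Smooth m n S f \<longleftrightarrow>
     S \<subseteq> RR m \<and> f ` S \<subseteq> RR n \<and> (\<forall>i<n. smooth_on m S (\<lambda>x. f x i))"
proof
  assume R: "regular_map Smooth m n S f"
  show "S \<subseteq> RR m \<and> f ` S \<subseteq> RR n \<and> (\<forall>i<n. smooth_on m S (\<lambda>x. f x i))"
  proof (intro conjI allI impI)
    fix i assume "i < n"
    show "smooth_on m S (\<lambda>x. f x i)" unfolding smooth_on_def
    proof
      fix a assume "a \<in> S"
      then obtain N g where N: "openin (Euclidean_space m) N" "a \<in> N"
          "\<forall>i<n. \<forall>r. Ck_fun m N r (\<lambda>x. g x i)" "\<forall>x\<in>S \<inter> N. \<forall>i<n. f x i = g x i"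
        using R unfolding regular_map_def regular_fun.simps by blast
      then show "\<exists>N h. openin (Euclidean_space m) N \<and> a \<in> N \<and> (\<forall>r. Ck_fun m N r h) \<and> (\<forall>x\<in>S \<inter> N. f x i = h x)"
        using \<open>i < n\<close> by (intro exI[of _ N] exI[of _ "\<lambda>x. g x i"]) auto
    qed
  qed (use R in \<open>auto simp: regular_map_def\<close>)
next
  assume R: "S \<subseteq> RR m \<and> f ` S \<subseteq> RR n \<and> (\<forall>i<n. smooth_on m S (\<lambda>x. f x i))"
  show "regular_map Smooth m n S f" unfolding regular_map_def
  proof (intro conjI ballI)
    fix a assume a: "a \<in> S"
    have "\<exists>N g. openin (Euclidean_space m) N \<and> a \<in> N \<and>
      (\<forall>r. Ck_fun m N r g) \<and> (\<forall>x\<in>S \<inter> N. f x i = g x)" if "i < n" for i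
      using R a that unfolding smooth_on_def by blast
    then obtain N g where Ng: "\<And>i. i < n \<Longrightarrow> openin (Euclidean_space m) (N i) \<and> a \<in> N i \<and>
      (\<forall>r. Ck_fun m (N i) r (g i)) \<and> (\<forall>x\<in>S \<inter> N i. f x i = g i x)" by metis
    \<comment> \<open>The components may be extended to different neighbourhoods; the intersection serves all
      of them. The factor \<open>RR m\<close> accounts for \<open>n = 0\<close>.\<close>
    define N' where "N' = RR m \<inter> (\<Inter>i<n. N i)"
    have "openin (Euclidean_space m) N'"
    proof (cases "n = 0")
      case False
      then have "openin (Euclidean_space m) (\<Inter>i<n. N i)" using Ng by (intro openin_Inter) auto
      then show ?thesis unfolding N'_def by blast
    qed (simp add: N'_def)
    moreover have "a \<in> N'" using Ng a R by (auto simp: N'_def)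
    moreover have "Ck_fun m N' r (g i)" if "i < n" for i r
    proof (rule Ck_subset[of m "N i"])
      show "N i \<subseteq> RR m" using Ng[OF that] openin_subset by blast
    qed (use Ng that in \<open>auto simp: N'_def\<close>)
    ultimately show "\<exists>N g. openin (Euclidean_space m) N \<and> a \<in> N \<and>
        (\<forall>i<n. regular_fun Smooth m N (\<lambda>x. g x i)) \<and> (\<forall>x\<in>S \<inter> N. \<forall>i<n. f x i = g x i)"
      using Ng by (intro exI[of _ N'] exI[of _ "\<lambda>x i. g i x"]) (auto simp: N'_def)
  qed (use R in auto)
qed

lemma regular_map_continuous_on:
  assumes "regular_map Smooth m n S f" shows "continuous_on S f"
proof (rule continuous_on_coordinatewise_then_product)
  have R: "S \<subseteq> RR m \<and> f ` S \<subseteq> RR n \<and> (\<forall>i<n. smooth_on m S (\<lambda>x. f x i))"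
    using assms regular_map_smooth_iff by blast
  fix i show "continuous_on S (\<lambda>x. f x i)"
  proof (cases "i < n")
    case True
    show ?thesis unfolding continuous_on_eq_continuous_within
    proof
      fix a assume a: "a \<in> S"
      obtain N g where Ng: "openin (Euclidean_space m) N" "a \<in> N" "\<And>r. Ck_fun m N r g"
         "\<forall>x\<in>S \<inter> N. f x i = g x" using R a True unfolding smooth_on_def by blast
      obtain G where G: "open G" "N = RR m \<inter> G" using Ng(1) openin_RR by blast
      have "continuous_on N g" using Ck_continuous[OF Ng(3)] Ng(1) openin_subset by blast
      then have "continuous_on (S \<inter> G) g" by (rule continuous_on_subset) (use G R in auto)
      then have "continuous_on (S \<inter> G) (\<lambda>x. f x i)"
        using continuous_on_cong[of "S \<inter> G" "S \<inter> G" "\<lambda>x. f x i" g] Ng(4) G R by blast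
      then have "continuous (at a within S \<inter> G) (\<lambda>x. f x i)"
        using a G Ng(2) by (simp add: continuous_on_eq_continuous_within)
      then show "continuous (at a within S) (\<lambda>x. f x i)"
        using at_within_nhd[of a G "S \<inter> G" S] G Ng(2) by (auto simp: continuous_within)
    qed
  next
    case False
    then have "f x i = 0" if "x \<in> S" for x using R that by (auto simp: RR_iff image_subset_iff)
    then show ?thesis using continuous_on_cong[of S S "\<lambda>x. f x i" "\<lambda>x. 0"] by simp
  qed
qed

lemma smooth_on_compose:
  assumes f: "regular_map Smooth m n S f" and g: "smooth_on n S' g" and sub: "f ` S \<subseteq> S'"
  shows "smooth_on m S (\<lambda>x. g (f x))"
  unfolding smooth_on_def
proof
  fix a assume a: "a \<in> S"
  have fRR: "f x \<in> RR n" "x \<in> RR m" if "x \<in> S" for x using f that unfolding regular_map_def by blast+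
  obtain N F where N: "openin (Euclidean_space m) N" "a \<in> N"
      and F: "\<forall>i<n. \<forall>r. Ck_fun m N r (\<lambda>x. F x i)" "\<forall>x\<in>S \<inter> N. \<forall>i<n. f x i = F x i"
    using f a unfolding regular_map_def regular_fun.simps by blast
  obtain N' G where N': "openin (Euclidean_space n) N'" "f a \<in> N'"
      and G: "\<forall>r. Ck_fun n N' r G" "\<forall>y\<in>S' \<inter> N'. g y = G y"
  proof -
    have "f a \<in> S'" using a sub by blast
    then show ?thesis using g that unfolding smooth_on_def by blast
  qed
  have NR: "N \<subseteq> RR m" using N openin_subset by blast
  have padF: "pad n (F x) = f x" if "x \<in> S \<inter> N" for x
    using F(2)[rule_format, OF that] fRR(1)[of x] that by (auto simp: pad_def fun_eq_iff RR_iff)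
  \<comment> \<open>Away from \<open>S\<close> the extension of \<open>f\<close> may leave the domain of the extension of \<open>g\<close>.\<close>
  define P where "P = {x \<in> N. pad n (F x) \<in> N'}"
  have "continuous_on N (\<lambda>x. pad n (F x))"
  proof (rule continuous_on_coordinatewise_then_product)
    fix i show "continuous_on N (\<lambda>x. pad n (F x) i)"
      using Ck_continuous[OF F(1)[rule_format] NR, of i] by (cases "i < n") (auto simp: pad_def)
  qed
  then have "openin (top_of_set N) (N \<inter> (\<lambda>x. pad n (F x)) -` N')"
  proof (rule continuous_openin_preimage)
    show "(\<lambda>x. pad n (F x)) \<in> N \<rightarrow> RR n" using pad_in_RR by blast
    show "openin (top_of_set (RR n)) N'" using N'(1) by (simp add: Euclidean_space_top_of_set)
  qed
  then have P: "openin (Euclidean_space m) P"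
    using N(1) unfolding Euclidean_space_top_of_set P_def vimage_def Int_def
    using openin_trans by (fastforce simp: Collect_conj_eq)
  have "Ck_fun m P r (\<lambda>x. G (pad n (F x)))" for r
    by (rule Ck_compose[OF P N'(1)]) (use F(1) G(1) NR P_def in \<open>auto intro: Ck_subset[of m N]\<close>)
  moreover have "a \<in> P" using padF a N(2) N'(2) by (simp add: P_def)
  moreover have "g (f x) = G (pad n (F x))" if "x \<in> S \<inter> P" for x
    using G(2)[rule_format, of "f x"] padF[of x] that sub by (auto simp: P_def)
  ultimately show "\<exists>N h. openin (Euclidean_space m) N \<and> a \<in> N \<and> (\<forall>r. Ck_fun m N r h) \<and> (\<forall>x\<in>S \<inter> N. g (f x) = h x)"
    using P by (intro exI[of _ P] exI[of _ "\<lambda>x. G (pad n (F x))"]) auto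
qed

lemma regular_map_compose:
  assumes f: "regular_map Smooth m n S f" and g: "regular_map Smooth n p S' g" and sub: "f ` S \<subseteq> S'"
  shows "regular_map Smooth m p S (g \<circ> f)"
proof -
  have "S \<subseteq> RR m" using f by (simp add: regular_map_def)
  moreover have "(g \<circ> f) ` S \<subseteq> RR p" using g sub by (auto simp: regular_map_def)
  moreover have "smooth_on m S (\<lambda>x. (g \<circ> f) x i)" if "i < p" for i
    using smooth_on_compose[OF f _ sub, of "\<lambda>x. g x i"] g that regular_map_smooth_iff by auto
  ultimately show ?thesis by (simp add: regular_map_smooth_iff)
qed

lemma regular_map_cong:
  assumes "regular_map \<rho> m n S f" "\<And>x. x \<in> S \<Longrightarrow> f x = g x" shows "regular_map \<rho> m n S g"
  unfolding regular_map_def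
proof (intro conjI ballI)
  fix a assume "a \<in> S"
  then obtain N h where "openin (Euclidean_space m) N" "a \<in> N"
      "\<forall>i<n. regular_fun \<rho> m N (\<lambda>x. h x i)" "\<forall>x\<in>S \<inter> N. \<forall>i<n. f x i = h x i"
    using assms unfolding regular_map_def by blast
  then show "\<exists>N h. openin (Euclidean_space m) N \<and> a \<in> N \<and>
      (\<forall>i<n. regular_fun \<rho> m N (\<lambda>x. h x i)) \<and> (\<forall>x\<in>S \<inter> N. \<forall>i<n. g x i = h x i)"
    using assms(2) by (intro exI[of _ N] exI[of _ h]) auto
qed (use assms in \<open>auto simp: regular_map_def\<close>)

lemma smooth_on_local:
  assumes "\<And>a. a \<in> S \<Longrightarrow> \<exists>P. openin (Euclidean_space m) P \<and> a \<in> P \<and> smooth_on m (S \<inter> P) f"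
  shows "smooth_on m S f"
  unfolding smooth_on_def
proof
  fix a assume a: "a \<in> S"
  obtain P where P: "openin (Euclidean_space m) P" "a \<in> P" "smooth_on m (S \<inter> P) f" using assms a by blast
  then obtain N g where Ng: "openin (Euclidean_space m) N" "a \<in> N" "\<forall>r. Ck_fun m N r g" "\<forall>x\<in>S \<inter> P \<inter> N. f x = g x"
    using a unfolding smooth_on_def by blast
  show "\<exists>N g. openin (Euclidean_space m) N \<and> a \<in> N \<and> (\<forall>r. Ck_fun m N r g) \<and> (\<forall>x\<in>S \<inter> N. f x = g x)"
    using Ng P openin_subset[OF Ng(1)]
    by (intro exI[of _ "P \<inter> N"] exI[of _ g]) (auto intro: Ck_subset[of m N])
qed

lemma regular_map_local:
  assumes "S \<subseteq> RR m"
    "\<And>a. a \<in> S \<Longrightarrow> \<exists>P. openin (Euclidean_space m) P \<and> a \<in> P \<and> regular_map Smooth m n (S \<inter> P) f"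
  shows "regular_map Smooth m n S f"
proof -
  have "f a \<in> RR n" if a: "a \<in> S" for a
    using assms(2)[OF a] a unfolding regular_map_def by blast
  moreover have "smooth_on m S (\<lambda>x. f x i)" if "i < n" for i
  proof (rule smooth_on_local)
    fix a assume "a \<in> S"
    then obtain P where "openin (Euclidean_space m) P" "a \<in> P" "regular_map Smooth m n (S \<inter> P) f"
      using assms(2) by blast
    moreover from this have "smooth_on m (S \<inter> P) (\<lambda>x. f x i)"
      using that by (simp add: regular_map_smooth_iff)
    ultimately show "\<exists>P. openin (Euclidean_space m) P \<and> a \<in> P \<and> smooth_on m (S \<inter> P) (\<lambda>x. f x i)"
      by blast
  qed
  ultimately show ?thesis using assms(1) by (auto simp: regular_map_smooth_iff)
qed

lemma smooth_on_affine:
  assumes "S \<subseteq> RR m" shows "smooth_on m S (\<lambda>x. c + b * x l)"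
proof -
  have "Ck_fun m (RR m) r (\<lambda>x. c + b * x l)" for r
    by (intro Ck_add Ck_mult Ck_const Ck_coord subset_refl)
  then show ?thesis unfolding smooth_on_def using assms
    by (intro ballI exI[of _ "RR m"] exI[of _ "\<lambda>x. c + b * x l"]) auto
qed

lemma regular_map_affine:
  assumes "S \<subseteq> RR m" "f ` S \<subseteq> RR n"
    "\<And>i. i < n \<Longrightarrow> \<exists>c b l. \<forall>x\<in>S. f x i = c + b * x l"
  shows "regular_map Smooth m n S f"
  unfolding regular_map_smooth_iff
proof (intro conjI assms(1,2) allI impI)
  fix i assume "i < n"
  then obtain c b l where "\<forall>x\<in>S. f x i = c + b * x l" using assms(3) by blast
  then show "smooth_on m S (\<lambda>x. f x i)"
    using smooth_on_cong[OF smooth_on_affine[OF assms(1), of c b l]] by simp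
qed

lemma topspace_subtopology_RR: "S \<subseteq> RR m \<Longrightarrow> topspace (subtopology (Euclidean_space m) S) = S"
  by (simp add: Int_absorb1)

lemma continuous_map_RR_iff:
  "S \<subseteq> RR m \<Longrightarrow> continuous_map (subtopology (Euclidean_space m) S) (Euclidean_space n) f
     \<longleftrightarrow> continuous_on S f \<and> f ` S \<subseteq> RR n"
  by (auto simp: cm_Euclidean_space_iff_continuous_on topspace_subtopology_RR Pi_iff image_subset_iff
      simp del: topspace_subtopology)

lemma regular_map_continuous_map:
  assumes "regular_map Smooth m n S f"
  shows "continuous_map (subtopology (Euclidean_space m) S) (Euclidean_space n) f"
  using assms continuous_map_RR_iff regular_map_continuous_on by (auto simp: regular_map_def)

lemma RR_open_halfspace: "openin (Euclidean_space m) {x \<in> RR m. a < x i}" "openin (Euclidean_space m) {x \<in> RR m. x i < a}"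
proof -
  have "open {x::nat\<Rightarrow>real. a < x i}" "open {x::nat\<Rightarrow>real. x i < a}"
    by (intro open_Collect_less continuous_on_const continuous_on_product_then_coordinatewise[OF continuous_on_id])+
  then show "openin (Euclidean_space m) {x \<in> RR m. a < x i}" "openin (Euclidean_space m) {x \<in> RR m. x i < a}"
    unfolding openin_RR by (auto simp: Int_def)
qed

section \<open>Gluing along an involution\<close>

text \<open>Let \<open>B\<^sub>0, B\<^sub>1, \<dots>\<close> be the finite unions of sets of a countable base. A point \<open>p\<close> is sent to
  the sequence that records which \<open>B\<^sub>m\<close> contain its class. Classes are finite, so they are
  separated by these sets, and the fibres are exactly the classes. The points whose class lies
  inside a given open set form an open set, because \<open>\<tau>\<close> is continuous on a closed set; this
  yields the Hausdorff property and the countable base of the quotient.\<close>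

lemma glue_along_involution:
  fixes Z :: "'p topology"
  assumes Z: "compact_space Z" "Hausdorff_space Z" "second_countable Z"
    and B: "closedin Z B"
    and \<tau>: "continuous_map (subtopology Z B) (subtopology Z B) \<tau>" "\<And>p. p \<in> B \<Longrightarrow> \<tau> (\<tau> p) = p"
  obtains F :: "'p \<Rightarrow> nat \<Rightarrow> real" and Q where
    "Hausdorff_space Q" "second_countable Q" "compact_space Q" "quotient_map Z Q F"
    "\<And>p q. p \<in> topspace Z \<Longrightarrow> q \<in> topspace Z \<Longrightarrow> F p = F q \<longleftrightarrow> q = p \<or> (p \<in> B \<and> q = \<tau> p)"
proof -
  define cls where "cls p = insert p (if p \<in> B then {\<tau> p} else {})" for p
  have BZ: "B \<subseteq> topspace Z" using B closedin_subset by blast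
  have \<tau>B: "\<tau> p \<in> B" if "p \<in> B" for p
    using continuous_map_image_subset_topspace[OF \<tau>(1)] BZ that by auto
  have clsZ: "cls p \<subseteq> topspace Z" if "p \<in> topspace Z" for p
    using that \<tau>B BZ by (auto simp: cls_def)
  have cls_self: "p \<in> cls p" for p by (simp add: cls_def)
  have cls_eq: "q \<in> cls p \<longleftrightarrow> cls q = cls p" for p q
    using \<tau>B \<tau>(2) by (auto simp: cls_def)
  have fin: "finite (cls p)" for p by (simp add: cls_def)
  have open_sat: "openin Z {p \<in> topspace Z. cls p \<subseteq> V}" if V: "openin Z V" for V
  proof -
    define C where "C = topspace Z - V"
    have C: "closedin Z C" using closedin_diff[OF closedin_topspace V] by (simp add: C_def)
    have "closedin (subtopology Z B) {p \<in> topspace (subtopology Z B). \<tau> p \<in> C \<inter> B}"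
      by (rule closedin_continuous_map_preimage[OF \<tau>(1)]) (use C closedin_subtopology in blast)
    then have "closedin Z {p \<in> topspace (subtopology Z B). \<tau> p \<in> C \<inter> B}"
      using B closedin_trans_full by blast
    then have "closedin Z (C \<union> {p \<in> topspace (subtopology Z B). \<tau> p \<in> C \<inter> B})"
      using C by blast
    moreover have "topspace Z - (C \<union> {p \<in> topspace (subtopology Z B). \<tau> p \<in> C \<inter> B})
        = {p \<in> topspace Z. cls p \<subseteq> V}"
      using \<tau>B BZ openin_subset[OF V] by (auto simp: cls_def C_def)
    ultimately show ?thesis using openin_diff[OF openin_topspace] by metis
  qed
  obtain \<B> where \<B>: "countable \<B>" "\<And>V. V \<in> \<B> \<Longrightarrow> openin Z V"
      "\<And>U x. openin Z U \<Longrightarrow> x \<in> U \<Longrightarrow> \<exists>V\<in>\<B>. x \<in> V \<and> V \<subseteq> U"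
    using Z(3) unfolding second_countable_def by metis
  define \<U> where "\<U> = Union ` {\<G>. finite \<G> \<and> \<G> \<subseteq> \<B>}"
  have "countable \<U>" unfolding \<U>_def by (intro countable_image countable_Collect_finite_subset \<B>(1))
  moreover have "\<U> \<noteq> {}" by (auto simp: \<U>_def)
  ultimately obtain Bs :: "nat \<Rightarrow> 'p set" where Bs: "range Bs = \<U>"
    using uncountable_def by blast
  have Bs_open: "openin Z (Bs m)" for m
  proof -
    have "Bs m \<in> \<U>" using Bs by blast
    then obtain \<G> where "\<G> \<subseteq> \<B>" "Bs m = \<Union>\<G>" unfolding \<U>_def by (elim imageE CollectE conjE)
    then show ?thesis using \<B>(2) openin_Union[of \<G> Z] by auto
  qed
  have Bs_base: "\<exists>m. C \<subseteq> Bs m \<and> Bs m \<subseteq> V" if "finite C" "C \<subseteq> V" "openin Z V" for C V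
  proof -
    have "\<exists>B\<in>\<B>. x \<in> B \<and> B \<subseteq> V" if "x \<in> C" for x using \<B>(3) that \<open>C \<subseteq> V\<close> \<open>openin Z V\<close> by blast
    then obtain b where b: "\<And>x. x \<in> C \<Longrightarrow> b x \<in> \<B> \<and> x \<in> b x \<and> b x \<subseteq> V" by metis
    have "\<Union> (b ` C) \<in> \<U>" unfolding \<U>_def using that(1) b by blast
    then obtain m where "Bs m = \<Union> (b ` C)" using Bs by (metis imageE)
    then show ?thesis using b by blast
  qed
  define F where "F p = (\<lambda>m. if cls p \<subseteq> Bs m then 1 else 0 :: real)" for p
  have F_eq: "F p = F q \<longleftrightarrow> cls p = cls q" if pq: "p \<in> topspace Z" "q \<in> topspace Z" for p q
  proof
    assume eq: "F p = F q"
    show "cls p = cls q"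
    proof (rule ccontr)
      assume "cls p \<noteq> cls q"
      then have "q \<notin> cls p" using cls_eq by metis
      moreover have "openin Z (topspace Z - {q})"
        by (intro openin_diff openin_topspace) (simp add: closedin_Hausdorff_sing_eq[OF Z(2)] pq)
      ultimately obtain m where "cls p \<subseteq> Bs m" "Bs m \<subseteq> topspace Z - {q}"
        using Bs_base[OF fin, of p "topspace Z - {q}"] clsZ[OF pq(1)] by blast
      then have "F p m = 1" "F q m = 0" using cls_self[of q] by (auto simp: F_def)
      then show False using eq by simp
    qed
  qed (simp add: F_def)
  \<comment> \<open>The quotient topology on the image of \<open>F\<close>; it need not be related to the topology of
    sequences.\<close>
  define Q where "Q = topology (\<lambda>V. V \<subseteq> F ` topspace Z \<and> openin Z {p \<in> topspace Z. F p \<in> V})"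
  have "istopology (\<lambda>V. V \<subseteq> F ` topspace Z \<and> openin Z {p \<in> topspace Z. F p \<in> V})"
    unfolding istopology_def
  proof (intro conjI allI impI)
    fix S T assume "S \<subseteq> F ` topspace Z \<and> openin Z {p \<in> topspace Z. F p \<in> S}"
      "T \<subseteq> F ` topspace Z \<and> openin Z {p \<in> topspace Z. F p \<in> T}"
    moreover have "{p \<in> topspace Z. F p \<in> S \<inter> T} = {p \<in> topspace Z. F p \<in> S} \<inter> {p \<in> topspace Z. F p \<in> T}" by blast
    ultimately show "S \<inter> T \<subseteq> F ` topspace Z" "openin Z {p \<in> topspace Z. F p \<in> S \<inter> T}" by auto
  next
    fix \<K> assume "\<forall>K\<in>\<K>. K \<subseteq> F ` topspace Z \<and> openin Z {p \<in> topspace Z. F p \<in> K}"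
    moreover have "{p \<in> topspace Z. F p \<in> \<Union>\<K>} = (\<Union>K\<in>\<K>. {p \<in> topspace Z. F p \<in> K})" by blast
    ultimately show "\<Union>\<K> \<subseteq> F ` topspace Z" "openin Z {p \<in> topspace Z. F p \<in> \<Union>\<K>}" by auto
  qed
  then have oQ: "openin Q V \<longleftrightarrow> V \<subseteq> F ` topspace Z \<and> openin Z {p \<in> topspace Z. F p \<in> V}" for V
    by (simp add: Q_def topology_inverse')
  have tQ: "topspace Q = F ` topspace Z"
  proof (rule antisym)
    show "topspace Q \<subseteq> F ` topspace Z" using oQ[of "topspace Q"] by simp
    have "{p \<in> topspace Z. F p \<in> F ` topspace Z} = topspace Z" by blast
    then have "openin Q (F ` topspace Z)" using oQ by simp
    then show "F ` topspace Z \<subseteq> topspace Q" using openin_subset by blast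
  qed
  have quot: "quotient_map Z Q F" unfolding quotient_map_def using tQ oQ by simp
  have oF: "openin Q (F ` {p \<in> topspace Z. cls p \<subseteq> V})" if "openin Z V" for V
  proof -
    have "{p \<in> topspace Z. F p \<in> F ` {p \<in> topspace Z. cls p \<subseteq> V}} = {p \<in> topspace Z. cls p \<subseteq> V}"
      using F_eq by auto
    then show ?thesis using oQ open_sat[OF that] by auto
  qed
  show thesis
  proof
    show "quotient_map Z Q F" by (rule quot)
    show "compact_space Q"
      using Z(1) quot quotient_imp_continuous_map tQ compact_space_def image_compactin by metis
    show "F p = F q \<longleftrightarrow> q = p \<or> (p \<in> B \<and> q = \<tau> p)" if "p \<in> topspace Z" "q \<in> topspace Z" for p q
      using F_eq[OF that] cls_eq[of q p] by (auto simp: cls_def split: if_splits)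
    show "Hausdorff_space Q"
      unfolding Hausdorff_space_def
    proof (intro allI impI)
      fix x y assume xy: "x \<in> topspace Q \<and> y \<in> topspace Q \<and> x \<noteq> y"
      then obtain p q where pq: "p \<in> topspace Z" "q \<in> topspace Z" "x = F p" "y = F q" using tQ by auto
      then have "cls p \<noteq> cls q" using F_eq xy by blast
      then have "disjnt (cls p) (cls q)" using cls_eq unfolding disjnt_def by blast
      moreover have "compactin Z (cls p)" "compactin Z (cls q)"
        using fin clsZ pq by (auto intro: finite_imp_compactin)
      ultimately obtain U V where UV: "openin Z U" "openin Z V" "cls p \<subseteq> U" "cls q \<subseteq> V" "disjnt U V"
        using Z(2)[unfolded Hausdorff_space_compact_sets] by meson
      have "disjnt (F ` {p \<in> topspace Z. cls p \<subseteq> U}) (F ` {p \<in> topspace Z. cls p \<subseteq> V})"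
        unfolding disjnt_iff
      proof (intro allI notI, elim conjE imageE CollectE)
        fix a u v assume "a = F u" "a = F v" "u \<in> topspace Z" "v \<in> topspace Z" "cls u \<subseteq> U" "cls v \<subseteq> V"
        then have "u \<in> U" "u \<in> V" using F_eq[of u v] cls_self[of u] by auto
        then show False using UV(5) by (simp add: disjnt_iff)
      qed
      then show "\<exists>U V. openin Q U \<and> openin Q V \<and> x \<in> U \<and> y \<in> V \<and> disjnt U V"
        using oF[OF UV(1)] oF[OF UV(2)] pq UV(3,4) by blast
    qed
    show "second_countable Q"
      unfolding second_countable_def
    proof (intro exI[of _ "range (\<lambda>m. F ` {p \<in> topspace Z. cls p \<subseteq> Bs m})"] conjI ballI allI impI)
      show "countable (range (\<lambda>m. F ` {p \<in> topspace Z. cls p \<subseteq> Bs m}))" by simp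
      fix V assume "V \<in> range (\<lambda>m. F ` {p \<in> topspace Z. cls p \<subseteq> Bs m})"
      then show "openin Q V" using oF Bs_open by auto
    next
      fix U x assume "openin Q U \<and> x \<in> U"
      then have U: "U \<subseteq> F ` topspace Z" "openin Z {p \<in> topspace Z. F p \<in> U}" "x \<in> U" using oQ by auto
      then obtain p where p: "p \<in> topspace Z" "x = F p" by blast
      have "cls p \<subseteq> {p \<in> topspace Z. F p \<in> U}"
      proof
        fix q assume q: "q \<in> cls p"
        then have "q \<in> topspace Z" using clsZ p by blast
        then have "F q = F p" using F_eq p q cls_eq by metis
        then show "q \<in> {p \<in> topspace Z. F p \<in> U}" using \<open>q \<in> topspace Z\<close> U p by simp
      qed
      from Bs_base[OF fin this U(2)] obtain m where m: "cls p \<subseteq> Bs m" "Bs m \<subseteq> {p \<in> topspace Z. F p \<in> U}" by blast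
      then show "\<exists>V\<in>range (\<lambda>m. F ` {p \<in> topspace Z. cls p \<subseteq> Bs m}). x \<in> V \<and> V \<subseteq> U"
        using p cls_self by (intro bexI[of _ "F ` {p \<in> topspace Z. cls p \<subseteq> Bs m}"]) auto
    qed
  qed
qed

section \<open>Charts of a quotient\<close>

locale chart_descent =
  fixes Z :: "'p topology" and Q :: "'q topology" and F :: "'p \<Rightarrow> 'q"
    and k :: nat and H :: "(nat \<Rightarrow> real) set"
  assumes quot: "quotient_map Z Q F"
begin

text \<open>A chart of the quotient, described by data upstairs. The set \<open>D\<close> is saturated and open, the
  coordinates \<open>c\<close> on \<open>D\<close> are constant on fibres, and \<open>P\<close> is a parametrization by the set \<open>E\<close>
  of coordinate values. It is inverse to \<open>c\<close> up to the gluing, and only \<open>F \<circ> P\<close> has to be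
  continuous: on a glued pair \<open>P\<close> jumps from one sheet to the other.\<close>

definition chart_upstairs where
  "chart_upstairs D c E P \<longleftrightarrow>
     openin Z D \<and> (\<forall>p\<in>D. \<forall>q\<in>topspace Z. F q = F p \<longrightarrow> q \<in> D \<and> c q = c p) \<and>
     continuous_map (subtopology Z D) (Euclidean_space k) c \<and>
     openin (subtopology (Euclidean_space k) H) E \<and> c ` D \<subseteq> E \<and>
     continuous_map (subtopology (Euclidean_space k) E) Q (F \<circ> P) \<and>
     (\<forall>x\<in>E. P x \<in> D \<and> c (P x) = x) \<and> (\<forall>p\<in>D. F (P (c p)) = F p)"

definition descend :: "('p \<Rightarrow> nat \<Rightarrow> real) \<Rightarrow> 'q \<Rightarrow> nat \<Rightarrow> real" where
  "descend c = c \<circ> inv_into (topspace Z) F"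

lemma chart_upstairsD:
  assumes "chart_upstairs D c E P"
  shows "openin Z D" "D \<subseteq> topspace Z" "\<And>p q. p \<in> D \<Longrightarrow> q \<in> topspace Z \<Longrightarrow> F q = F p \<Longrightarrow> q \<in> D \<and> c q = c p"
    "continuous_map (subtopology Z D) (Euclidean_space k) c"
    "openin (subtopology (Euclidean_space k) H) E" "E \<subseteq> RR k" "c ` D \<subseteq> E"
    "continuous_map (subtopology (Euclidean_space k) E) Q (F \<circ> P)"
    "\<And>x. x \<in> E \<Longrightarrow> P x \<in> D" "\<And>x. x \<in> E \<Longrightarrow> c (P x) = x" "\<And>p. p \<in> D \<Longrightarrow> F (P (c p)) = F p"
    "c ` D = E"
proof -
  note A = assms[unfolded chart_upstairs_def]
  from A show 1: "openin Z D" "continuous_map (subtopology Z D) (Euclidean_space k) c"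
    "openin (subtopology (Euclidean_space k) H) E" "c ` D \<subseteq> E"
    "continuous_map (subtopology (Euclidean_space k) E) Q (F \<circ> P)" by simp_all
  from 1 show "E \<subseteq> RR k" "D \<subseteq> topspace Z" using openin_subset by fastforce+
  from A have P: "\<forall>x\<in>E. P x \<in> D \<and> c (P x) = x" by simp
  then show "P x \<in> D" "c (P x) = x" if "x \<in> E" for x using that by simp_all
  show "c ` D = E" using 1(4) P by force
  from A show "F (P (c p)) = F p" if "p \<in> D" for p using that by simp
  from A have "\<forall>p\<in>D. \<forall>q\<in>topspace Z. F q = F p \<longrightarrow> q \<in> D \<and> c q = c p" by simp
  then show "q \<in> D \<and> c q = c p" if "p \<in> D" "q \<in> topspace Z" "F q = F p" for p q using that by simp
qed

lemma descend_F:
  assumes "chart_upstairs D c E P" "p \<in> D" shows "descend c (F p) = c p"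
proof -
  have "p \<in> topspace Z" using assms chart_upstairsD(2) by blast
  then show ?thesis unfolding descend_def o_def
    using chart_upstairsD(3)[OF assms(1,2)] by (metis f_inv_into_f imageI inv_into_into)
qed

lemma descend_image: "chart_upstairs D c E P \<Longrightarrow> descend c ` (F ` D) = E"
  using descend_F chart_upstairsD(12) by (metis (no_types, lifting) image_cong image_image)

lemma descend_inverse:
  assumes U: "chart_upstairs D c E P" and x: "x \<in> E"
  shows "inv_into (F ` D) (descend c) x = F (P x)"
proof (rule inv_into_f_eq)
  show "inj_on (descend c) (F ` D)"
  proof (rule inj_onI, elim imageE)
    fix a b p q assume "descend c a = descend c b" "a = F p" "b = F q" "p \<in> D" "q \<in> D"
    then show "a = b" using descend_F[OF U] chart_upstairsD(11)[OF U] by metis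
  qed
  show "F (P x) \<in> F ` D" using chart_upstairsD(9)[OF U x] by blast
  show "descend c (F (P x)) = x"
    using descend_F[OF U] chart_upstairsD(9,10)[OF U x] by simp
qed

lemma saturated:
  assumes "chart_upstairs D c E P" shows "{p \<in> topspace Z. F p \<in> F ` D} = D"
  using chart_upstairsD(2,3)[OF assms] by blast

lemma chart_on_descend:
  assumes U: "chart_upstairs D c E P"
  shows "chart_on k H Q (F ` D, descend c)"
proof -
  have FD: "F ` D \<subseteq> topspace Q"
    using quot chart_upstairsD(2)[OF U] unfolding quotient_map_def by blast
  have oFD: "openin Q (F ` D)"
    using quot FD chart_upstairsD(1)[OF U] saturated[OF U] unfolding quotient_map_def by metis
  have qD: "quotient_map (subtopology Z D) (subtopology Q (F ` D)) F"
    by (rule quotient_map_restriction[OF quot saturated[OF U]]) (use oFD in blast)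
  have ED: "descend c ` (F ` D) = E" by (rule descend_image[OF U])
  have tD: "topspace (subtopology Z D) = D" using chart_upstairsD(2)[OF U] by (simp add: Int_absorb1)
  have tQD: "topspace (subtopology Q (F ` D)) = F ` D" using FD by (simp add: Int_absorb1)
  have tE: "topspace (subtopology (Euclidean_space k) E) = E"
    using chart_upstairsD(6)[OF U] by (simp add: Int_absorb1)
  have "continuous_map (subtopology Z D) (subtopology (Euclidean_space k) E) c"
    using chart_upstairsD(4,7)[OF U] tD by (auto simp: continuous_map_in_subtopology)
  then have "continuous_map (subtopology Z D) (subtopology (Euclidean_space k) E) (descend c \<circ> F)"
    by (rule continuous_map_eq) (use tD descend_F[OF U] in auto)
  then have c1: "continuous_map (subtopology Q (F ` D)) (subtopology (Euclidean_space k) E) (descend c)"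
    by (rule continuous_compose_quotient_map[OF qD])
  have c2: "continuous_map (subtopology (Euclidean_space k) E) (subtopology Q (F ` D)) (F \<circ> P)"
    using chart_upstairsD(8,9)[OF U] tE by (auto simp: continuous_map_in_subtopology)
  have "homeomorphic_maps (subtopology Q (F ` D)) (subtopology (Euclidean_space k) E) (descend c) (F \<circ> P)"
    unfolding homeomorphic_maps_def tQD tE using c1 c2 descend_F[OF U] chart_upstairsD(9,10,11)[OF U] by auto
  then show ?thesis
    unfolding chart_on_def using oFD ED chart_upstairsD(5)[OF U] homeomorphic_map_maps by auto
qed

text \<open>Since the domains are saturated, their images meet exactly in the image of their
  intersection.\<close>

lemma descend_overlap:
  assumes U: "chart_upstairs D c E P" and U': "chart_upstairs D' c' E' P'"
  shows "descend c ` (F ` D \<inter> F ` D') = {x \<in> E. P x \<in> D'}"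
proof (intro equalityI subsetI)
  fix x assume "x \<in> descend c ` (F ` D \<inter> F ` D')"
  then obtain p where p: "p \<in> D" "F p \<in> F ` D'" "x = descend c (F p)" by blast
  then have "x = c p" using descend_F[OF U] by simp
  moreover have "P (c p) \<in> D" using chart_upstairsD(7,9)[OF U] p(1) by blast
  moreover have "F (P (c p)) = F p" using chart_upstairsD(11)[OF U p(1)] .
  ultimately show "x \<in> {x \<in> E. P x \<in> D'}"
    using chart_upstairsD(2,7)[OF U] saturated[OF U'] p by auto
next
  fix x assume x: "x \<in> {x \<in> E. P x \<in> D'}"
  then have "descend c (F (P x)) = x" "P x \<in> D" using descend_F[OF U] chart_upstairsD(9,10)[OF U] by auto
  then show "x \<in> descend c ` (F ` D \<inter> F ` D')" using x by force
qed

lemma compatible_descend: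
  assumes U: "chart_upstairs D c E P" and U': "chart_upstairs D' c' E' P'"
    and t: "regular_map Smooth k k {x \<in> E. P x \<in> D'} (c' \<circ> P)"
    and t': "regular_map Smooth k k {x \<in> E'. P' x \<in> D} (c \<circ> P')"
  shows "compatible_charts Smooth k (F ` D, descend c) (F ` D', descend c')"
proof -
  have *: "regular_map Smooth k k (descend c ` (F ` D \<inter> F ` D')) (descend c' \<circ> inv_into (F ` D) (descend c))"
    if U: "chart_upstairs D c E P" and U': "chart_upstairs D' c' E' P'"
    and t: "regular_map Smooth k k {x \<in> E. P x \<in> D'} (c' \<circ> P)" for D c E P D' c' E' P'
    unfolding descend_overlap[OF U U']
    by (rule regular_map_cong[OF t]) (use descend_inverse[OF U] descend_F[OF U'] in auto)
  show ?thesis unfolding compatible_charts_def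
    using *[OF U U' t] *[OF U' U t'] by (simp add: Int_commute)
qed

end

section \<open>The preimage of the region bounded by the equator\<close>

text \<open>The sheets \<open>\<S>\<close> over \<open>W\<close> are matched by the involution \<open>\<sigma>\<close>; its only fixed sheet is \<open>A0\<close>, and
  \<open>R\<close> contains one sheet of each pair. The collar of \<open>Y\<close> is \<open>V = \<psi>(Y \<times> (-1,1))\<close>, and \<open>K\<close> is
  the region bounded by \<open>Y\<close>. The closure of \<open>K\<close> enters as \<open>K \<union> Y\<close>.\<close>

locale glued_preimage =
  fixes n j :: nat and T :: "'p topology" and \<A> :: "'p chart set" and \<phi> :: "'p \<Rightarrow> nat \<Rightarrow> real"
    and K Y W V :: "(nat \<Rightarrow> real) set" and \<psi> :: "(nat \<Rightarrow> real) \<Rightarrow> nat \<Rightarrow> real"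
    and \<S> R :: "'p set set" and \<sigma> :: "'p set \<Rightarrow> 'p set" and A0 :: "'p set"
  assumes manifold: "analytic_manifold (Suc j) T \<A>"
    and phi_regular: "regular_on_manifold Analytic (Suc j) T \<A> n \<phi>"
    and phi_cont: "continuous_map T (Euclidean_space n) \<phi>"
    and compact_preimage: "compactin T {p \<in> topspace T. \<phi> p \<in> K \<union> Y}"
    and K_open: "openin T {p \<in> topspace T. \<phi> p \<in> K}"
    and K_Y: "K \<inter> Y = {}"
    and Y_compact: "compactin (Euclidean_space n) Y"
    and Y_submanifold: "submanifold Smooth n j Y"
    and Y_W: "Y \<subseteq> W" and W_RR: "W \<subseteq> RR n"
    and sheet_open: "\<And>A. A \<in> \<S> \<Longrightarrow> openin T A"
    and sheet_iso: "\<And>A. A \<in> \<S> \<Longrightarrow> manifold_iso_onto Analytic (Suc j) T \<A> A n W \<phi>"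
    and sheet_disjoint: "\<And>A B p. A \<in> \<S> \<Longrightarrow> B \<in> \<S> \<Longrightarrow> p \<in> A \<Longrightarrow> p \<in> B \<Longrightarrow> A = B"
    and sheet_cover: "\<And>p. p \<in> topspace T \<Longrightarrow> \<phi> p \<in> W \<Longrightarrow> \<exists>A\<in>\<S>. p \<in> A"
    and collar_iso: "regular_iso Smooth (Suc n) n (cylinder n Y {-1<..<1}) V \<psi>"
    and Y_V: "Y \<subseteq> V" and V_open: "openin T {p \<in> topspace T. \<phi> p \<in> V}"
    and VW_open: "openin (top_of_set V) (V \<inter> W)"
    and collar_Y: "\<psi> ` cylinder n Y {0} = Y"
    and collar_K: "K \<inter> V = \<psi> ` cylinder n Y {-1<..<0}"
    and \<sigma>: "\<And>A. A \<in> \<S> \<Longrightarrow> \<sigma> A \<in> \<S>" "\<And>A. A \<in> \<S> \<Longrightarrow> \<sigma> (\<sigma> A) = A"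
    and R: "R \<subseteq> \<S>" "\<And>A. A \<in> \<S> \<Longrightarrow> A \<in> R \<or> \<sigma> A \<in> R" "\<And>A. A \<in> R \<Longrightarrow> \<sigma> A \<in> R \<Longrightarrow> \<sigma> A = A"
    and A0: "A0 \<in> R" "\<sigma> A0 = A0" "\<And>A. A \<in> R \<Longrightarrow> \<sigma> A = A \<Longrightarrow> A = A0"
begin

abbreviation k where "k \<equiv> Suc j"

text \<open>The compact space to be glued, with boundary \<open>B\<close>.\<close>

definition M0 where "M0 = {p \<in> topspace T. \<phi> p \<in> K \<union> Y}"
definition Z where "Z = subtopology T M0"
definition B where "B = {p \<in> topspace T. \<phi> p \<in> Y}"
definition lift where "lift A = inv_into A \<phi>"
definition Cyl where "Cyl = cylinder n Y {-1<..<1}"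

text \<open>Points of the collar have a foot in \<open>Y\<close> and a height in \<open>(-1,1)\<close>, which are the two factors
  of \<open>Y \<times> (-1,1)\<close> under \<open>\<psi>\<close>. As \<open>\<psi>\<close> maps \<open>Y \<times> {0}\<close> to \<open>Y\<close> possibly by a nontrivial
  diffeomorphism, the foot of a point of \<open>Y\<close> can be a different point of \<open>Y\<close>.\<close>

definition unroll where "unroll = inv_into Cyl \<psi>"
definition height where "height w = unroll w n"
definition foot where "foot w = (unroll w)(n := 0)"

lemma Y_RR: "Y \<subseteq> RR n" using Y_W W_RR by blast
lemma j_le_n: "j \<le> n" using Y_submanifold by (simp add: submanifold_def)

lemma cylinder_iff: "v \<in> cylinder n Y I \<longleftrightarrow> v(n := 0) \<in> Y \<and> v n \<in> I"
proof
  assume "v \<in> cylinder n Y I"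
  then obtain y t where "v = y(n := t)" "y \<in> Y" "t \<in> I" by (auto simp: cylinder_def)
  moreover have "y n = 0" using \<open>y \<in> Y\<close> Y_RR by (auto simp: RR_iff)
  ultimately show "v(n := 0) \<in> Y \<and> v n \<in> I" by (metis fun_upd_same fun_upd_triv fun_upd_upd)
next
  assume "v(n := 0) \<in> Y \<and> v n \<in> I"
  then show "v \<in> cylinder n Y I" unfolding cylinder_def
    by (intro CollectI exI[of _ "v(n := 0)"] exI[of _ "v n"]) simp
qed

lemma Cyl_iff: "v \<in> Cyl \<longleftrightarrow> v(n := 0) \<in> Y \<and> - 1 < v n \<and> v n < 1"
  by (simp add: Cyl_def cylinder_iff)

lemma \<psi>_bij: "bij_betw \<psi> Cyl V" and \<psi>_regular: "regular_map Smooth (Suc n) n Cyl \<psi>"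
  and unroll_regular: "regular_map Smooth n (Suc n) V unroll"
  using collar_iso by (auto simp: regular_iso_def Cyl_def unroll_def)

lemma unroll_in: "w \<in> V \<Longrightarrow> unroll w \<in> Cyl" and \<psi>_unroll: "w \<in> V \<Longrightarrow> \<psi> (unroll w) = w"
  and \<psi>_in: "v \<in> Cyl \<Longrightarrow> \<psi> v \<in> V" and unroll_\<psi>: "v \<in> Cyl \<Longrightarrow> unroll (\<psi> v) = v"
  using \<psi>_bij unfolding unroll_def bij_betw_def
  by (auto simp: inv_into_into f_inv_into_f)

lemma foot_Y: "w \<in> V \<Longrightarrow> foot w \<in> Y" and height_bounds: "w \<in> V \<Longrightarrow> - 1 < height w \<and> height w < 1"
  using unroll_in by (auto simp: foot_def height_def Cyl_iff)

lemma foot_upd_height: "(foot w)(n := height w) = unroll w" by (simp add: foot_def height_def)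

lemma cyl_upd: assumes "y \<in> Y" "- 1 < t" "t < 1"
  shows "y(n := t) \<in> Cyl" "foot (\<psi> (y(n := t))) = y" "height (\<psi> (y(n := t))) = t"
proof -
  have "y n = 0" using assms Y_RR by (auto simp: RR_iff)
  then have y: "y(n := 0) = y" by (metis fun_upd_triv)
  then show c: "y(n := t) \<in> Cyl" using assms by (simp add: Cyl_iff)
  show "foot (\<psi> (y(n := t))) = y" "height (\<psi> (y(n := t))) = t"
    using y by (simp_all add: foot_def height_def unroll_\<psi>[OF c])
qed

lemma image_cylinder: assumes "w \<in> V" "I \<subseteq> {-1<..<1}" shows "w \<in> \<psi> ` cylinder n Y I \<longleftrightarrow> height w \<in> I"
proof
  assume "w \<in> \<psi> ` cylinder n Y I"
  then obtain v where v: "v \<in> cylinder n Y I" "w = \<psi> v" by blast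
  then have "v \<in> Cyl" using assms(2) by (auto simp: Cyl_def cylinder_iff)
  then show "height w \<in> I" using v by (simp add: height_def unroll_\<psi> cylinder_iff)
next
  assume "height w \<in> I"
  then have "unroll w \<in> cylinder n Y I" using unroll_in[OF assms(1)] by (simp add: cylinder_iff Cyl_iff height_def)
  then show "w \<in> \<psi> ` cylinder n Y I" using \<psi>_unroll[OF assms(1)] by (metis imageI)
qed

lemma in_Y_iff: "w \<in> V \<Longrightarrow> w \<in> Y \<longleftrightarrow> height w = 0"
  using image_cylinder[of w "{0}"] collar_Y by simp

lemma in_K_iff: "w \<in> V \<Longrightarrow> w \<in> K \<longleftrightarrow> height w < 0"
proof -
  assume w: "w \<in> V"
  have "{-1<..<0} \<subseteq> {-1<..<1::real}" by auto
  from image_cylinder[OF w this] show ?thesis using collar_K height_bounds[OF w] w by auto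
qed

lemma in_KY_iff: "w \<in> V \<Longrightarrow> w \<in> K \<union> Y \<longleftrightarrow> height w \<le> 0"
  using in_Y_iff in_K_iff by auto

lemma sheet_sub: "A \<in> \<S> \<Longrightarrow> A \<subseteq> topspace T" using sheet_open openin_subset by blast

lemma sheet_homeo: assumes "A \<in> \<S>" shows "homeomorphic_map (subtopology T A) (subtopology (Euclidean_space n) W) \<phi>"
  using sheet_iso[OF assms] by (simp add: manifold_iso_onto_def)

lemma sheet_bij: assumes "A \<in> \<S>" shows "bij_betw \<phi> A W"
  using homeomorphic_imp_surjective_map[OF sheet_homeo[OF assms]]
    homeomorphic_imp_injective_map[OF sheet_homeo[OF assms]] sheet_sub[OF assms] W_RR
  by (simp add: bij_betw_def Int_absorb1)

lemma phi_sheet: "A \<in> \<S> \<Longrightarrow> p \<in> A \<Longrightarrow> \<phi> p \<in> W" using sheet_bij bij_betwE by blast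
lemma lift_in: "A \<in> \<S> \<Longrightarrow> w \<in> W \<Longrightarrow> lift A w \<in> A"
  unfolding lift_def using sheet_bij by (metis bij_betw_imp_surj_on inv_into_into)
lemma phi_lift: "A \<in> \<S> \<Longrightarrow> w \<in> W \<Longrightarrow> \<phi> (lift A w) = w"
  unfolding lift_def using sheet_bij by (metis bij_betw_imp_surj_on f_inv_into_f)
lemma lift_phi: "A \<in> \<S> \<Longrightarrow> p \<in> A \<Longrightarrow> lift A (\<phi> p) = p"
  unfolding lift_def using sheet_bij by (metis bij_betw_imp_inj_on inv_into_f_f)

lemma lift_cont: assumes "A \<in> \<S>" shows "continuous_map (subtopology (Euclidean_space n) W) T (lift A)"
proof -
  obtain g where g: "homeomorphic_maps (subtopology T A) (subtopology (Euclidean_space n) W) \<phi> g"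
    using sheet_homeo[OF assms] homeomorphic_map_maps by blast
  then have cg: "continuous_map (subtopology (Euclidean_space n) W) (subtopology T A) g"
    by (simp add: homeomorphic_maps_def)
  have "g w = lift A w" if w: "w \<in> W" for w
  proof -
    have "g w \<in> A" "\<phi> (g w) = w"
      using g w cg continuous_map_image_subset_topspace[OF cg] W_RR unfolding homeomorphic_maps_def by auto
    then show ?thesis using lift_phi[OF assms, of "g w"] by simp
  qed
  then have "continuous_map (subtopology (Euclidean_space n) W) (subtopology T A) (lift A)"
    by (intro continuous_map_eq[OF cg]) auto
  then show ?thesis by (simp add: continuous_map_in_subtopology)
qed

lemma sheet_regular:
  assumes "A \<in> \<S>" "(D, c) \<in> \<A>" shows "regular_map Smooth n k (\<phi> ` (A \<inter> D)) (c \<circ> lift A)"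
  using sheet_iso[OF assms(1)] assms(2) regular_map_analytic_imp_smooth
  unfolding manifold_iso_onto_def lift_def by fastforce

lemma phi_chart_regular: assumes "(D, c) \<in> \<A>" shows "regular_map Smooth k n (c ` D) (\<phi> \<circ> inv_into D c)"
  using phi_regular assms regular_map_analytic_imp_smooth unfolding regular_on_manifold_def by fastforce

lemma transition_regular:
  assumes "(D, c) \<in> \<A>" "(D', c') \<in> \<A>" shows "regular_map Smooth k k (c ` (D \<inter> D')) (c' \<circ> inv_into D c)"
proof -
  have "compatible_charts Analytic k (D, c) (D', c')"
    using manifold assms unfolding analytic_manifold_def manifold_modelled_on_def by blast
  then show ?thesis using regular_map_analytic_imp_smooth by (simp add: compatible_charts_def)
qed

lemma chart_facts:
  assumes "(D, c) \<in> \<A>"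
  shows "openin T D" "openin (Euclidean_space k) (c ` D)" "inj_on c D"
    "homeomorphic_map (subtopology T D) (subtopology (Euclidean_space k) (c ` D)) c"
    "continuous_map (subtopology (Euclidean_space k) (c ` D)) T (inv_into D c)"
proof -
  have "chart_on k (RR k) T (D, c)"
    using manifold assms unfolding analytic_manifold_def manifold_modelled_on_def by blast
  then show D: "openin T D" and collar_dom: "openin (Euclidean_space k) (c ` D)"
    and h: "homeomorphic_map (subtopology T D) (subtopology (Euclidean_space k) (c ` D)) c"
    by (simp_all add: chart_on_def)
  have DT: "D \<subseteq> topspace T" and cDR: "c ` D \<subseteq> RR k" using D collar_dom openin_subset by blast+
  show inj: "inj_on c D" using homeomorphic_imp_injective_map[OF h] DT by (simp add: Int_absorb1)
  obtain g where g: "homeomorphic_maps (subtopology T D) (subtopology (Euclidean_space k) (c ` D)) c g"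
    using h homeomorphic_map_maps by blast
  then have cg: "continuous_map (subtopology (Euclidean_space k) (c ` D)) (subtopology T D) g"
    by (simp add: homeomorphic_maps_def)
  have "g x = inv_into D c x" if "x \<in> c ` D" for x
  proof -
    have "g (c p) = p" if "p \<in> D" for p using g that DT unfolding homeomorphic_maps_def by auto
    then show ?thesis using that inj by auto
  qed
  then have "continuous_map (subtopology (Euclidean_space k) (c ` D)) (subtopology T D) (inv_into D c)"
    by (intro continuous_map_eq[OF cg]) auto
  then show "continuous_map (subtopology (Euclidean_space k) (c ` D)) T (inv_into D c)"
    by (simp add: continuous_map_in_subtopology)
qed

lemma chart_image_open:
  assumes "(D, c) \<in> \<A>" "openin T G" shows "openin (Euclidean_space k) (c ` (D \<inter> G))"
proof -
  have "openin (subtopology T D) (D \<inter> G)" using assms(2) by (simp add: openin_subtopology_Int2)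
  then have "openin (subtopology (Euclidean_space k) (c ` D)) (c ` (D \<inter> G))"
    using homeomorphic_imp_open_map[OF chart_facts(4)[OF assms(1)]] by (simp add: open_map_def)
  then show ?thesis using chart_facts(2)[OF assms(1)] openin_trans_full by blast
qed

lemma atlas_cover: "p \<in> topspace T \<Longrightarrow> \<exists>(D, c)\<in>\<A>. p \<in> D"
  using manifold unfolding analytic_manifold_def manifold_modelled_on_def by blast

lemma B_M0: "B \<subseteq> M0" and M0_T: "M0 \<subseteq> topspace T" and topspace_Z: "topspace Z = M0"
  by (auto simp: B_def M0_def Z_def)

subsection \<open>The involution\<close>

definition sheet_of where "sheet_of p = (THE A. A \<in> \<S> \<and> p \<in> A)"
definition \<tau> where "\<tau> p = lift (\<sigma> (sheet_of p)) (\<phi> p)"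

lemma sheet_of_eq: "A \<in> \<S> \<Longrightarrow> p \<in> A \<Longrightarrow> sheet_of p = A"
  unfolding sheet_of_def using sheet_disjoint by (intro the_equality) auto

lemma \<tau>_eq: "A \<in> \<S> \<Longrightarrow> p \<in> A \<Longrightarrow> \<tau> p = lift (\<sigma> A) (\<phi> p)"
  by (simp add: \<tau>_def sheet_of_eq)

lemma \<tau>_in: assumes "A \<in> \<S>" "p \<in> A" shows "\<tau> p \<in> \<sigma> A" "\<phi> (\<tau> p) = \<phi> p" "\<tau> (\<tau> p) = p"
proof -
  show 1: "\<tau> p \<in> \<sigma> A" and 2: "\<phi> (\<tau> p) = \<phi> p"
    using assms \<tau>_eq[OF assms] lift_in phi_lift \<sigma>(1) phi_sheet by auto
  show "\<tau> (\<tau> p) = p" using \<tau>_eq[OF \<sigma>(1)[OF assms(1)] 1] 2 \<sigma>(2) assms lift_phi by simp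
qed

lemma B_sheet: "p \<in> B \<Longrightarrow> \<exists>A\<in>\<S>. p \<in> A" using sheet_cover Y_W by (auto simp: B_def)

lemma \<tau>_B: "p \<in> B \<Longrightarrow> \<tau> p \<in> B" and \<tau>_\<tau>: "p \<in> B \<Longrightarrow> \<tau> (\<tau> p) = p"
proof -
  assume p: "p \<in> B"
  then obtain A where A: "A \<in> \<S>" "p \<in> A" using B_sheet by blast
  show "\<tau> (\<tau> p) = p" using \<tau>_in[OF A] by blast
  show "\<tau> p \<in> B" using \<tau>_in[OF A] p sheet_sub[OF \<sigma>(1)[OF A(1)]] by (auto simp: B_def)
qed

lemma sub_ZB: "subtopology Z B = subtopology T B"
  unfolding Z_def using B_M0 by (simp add: subtopology_subtopology Int_absorb1)

text \<open>On the open part of \<open>B\<close> in the sheet \<open>A\<close>, the map \<open>\<tau>\<close> is \<open>\<phi>\<close> followed by the inverse of \<open>\<phi>\<close>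
  on \<open>\<sigma> A\<close>.\<close>

lemma \<tau>_cont: "continuous_map (subtopology Z B) (subtopology Z B) \<tau>"
proof -
  have tB: "topspace (subtopology T B) = B" using B_M0 M0_T by auto
  have "continuous_map (subtopology T B) T \<tau>"
  proof (rule pasting_lemma[where I = \<S> and T = "\<lambda>A. B \<inter> A" and f = "\<lambda>A. lift (\<sigma> A) \<circ> \<phi>"])
    fix A assume A: "A \<in> \<S>"
    show "openin (subtopology T B) (B \<inter> A)" using sheet_open[OF A] by (simp add: openin_subtopology_Int2)
    have "continuous_map (subtopology T (B \<inter> A)) (subtopology (Euclidean_space n) W) \<phi>"
      unfolding continuous_map_in_subtopology
      using continuous_map_from_subtopology[OF phi_cont] phi_sheet[OF A] by auto
    from continuous_map_compose[OF this lift_cont[OF \<sigma>(1)[OF A]]]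
    show "continuous_map (subtopology (subtopology T B) (B \<inter> A)) T (lift (\<sigma> A) \<circ> \<phi>)"
      by (simp add: subtopology_subtopology)
  next
    fix A A' x assume "A \<in> \<S>" "A' \<in> \<S>" "x \<in> topspace (subtopology T B) \<inter> (B \<inter> A) \<inter> (B \<inter> A')"
    then have "A = A'" using sheet_disjoint by blast
    then show "(lift (\<sigma> A) \<circ> \<phi>) x = (lift (\<sigma> A') \<circ> \<phi>) x" by simp
  next
    fix x assume "x \<in> topspace (subtopology T B)"
    then obtain A where "A \<in> \<S>" "x \<in> A" "x \<in> B" using B_sheet tB by auto
    then show "\<exists>A. A \<in> \<S> \<and> x \<in> B \<inter> A \<and> \<tau> x = (lift (\<sigma> A) \<circ> \<phi>) x" using \<tau>_eq by auto
  qed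
  then show ?thesis unfolding sub_ZB continuous_map_in_subtopology using \<tau>_B tB by auto
qed

lemma B_closed: "closedin Z B"
proof -
  have "closedin (Euclidean_space n) Y"
    using Y_compact by (intro compactin_imp_closedin) (simp_all add: Euclidean_space_top_of_set Hausdorff_space_subtopology)
  then have "closedin T B" unfolding B_def by (rule closedin_continuous_map_preimage[OF phi_cont])
  then show ?thesis unfolding Z_def using B_M0 by (simp add: closedin_subset_topspace)
qed

lemma glued_space:
  obtains F :: "'p \<Rightarrow> nat \<Rightarrow> real" and Q where
    "Hausdorff_space Q" "second_countable Q" "compact_space Q" "quotient_map Z Q F"
    "\<And>p q. p \<in> M0 \<Longrightarrow> q \<in> M0 \<Longrightarrow> F p = F q \<longleftrightarrow> q = p \<or> (p \<in> B \<and> q = \<tau> p)"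
proof -
  have "Hausdorff_space T" "second_countable T"
    using manifold unfolding analytic_manifold_def manifold_modelled_on_def by blast+
  then have "Hausdorff_space Z" "second_countable Z"
    unfolding Z_def by (simp_all add: Hausdorff_space_subtopology second_countable_subtopology)
  moreover have "compact_space Z"
    using compact_preimage unfolding Z_def M0_def by (rule compact_space_subtopology)
  ultimately show ?thesis
    using glue_along_involution[OF _ _ _ B_closed \<tau>_cont \<tau>_\<tau>] that topspace_Z by metis
qed

end

locale glued_quotient = glued_preimage +
  fixes F :: "'a \<Rightarrow> nat \<Rightarrow> real" and Q :: "(nat \<Rightarrow> real) topology"
  assumes Q: "Hausdorff_space Q" "second_countable Q" "compact_space Q" "quotient_map Z Q F"
    and F_eq: "\<And>p q. p \<in> M0 \<Longrightarrow> q \<in> M0 \<Longrightarrow> F p = F q \<longleftrightarrow> q = p \<or> (p \<in> B \<and> q = \<tau> p)"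
begin

definition half_space where "half_space = {x \<in> RR k. 0 \<le> x 0}"

sublocale chart_descent Z Q F k half_space by unfold_locales (rule Q(4))

lemma F_cont: "continuous_map Z Q F" using Q(4) quotient_imp_continuous_map by blast

lemma F_fibre:
  assumes "p \<in> M0" "q \<in> M0" "F q = F p" "A \<in> \<S>" "p \<in> A"
  shows "q = p \<or> (\<phi> p \<in> Y \<and> q \<in> \<sigma> A \<and> \<phi> q = \<phi> p)"
  using F_eq[of p q] assms \<tau>_in[OF assms(4,5)] by (auto simp: B_def)

text \<open>Glued points have the same image under \<open>\<phi>\<close>, so \<open>\<phi>\<close> descends to the quotient.\<close>

lemma F_phi: assumes "p \<in> M0" "q \<in> M0" "F q = F p" shows "\<phi> q = \<phi> p"
proof (cases "p \<in> B")
  case True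
  then show ?thesis using F_fibre[OF assms] B_sheet by blast
next
  case False
  then show ?thesis using F_eq[OF assms(1,2)] assms(3) by auto
qed

lemma into_Q_cont:
  assumes "continuous_map X T g" "g ` topspace X \<subseteq> M0" shows "continuous_map X Q (F \<circ> g)"
proof (rule continuous_map_compose[OF _ F_cont])
  show "continuous_map X Z g" unfolding Z_def continuous_map_in_subtopology using assms by auto
qed

subsection \<open>Interior charts\<close>

text \<open>A boundary point is one whose coordinate \<open>0\<close> vanishes, so this coordinate must be positive
  on interior charts. Translating by every real \<open>b\<close>, and restricting to the points where the
  translated coordinate is positive, still covers \<open>\<phi>\<^sup>-\<^sup>1(K)\<close>.\<close>

definition shift :: "real \<Rightarrow> (nat \<Rightarrow> real) \<Rightarrow> nat \<Rightarrow> real" where "shift b x = x(0 := x 0 + b)"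

lemma shift_shift: "shift b (shift (- b) x) = x" "shift (- b) (shift b x) = x" by (auto simp: shift_def)
lemma shift_0: "shift b x 0 = x 0 + b" by (simp add: shift_def)
lemma shift_RR: "shift b x \<in> RR k \<longleftrightarrow> x \<in> RR k" by (auto simp: shift_def RR_iff)

lemma shift_regular: "regular_map Smooth k k (RR k) (shift b)"
proof (rule regular_map_affine)
  fix i assume "i < k"
  show "\<exists>c d l. \<forall>x\<in>RR k. shift b x i = c + d * x l"
  proof (cases "i = 0")
    case True
    then show ?thesis by (intro exI[of _ b] exI[of _ 1] exI[of _ 0]) (simp add: shift_def)
  next
    case False
    then show ?thesis by (intro exI[of _ 0] exI[of _ 1] exI[of _ i]) (simp add: shift_def)
  qed
qed (auto simp: shift_RR simp del: topspace_subtopology)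

definition interior_dom where "interior_dom D c b = {p \<in> D. \<phi> p \<in> K \<and> c p 0 + b > 0}"
definition interior_coord where "interior_coord c b = shift b \<circ> c"
definition interior_img where "interior_img D c b = {x \<in> RR k. 0 < x 0 \<and> shift (- b) x \<in> c ` (D \<inter> {p \<in> topspace T. \<phi> p \<in> K})}"
definition interior_param where "interior_param D c b = inv_into D c \<circ> shift (- b)"

lemma openin_H: "openin (Euclidean_space k) G \<Longrightarrow> openin (subtopology (Euclidean_space k) half_space) (G \<inter> half_space)"
  by (simp add: openin_subtopology_Int)

text \<open>Gluing takes place over \<open>Y\<close> only, and \<open>K\<close> is disjoint from \<open>Y\<close>; so the domain is saturated.\<close>

lemma interior_chart:
  assumes C: "(D, c) \<in> \<A>"
  shows "chart_upstairs (interior_dom D c b) (interior_coord c b) (interior_img D c b) (interior_param D c b)"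
proof -
  note cf = chart_facts[OF C]
  have DT: "D \<subseteq> topspace T" and cDR: "c ` D \<subseteq> RR k" using cf(1,2) openin_subset by blast+
  have inv: "inv_into D c (c p) = p" if "p \<in> D" for p using cf(3) that by simp
  have c_cont: "continuous_map (subtopology T D) (Euclidean_space k) c"
    using homeomorphic_imp_continuous_map[OF cf(4)] by (simp add: continuous_map_in_subtopology)
  have shift_cont: "continuous_map (Euclidean_space k) (Euclidean_space k) (shift b)" for b
    using regular_map_continuous_map[OF shift_regular] by simp
  have interior_dom_M0: "interior_dom D c b \<subseteq> M0" using DT by (auto simp: interior_dom_def M0_def)
  have interior_param_in: "interior_param D c b x \<in> interior_dom D c b" "interior_coord c b (interior_param D c b x) = x" if x: "x \<in> interior_img D c b" for x
  proof -
    obtain p where p: "p \<in> D" "\<phi> p \<in> K" "shift (- b) x = c p" using x by (auto simp: interior_img_def)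
    then have P: "interior_param D c b x = p" using inv by (simp add: interior_param_def)
    have "x = shift b (c p)" using p(3) shift_shift(1) by metis
    then show "interior_param D c b x \<in> interior_dom D c b" "interior_coord c b (interior_param D c b x) = x"
      unfolding P using x p by (auto simp: interior_dom_def interior_coord_def shift_0 interior_img_def)
  qed
  show ?thesis unfolding chart_upstairs_def
  proof (intro conjI ballI impI)
    have o: "openin T {p \<in> D. c p \<in> {x \<in> RR k. - b < x 0}}"
      using openin_continuous_map_preimage[OF c_cont RR_open_halfspace(1)[where a = "- b" and i = 0]] cf(1) DT
      by (simp add: Int_absorb1 openin_trans_full[of T D])
    have "interior_dom D c b = {p \<in> D. c p \<in> {x \<in> RR k. - b < x 0}} \<inter> {p \<in> topspace T. \<phi> p \<in> K}"
      using cDR DT by (auto simp: interior_dom_def)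
    then have "openin T (interior_dom D c b)" using o K_open by auto
    then show "openin Z (interior_dom D c b)" unfolding Z_def using interior_dom_M0 by (metis Int_absorb1 openin_subtopology_Int2)
  next
    fix p q assume p: "p \<in> interior_dom D c b" "q \<in> topspace Z" "F q = F p"
    then have "p \<notin> B" using K_Y by (auto simp: interior_dom_def B_def)
    then have "q = p" using F_eq[of p q] p interior_dom_M0 topspace_Z by auto
    then show "q \<in> interior_dom D c b" "interior_coord c b q = interior_coord c b p" using p by auto
  next
    have "continuous_map (subtopology T (interior_dom D c b)) (Euclidean_space k) c"
      using continuous_map_from_subtopology_mono[OF c_cont] by (auto simp: interior_dom_def)
    then have "continuous_map (subtopology T (interior_dom D c b)) (Euclidean_space k) (interior_coord c b)"
      unfolding interior_coord_def by (rule continuous_map_compose[OF _ shift_cont])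
    then show "continuous_map (subtopology Z (interior_dom D c b)) (Euclidean_space k) (interior_coord c b)"
      unfolding Z_def subtopology_subtopology using interior_dom_M0 by (simp add: Int_absorb1)
  next
    have "openin (Euclidean_space k) {x \<in> topspace (Euclidean_space k). shift (- b) x \<in> c ` (D \<inter> {p \<in> topspace T. \<phi> p \<in> K})}"
      by (rule openin_continuous_map_preimage[OF shift_cont chart_image_open[OF C K_open]])
    then have "openin (Euclidean_space k) ({x \<in> RR k. 0 < x 0} \<inter> {x \<in> topspace (Euclidean_space k). shift (- b) x \<in> c ` (D \<inter> {p \<in> topspace T. \<phi> p \<in> K})})"
      using RR_open_halfspace(1) by (intro openin_Int)
    from openin_H[OF this]
    show "openin (subtopology (Euclidean_space k) half_space) (interior_img D c b)"
      by (rule back_subst[of "openin _"]) (auto simp: interior_img_def half_space_def)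
  next
    show "interior_coord c b ` interior_dom D c b \<subseteq> interior_img D c b"
      using cDR DT by (auto simp: interior_coord_def interior_dom_def interior_img_def shift_0 shift_RR shift_shift simp del: topspace_subtopology)
  next
    have iER: "interior_img D c b \<subseteq> RR k" by (auto simp: interior_img_def)
    have "continuous_map (subtopology (Euclidean_space k) (interior_img D c b)) (subtopology (Euclidean_space k) (c ` D)) (shift (- b))"
      unfolding continuous_map_in_subtopology
      using continuous_map_from_subtopology[OF shift_cont] by (auto simp: interior_img_def)
    from continuous_map_compose[OF this cf(5)]
    have "continuous_map (subtopology (Euclidean_space k) (interior_img D c b)) T (interior_param D c b)" by (simp add: interior_param_def)
    then show "continuous_map (subtopology (Euclidean_space k) (interior_img D c b)) Q (F \<circ> interior_param D c b)"
      by (rule into_Q_cont) (use interior_param_in(1) interior_dom_M0 iER in auto)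
  next
    fix x assume "x \<in> interior_img D c b"
    then show "interior_param D c b x \<in> interior_dom D c b" "interior_coord c b (interior_param D c b x) = x" using interior_param_in by auto
  next
    fix p assume "p \<in> interior_dom D c b"
    then have "interior_param D c b (interior_coord c b p) = p" using inv by (simp add: interior_param_def interior_coord_def shift_shift interior_dom_def)
    then show "F (interior_param D c b (interior_coord c b p)) = F p" by simp
  qed
qed


subsection \<open>Collar charts\<close>

definition tail_coords :: "(nat \<Rightarrow> real) \<Rightarrow> nat \<Rightarrow> real" where "tail_coords x = (\<lambda>i. x (Suc i))"

text \<open>Straightening charts of the submanifold \<open>Y\<close>.\<close>

definition Ychart where
  "Ychart N N' h \<longleftrightarrow> openin (Euclidean_space n) N \<and> openin (Euclidean_space n) N' \<and>
     regular_iso Smooth n n N N' h \<and> h ` (Y \<inter> N) = N' \<inter> RR j"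

text \<open>The value of coordinate \<open>0\<close> over \<open>Y\<close>: zero on the sheet that is not glued, whose copy of \<open>Y\<close>
  becomes the boundary. On glued pairs it is \<open>1\<close>, so that coordinate \<open>0\<close> stays positive on the
  collar.\<close>

definition level :: "'a set \<Rightarrow> real" where "level A = (if \<sigma> A = A then 0 else 1)"

text \<open>The sign of the height in coordinate \<open>0\<close>. The chart has values at least \<open>level A\<close> on \<open>A\<close> and
  at most \<open>level A\<close> on the sheet glued to it. On the unpaired sheet only the first case
  occurs.\<close>

definition side :: "'a set \<Rightarrow> 'a \<Rightarrow> real" where "side A p = (if p \<in> A then - 1 else 1)"

definition collar_fun :: "((nat \<Rightarrow> real) \<Rightarrow> nat \<Rightarrow> real) \<Rightarrow> real \<Rightarrow> real \<Rightarrow> (nat \<Rightarrow> real) \<Rightarrow> nat \<Rightarrow> real" where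
  "collar_fun h a s w = (\<lambda>i. case i of 0 \<Rightarrow> a + s * height w | Suc l \<Rightarrow> h (foot w) l)"

definition collar_dom where "collar_dom N A = {p \<in> M0. \<phi> p \<in> V \<and> foot (\<phi> p) \<in> N \<and> p \<in> A \<union> \<sigma> A}"

definition collar_coord where "collar_coord h A p = collar_fun h (level A) (side A p) (\<phi> p)"

text \<open>Inverse of \<open>collar_fun\<close> with \<open>s = \<plusminus>1\<close>, as a point of the cylinder \<open>Y \<times> (-1,1)\<close>.\<close>

definition collar_lift where "collar_lift N h a s x = (inv_into N h (tail_coords x))(n := s * (x 0 - a))"

text \<open>The height is \<open>- \<bar>x 0 - level A\<bar>\<close> on both sheets. The last condition keeps the parametrized
  point over \<open>W\<close>, which need not contain the whole collar.\<close>

definition collar_img where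
  "collar_img N N' h A = {x \<in> half_space. \<bar>x 0 - level A\<bar> < 1 \<and> tail_coords x \<in> N' \<and>
     \<psi> ((inv_into N h (tail_coords x))(n := - \<bar>x 0 - level A\<bar>)) \<in> W}"

definition collar_param where
  "collar_param N h A x = (if level A \<le> x 0 then lift A (\<psi> (collar_lift N h (level A) (- 1) x))
     else lift (\<sigma> A) (\<psi> (collar_lift N h (level A) 1 x)))"

lemma tail_coords_RR: "x \<in> RR k \<Longrightarrow> tail_coords x \<in> RR j" by (simp add: tail_coords_def RR_iff)

lemma tail_coords_RRn: "x \<in> RR k \<Longrightarrow> tail_coords x \<in> RR n" using tail_coords_RR[of x] RR_mono[OF j_le_n] by blast

lemma tail_coords_regular: "regular_map Smooth k n (RR k) tail_coords"
proof (rule regular_map_affine)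
  fix i
  show "\<exists>c d l. \<forall>x\<in>RR k. tail_coords x i = c + d * x l"
    by (intro exI[of _ 0] exI[of _ 1] exI[of _ "Suc i"]) (simp add: tail_coords_def)
qed (use tail_coords_RRn in auto)

lemma Ychart_facts:
  assumes "Ychart N N' h"
  shows "openin (Euclidean_space n) N" "openin (Euclidean_space n) N'"
    "regular_map Smooth n n N h" "regular_map Smooth n n N' (inv_into N h)"
    "\<And>y. y \<in> Y \<Longrightarrow> y \<in> N \<Longrightarrow> h y \<in> N' \<and> h y \<in> RR j \<and> inv_into N h (h y) = y"
    "\<And>z. z \<in> N' \<Longrightarrow> z \<in> RR j \<Longrightarrow> inv_into N h z \<in> Y \<and> inv_into N h z \<in> N \<and> h (inv_into N h z) = z"
proof -
  have b: "bij_betw h N N'" and im: "h ` (Y \<inter> N) = N' \<inter> RR j"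
    using assms by (auto simp: Ychart_def regular_iso_def)
  then have inj: "inj_on h N" by (simp add: bij_betw_def)
  show "h y \<in> N' \<and> h y \<in> RR j \<and> inv_into N h (h y) = y" if "y \<in> Y" "y \<in> N" for y
  proof -
    have "h y \<in> N' \<inter> RR j" using im that by blast
    then show ?thesis using inv_into_f_f[OF inj that(2)] by blast
  qed
  show "inv_into N h z \<in> Y \<and> inv_into N h z \<in> N \<and> h (inv_into N h z) = z" if z: "z \<in> N'" "z \<in> RR j" for z
  proof -
    have "z \<in> h ` (Y \<inter> N)" using im z by blast
    then obtain y where "y \<in> Y" "y \<in> N" "z = h y" by blast
    then show ?thesis using inv_into_f_f[OF inj] by simp
  qed
qed (use assms in \<open>auto simp: Ychart_def regular_iso_def\<close>)

lemma level_cases: "level A = 0 \<and> \<sigma> A = A \<or> level A = 1 \<and> \<sigma> A \<noteq> A"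
  by (simp add: level_def)

lemma collar_lift_facts:
  assumes h: "Ychart N N' h" and x: "x \<in> RR k" "tail_coords x \<in> N'" "\<bar>s * (x 0 - a)\<bar> < 1"
  defines "y \<equiv> inv_into N h (tail_coords x)"
  shows "y \<in> Y" "y \<in> N" "h y = tail_coords x" "collar_lift N h a s x \<in> Cyl" "\<psi> (collar_lift N h a s x) \<in> V"
    "foot (\<psi> (collar_lift N h a s x)) = y" "height (\<psi> (collar_lift N h a s x)) = s * (x 0 - a)"
proof -
  show y: "y \<in> Y" "y \<in> N" "h y = tail_coords x"
    using Ychart_facts(6)[OF h x(2) tail_coords_RR[OF x(1)]] by (auto simp: y_def)
  have "- 1 < s * (x 0 - a)" "s * (x 0 - a) < 1" using x(3) by linarith+
  from cyl_upd[OF y(1) this] show "collar_lift N h a s x \<in> Cyl" "foot (\<psi> (collar_lift N h a s x)) = y"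
    "height (\<psi> (collar_lift N h a s x)) = s * (x 0 - a)" by (simp_all add: collar_lift_def y_def)
  then show "\<psi> (collar_lift N h a s x) \<in> V" using \<psi>_in by blast
qed

lemma collar_lift_regular:
  assumes h: "Ychart N N' h"
  shows "regular_map Smooth k (Suc n) {x \<in> RR k. tail_coords x \<in> N'} (collar_lift N h a s)"
proof -
  let ?S = "{x \<in> RR k. tail_coords x \<in> N'}"
  have S: "?S \<subseteq> RR k" by blast
  have 1: "regular_map Smooth k n ?S (inv_into N h \<circ> tail_coords)"
    by (rule regular_map_compose[OF regular_map_subset[OF tail_coords_regular S] Ychart_facts(4)[OF h]]) auto
  have "collar_lift N h a s ` ?S \<subseteq> RR (Suc n)"
  proof
    fix v assume "v \<in> collar_lift N h a s ` ?S"
    then obtain x where x: "x \<in> ?S" "v = collar_lift N h a s x" by blast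
    then have "(inv_into N h \<circ> tail_coords) x \<in> RR n" using 1 unfolding regular_map_def by blast
    then show "v \<in> RR (Suc n)" unfolding x(2) collar_lift_def RR_iff by auto
  qed
  moreover have "smooth_on k ?S (\<lambda>x. collar_lift N h a s x i)" if i: "i < Suc n" for i
  proof (cases "i = n")
    case True
    show ?thesis
      by (rule smooth_on_cong[OF smooth_on_affine[OF S, of "- s * a" s 0]]) (simp add: collar_lift_def True algebra_simps)
  next
    case False
    then have "smooth_on k ?S (\<lambda>x. (inv_into N h \<circ> tail_coords) x i)"
      using 1 i unfolding regular_map_smooth_iff by simp
    then show ?thesis by (rule smooth_on_cong) (simp add: collar_lift_def False)
  qed
  ultimately show ?thesis unfolding regular_map_smooth_iff using S by blast
qed

text \<open>Both are coordinate parts of the inverse of the collar diffeomorphism.\<close>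

lemma height_smooth: "smooth_on n V height" and foot_regular: "regular_map Smooth n n V foot"
proof -
  have V: "V \<subseteq> RR n" and u: "unroll ` V \<subseteq> RR (Suc n)" and
    s: "\<And>i. i < Suc n \<Longrightarrow> smooth_on n V (\<lambda>w. unroll w i)"
    using unroll_regular unfolding regular_map_smooth_iff by auto
  show "smooth_on n V height" using s[of n] by (simp add: height_def[abs_def])
  have "foot ` V \<subseteq> RR n" using foot_Y Y_RR by blast
  moreover have "smooth_on n V (\<lambda>w. foot w i)" if "i < n" for i
    by (rule smooth_on_cong[OF s[of i]]) (use that in \<open>auto simp: foot_def\<close>)
  ultimately show "regular_map Smooth n n V foot" unfolding regular_map_smooth_iff using V by blast
qed

lemma collar_fun_regular:
  assumes h: "Ychart N N' h"
  shows "regular_map Smooth n k {w \<in> V. foot w \<in> N} (collar_fun h a s)"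
proof -
  let ?S = "{w \<in> V. foot w \<in> N}"
  have SV: "?S \<subseteq> V" and S: "?S \<subseteq> RR n" using foot_regular by (auto simp: regular_map_def)
  have 1: "regular_map Smooth n n ?S (h \<circ> foot)"
    by (rule regular_map_compose[OF regular_map_subset[OF foot_regular SV] Ychart_facts(3)[OF h]]) auto
  have "collar_fun h a s ` ?S \<subseteq> RR k"
  proof
    fix x assume "x \<in> collar_fun h a s ` ?S"
    then obtain w where w: "w \<in> V" "foot w \<in> N" "x = collar_fun h a s w" by blast
    then have "h (foot w) \<in> RR j" using Ychart_facts(5)[OF h foot_Y] by blast
    then show "x \<in> RR k" unfolding w(3) RR_iff collar_fun_def by (auto split: nat.splits)
  qed
  moreover have "smooth_on n ?S (\<lambda>w. collar_fun h a s w i)" if i: "i < k" for i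
  proof (cases i)
    case 0
    have "regular_map Smooth n 1 ?S (\<lambda>w i. if i = 0 then height w else 0)"
      unfolding regular_map_smooth_iff using smooth_on_subset[OF height_smooth SV] S by (auto simp: RR_iff simp del: topspace_subtopology)
    from smooth_on_compose[OF this smooth_on_affine[OF subset_refl, of 1 a s 0]]
    have "smooth_on n ?S (\<lambda>w. a + s * height w)" by (force simp: RR_iff image_subset_iff)
    then show ?thesis by (simp add: collar_fun_def 0)
  next
    case (Suc l)
    then have "smooth_on n ?S (\<lambda>w. (h \<circ> foot) w l)"
      using 1 i j_le_n unfolding regular_map_smooth_iff by simp
    then show ?thesis by (simp add: collar_fun_def Suc)
  qed
  ultimately show ?thesis unfolding regular_map_smooth_iff using S by blast
qed

lemma side_other: assumes "A \<in> R" "p \<in> \<sigma> A" "\<sigma> A \<noteq> A" shows "side A p = 1"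
proof -
  have "A \<in> \<S>" "\<sigma> A \<in> \<S>" using assms R(1) \<sigma>(1) by auto
  then have "p \<notin> A" using sheet_disjoint assms by blast
  then show ?thesis by (simp add: side_def)
qed

text \<open>Over the point with height \<open>- \<bar>x 0 - level A\<bar>\<close>, the parametrization picks the sheet \<open>A\<close> or
  \<open>\<sigma> A\<close> according to the side of \<open>x 0\<close>. The second choice does not occur if \<open>\<sigma> A = A\<close>, as then
  the level is \<open>0\<close> and \<open>x 0\<close> is nonnegative.\<close>

lemma collar_img_facts:
  assumes h: "Ychart N N' h" and A: "A \<in> R" and x: "x \<in> collar_img N N' h A"
  defines "w \<equiv> \<phi> (collar_param N h A x)"
  shows "x \<in> RR k" "0 \<le> x 0" "tail_coords x \<in> N'"
    "level A \<le> x 0 \<Longrightarrow> collar_param N h A x \<in> A \<and> w = \<psi> (collar_lift N h (level A) (- 1) x)"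
    "x 0 \<le> level A \<Longrightarrow> w = \<psi> (collar_lift N h (level A) 1 x)"
    "x 0 < level A \<Longrightarrow> collar_param N h A x \<in> \<sigma> A \<and> \<sigma> A \<noteq> A \<and> collar_param N h A x = lift (\<sigma> A) w"
    "w \<in> W" "w \<in> V" "foot w = inv_into N h (tail_coords x)" "foot w \<in> N" "h (foot w) = tail_coords x" "height w = - \<bar>x 0 - level A\<bar>"
    "collar_param N h A x \<in> collar_dom N A" "collar_coord h A (collar_param N h A x) = x"
proof -
  show x1: "x \<in> RR k" "0 \<le> x 0" "tail_coords x \<in> N'" using x by (auto simp: collar_img_def half_space_def)
  have x2: "\<bar>x 0 - level A\<bar> < 1" "\<psi> ((inv_into N h (tail_coords x))(n := - \<bar>x 0 - level A\<bar>)) \<in> W"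
    using x by (auto simp: collar_img_def)
  have AS: "A \<in> \<S>" "\<sigma> A \<in> \<S>" using A R(1) \<sigma>(1) by auto
  define s :: real where "s = (if level A \<le> x 0 then - 1 else 1)"
  have s: "\<bar>s * (x 0 - level A)\<bar> < 1" "s * (x 0 - level A) = - \<bar>x 0 - level A\<bar>"
    using x2(1) by (auto simp: s_def)
  note g = collar_lift_facts[OF h x1(1,3) s(1)]
  have gW: "\<psi> (collar_lift N h (level A) s x) \<in> W" using x2(2) by (simp only: collar_lift_def s(2))
  have P: "collar_param N h A x = lift (if level A \<le> x 0 then A else \<sigma> A) (\<psi> (collar_lift N h (level A) s x))"
    by (simp add: collar_param_def s_def)
  have w: "w = \<psi> (collar_lift N h (level A) s x)" using AS gW phi_lift by (simp add: w_def P)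
  show "w \<in> W" "w \<in> V" "foot w = inv_into N h (tail_coords x)" "foot w \<in> N" "h (foot w) = tail_coords x"
    using gW g by (simp_all add: w)
  show height: "height w = - \<bar>x 0 - level A\<bar>" using g(7) s(2) by (simp add: w)
  show 1: "collar_param N h A x \<in> A \<and> w = \<psi> (collar_lift N h (level A) (- 1) x)" if "level A \<le> x 0"
    using that w gW AS lift_in by (simp add: P s_def)
  show "w = \<psi> (collar_lift N h (level A) 1 x)" if "x 0 \<le> level A"
  proof (cases "x 0 = level A")
    case True
    then show ?thesis using w by (simp add: collar_lift_def s_def)
  next
    case False
    then show ?thesis using w that by (simp add: s_def)
  qed
  show 2: "collar_param N h A x \<in> \<sigma> A \<and> \<sigma> A \<noteq> A \<and> collar_param N h A x = lift (\<sigma> A) w" if "x 0 < level A"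
  proof -
    have "\<sigma> A \<noteq> A" using that x1(2) level_cases[of A] by auto
    then show ?thesis using that w gW AS lift_in by (simp add: P s_def)
  qed
  have mem: "collar_param N h A x \<in> A \<union> \<sigma> A" using 1 2 by fastforce
  then have "collar_param N h A x \<in> topspace T" using sheet_sub AS by blast
  moreover have "w \<in> K \<union> Y" using height in_KY_iff[OF \<open>w \<in> V\<close>] by simp
  ultimately have "collar_param N h A x \<in> M0" by (simp add: M0_def w_def)
  then show "collar_param N h A x \<in> collar_dom N A"
    using mem \<open>w \<in> V\<close> \<open>foot w \<in> N\<close> by (simp add: collar_dom_def w_def)
  have "level A + side A (collar_param N h A x) * height w = x 0"
  proof (cases "level A \<le> x 0")
    case True
    then show ?thesis using 1 height by (simp add: side_def)
  next
    case False
    then have "x 0 < level A" by simp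
    then have "collar_param N h A x \<in> \<sigma> A" "\<sigma> A \<noteq> A" using 2 by blast+
    then have "side A (collar_param N h A x) = 1" by (rule side_other[OF A])
    then show ?thesis using False height by simp
  qed
  then show "collar_coord h A (collar_param N h A x) = x"
    unfolding collar_coord_def collar_fun_def w_def[symmetric] \<open>h (foot w) = tail_coords x\<close>
    by (auto simp: fun_eq_iff tail_coords_def split: nat.splits)
qed

text \<open>The coordinates of \<open>p\<close> determine \<open>\<phi> p\<close>, and with the choice of side they recover \<open>p\<close>, except
  that a point of \<open>\<sigma> A\<close> over \<open>Y\<close> is recovered as the point of \<open>A\<close> with which it is glued.\<close>

lemma collar_dom_facts:
  assumes h: "Ychart N N' h" and A: "A \<in> R" and p: "p \<in> collar_dom N A"
  shows "p \<in> M0" "\<phi> p \<in> V" "\<phi> p \<in> W" "foot (\<phi> p) \<in> N" "foot (\<phi> p) \<in> Y" "height (\<phi> p) \<le> 0" "- 1 < height (\<phi> p)"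
    "p \<notin> A \<Longrightarrow> p \<in> \<sigma> A \<and> \<sigma> A \<noteq> A"
    "collar_coord h A p 0 = level A + side A p * height (\<phi> p)" "tail_coords (collar_coord h A p) = h (foot (\<phi> p))"
    "collar_coord h A p \<in> collar_img N N' h A" "F (collar_param N h A (collar_coord h A p)) = F p"
proof -
  show p1: "p \<in> M0" "\<phi> p \<in> V" "foot (\<phi> p) \<in> N" and other: "p \<notin> A \<Longrightarrow> p \<in> \<sigma> A \<and> \<sigma> A \<noteq> A"
    using p by (auto simp: collar_dom_def)
  have AS: "A \<in> \<S>" "\<sigma> A \<in> \<S>" using A R(1) \<sigma>(1) by auto
  show pW: "\<phi> p \<in> W" using p AS phi_sheet by (auto simp: collar_dom_def)
  show height: "height (\<phi> p) \<le> 0" "- 1 < height (\<phi> p)" and bY: "foot (\<phi> p) \<in> Y"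
    using p1 in_KY_iff[OF p1(2)] height_bounds[OF p1(2)] foot_Y by (auto simp: M0_def)
  show c0: "collar_coord h A p 0 = level A + side A p * height (\<phi> p)" by (simp add: collar_coord_def collar_fun_def)
  show csh: "tail_coords (collar_coord h A p) = h (foot (\<phi> p))" by (simp add: collar_coord_def collar_fun_def tail_coords_def)
  note hb = Ychart_facts(5)[OF h bY p1(3)]
  let ?x = "collar_coord h A p"
  have xR: "?x \<in> RR k"
  proof -
    have "h (foot (\<phi> p)) \<in> RR j" using hb by blast
    then show ?thesis unfolding RR_iff collar_coord_def collar_fun_def by (auto split: nat.splits)
  qed
  have absx: "\<bar>?x 0 - level A\<bar> = - height (\<phi> p)" using height c0 by (auto simp: side_def)
  have "0 \<le> ?x 0"
  proof (cases "\<sigma> A = A")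
    case True
    then have "p \<in> A" using other by blast
    then show ?thesis using True c0 height by (simp add: level_def side_def)
  next
    case False
    then show ?thesis using absx height by (simp add: level_def)
  qed
  moreover have rollup: "(inv_into N h (tail_coords ?x))(n := - \<bar>?x 0 - level A\<bar>) = unroll (\<phi> p)"
    using absx csh hb foot_upd_height by simp
  ultimately show xE: "?x \<in> collar_img N N' h A"
    unfolding collar_img_def half_space_def using xR absx height pW csh hb \<psi>_unroll[OF p1(2)] by auto
  have w: "\<phi> (collar_param N h A ?x) = \<phi> p"
  proof -
    have "\<phi> (collar_param N h A ?x) \<in> V" by (rule collar_img_facts(8)[OF h A xE])
    moreover have "unroll (\<phi> (collar_param N h A ?x)) = unroll (\<phi> p)"
      using collar_img_facts(9,12)[OF h A xE] rollup foot_upd_height by metis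
    ultimately show ?thesis using \<psi>_unroll p1(2) by metis
  qed
  have PM: "collar_param N h A ?x \<in> M0" using collar_img_facts(13)[OF h A xE] by (simp add: collar_dom_def)
  show "F (collar_param N h A ?x) = F p"
  proof (cases "p \<in> A")
    case True
    then have "level A \<le> ?x 0" using c0 height by (simp add: side_def)
    then have "collar_param N h A ?x \<in> A" using collar_img_facts(4)[OF h A xE] by blast
    then have "collar_param N h A ?x = p" using lift_phi[OF AS(1)] True w by metis
    then show ?thesis by simp
  next
    case False
    then have ps: "p \<in> \<sigma> A" and neq: "\<sigma> A \<noteq> A" and x0: "?x 0 = level A + height (\<phi> p)"
      using other c0 by (auto simp: side_def)
    show ?thesis
    proof (cases "height (\<phi> p) = 0")
      case True
      then have "collar_param N h A ?x \<in> A" using collar_img_facts(4)[OF h A xE] x0 by simp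
      moreover have "\<tau> p = lift A (\<phi> p)" using \<tau>_eq[OF AS(2) ps] \<sigma>(2)[OF AS(1)] by simp
      ultimately have "collar_param N h A ?x = \<tau> p" using lift_phi[OF AS(1)] w by metis
      moreover have "p \<in> B" using True in_Y_iff[OF p1(2)] p1(1) by (auto simp: B_def M0_def)
      ultimately have "F p = F (collar_param N h A ?x)" using F_eq[OF p1(1) PM] by blast
      then show ?thesis by simp
    next
      case nz: False
      then have "?x 0 < level A" using x0 height by simp
      then have "collar_param N h A ?x = p" using collar_img_facts(6)[OF h A xE] lift_phi[OF AS(2) ps] w by metis
      then show ?thesis by simp
    qed
  qed
qed

text \<open>Each half of the parametrization is continuous into \<open>M0\<close>, and on the common level the values
  of the two halves are exchanged by \<open>\<tau>\<close>, so the halves agree in the quotient.\<close>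

lemma collar_param_cont:
  assumes h: "Ychart N N' h" and A: "A \<in> R"
  shows "continuous_map (subtopology (Euclidean_space k) (collar_img N N' h A)) Q (F \<circ> collar_param N h A)"
proof -
  let ?E = "collar_img N N' h A" and ?a = "level A"
  let ?X = "subtopology (Euclidean_space k) ?E"
  have AS: "A \<in> \<S>" "\<sigma> A \<in> \<S>" using A R(1) \<sigma>(1) by auto
  have ER: "?E \<subseteq> RR k" by (auto simp: collar_img_def half_space_def)
  then have tX: "topspace ?X = ?E" by (rule topspace_subtopology_RR)
  have piece: "continuous_map (subtopology ?X S') Q (F \<circ> (lift A' \<circ> (\<psi> \<circ> collar_lift N h ?a s)))"
    if S': "S' \<subseteq> ?E" and A': "A' \<in> \<S>" and
      s: "\<And>x. x \<in> S' \<Longrightarrow> s * (x 0 - ?a) = - \<bar>x 0 - ?a\<bar>" for S' A' s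
  proof -
    have sub: "subtopology ?X S' = subtopology (Euclidean_space k) S'"
      using S' by (simp add: subtopology_subtopology Int_absorb1)
    have tS: "topspace (subtopology (Euclidean_space k) S') = S'" using S' ER by (intro topspace_subtopology_RR) blast
    have x: "x \<in> RR k" "tail_coords x \<in> N'" "\<bar>s * (x 0 - ?a)\<bar> < 1" "\<psi> (collar_lift N h ?a s x) \<in> W" if "x \<in> S'" for x
      using that S' s[OF that] by (auto simp: collar_img_def half_space_def collar_lift_def)
    have "regular_map Smooth k (Suc n) S' (collar_lift N h ?a s)"
      by (rule regular_map_subset[OF collar_lift_regular[OF h]]) (use x in auto)
    then have r: "regular_map Smooth k n S' (\<psi> \<circ> collar_lift N h ?a s)"
      by (rule regular_map_compose[OF _ \<psi>_regular]) (use collar_lift_facts(4)[OF h] x in blast)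
    have "continuous_map (subtopology (Euclidean_space k) S') (subtopology (Euclidean_space n) W) (\<psi> \<circ> collar_lift N h ?a s)"
      unfolding continuous_map_in_subtopology using regular_map_continuous_map[OF r] x(4) tS by auto
    from continuous_map_compose[OF this lift_cont[OF A']]
    have c: "continuous_map (subtopology (Euclidean_space k) S') T (lift A' \<circ> (\<psi> \<circ> collar_lift N h ?a s))" .
    show ?thesis unfolding sub
    proof (rule into_Q_cont[OF c], unfold tS, intro subsetI, elim imageE)
      fix q x assume q: "q = (lift A' \<circ> (\<psi> \<circ> collar_lift N h ?a s)) x" "x \<in> S'"
      note g = collar_lift_facts[OF h x(1,2,3)[OF q(2)]]
      have "height (\<psi> (collar_lift N h ?a s x)) \<le> 0" using g(7) s[OF q(2)] by simp
      then have "\<psi> (collar_lift N h ?a s x) \<in> K \<union> Y" using in_KY_iff[OF g(5)] by blast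
      then show "q \<in> M0" using q x(4)[OF q(2)] lift_in[OF A'] phi_lift[OF A'] sheet_sub[OF A'] by (auto simp: M0_def)
    qed
  qed
  have "continuous_map ?X Q (\<lambda>x. if ?a \<le> x 0 then (F \<circ> (lift A \<circ> (\<psi> \<circ> collar_lift N h ?a (- 1)))) x
      else (F \<circ> (lift (\<sigma> A) \<circ> (\<psi> \<circ> collar_lift N h ?a 1))) x)"
  proof (rule continuous_map_cases_le)
    show "continuous_map ?X euclideanreal (\<lambda>x. ?a)" by simp
    have "continuous_on ?E (\<lambda>x. x 0)" by (rule continuous_on_product_then_coordinatewise[OF continuous_on_id])
    then show "continuous_map ?X euclideanreal (\<lambda>x. x 0)"
      using ER by (simp add: subtopology_RR Int_absorb1)
    show "continuous_map (subtopology ?X {x \<in> topspace ?X. ?a \<le> x 0}) Q (F \<circ> (lift A \<circ> (\<psi> \<circ> collar_lift N h ?a (- 1))))"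
      by (rule piece) (use tX AS in auto)
    show "continuous_map (subtopology ?X {x \<in> topspace ?X. x 0 \<le> ?a}) Q (F \<circ> (lift (\<sigma> A) \<circ> (\<psi> \<circ> collar_lift N h ?a 1)))"
      by (rule piece) (use tX AS in auto)
    fix x assume x: "x \<in> topspace ?X" "?a = x 0"
    then have xE: "x \<in> ?E" using tX by blast
    note f = collar_img_facts[OF h A xE]
    let ?w = "\<phi> (collar_param N h A x)"
    have w: "\<psi> (collar_lift N h ?a (- 1) x) = ?w" "\<psi> (collar_lift N h ?a 1 x) = ?w" "height ?w = 0" using f(4,5,12) x(2) by auto
    let ?p = "lift A ?w"
    have p: "?p \<in> A" "\<phi> ?p = ?w" using lift_in phi_lift AS f(7) by auto
    have wY: "?w \<in> Y" using in_Y_iff[OF f(8)] w(3) by blast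
    have pB: "?p \<in> B" using p wY sheet_sub[OF AS(1)] by (auto simp: B_def)
    have "\<tau> ?p = lift (\<sigma> A) ?w" using \<tau>_eq[OF AS(1) p(1)] p(2) by simp
    then have "F ?p = F (lift (\<sigma> A) ?w)" using F_eq[of ?p "lift (\<sigma> A) ?w"] pB \<tau>_B[OF pB] B_M0 by auto
    then show "(F \<circ> (lift A \<circ> (\<psi> \<circ> collar_lift N h ?a (- 1)))) x = (F \<circ> (lift (\<sigma> A) \<circ> (\<psi> \<circ> collar_lift N h ?a 1))) x"
      using w by simp
  qed
  then show ?thesis by (rule continuous_map_eq) (simp add: collar_param_def)
qed

lemma collar_img_open:
  assumes h: "Ychart N N' h" shows "openin (subtopology (Euclidean_space k) half_space) (collar_img N N' h A)"
proof -
  let ?a = "level A"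
  let ?Eb = "{x \<in> RR k. tail_coords x \<in> N'} \<inter> ({x \<in> RR k. ?a - 1 < x 0} \<inter> {x \<in> RR k. x 0 < ?a + 1})"
  let ?g = "\<lambda>x. (inv_into N h (tail_coords x))(n := - \<bar>x 0 - ?a\<bar>)"
  have "openin (Euclidean_space k) {x \<in> topspace (Euclidean_space k). tail_coords x \<in> N'}"
    using openin_continuous_map_preimage[OF regular_map_continuous_map[OF tail_coords_regular] Ychart_facts(2)[OF h]] by simp
  then have Eb: "openin (Euclidean_space k) ?Eb" by (intro openin_Int RR_open_halfspace)
  have gC: "?g x \<in> Cyl" if "x \<in> ?Eb" for x
  proof -
    have "\<bar>x 0 - ?a\<bar> < 1" using that by auto
    then show ?thesis using cyl_upd(1)[OF collar_lift_facts(1)[OF h, of x 0 ?a], of "- \<bar>x 0 - ?a\<bar>"] that by auto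
  qed
  have "continuous_on ?Eb ?g"
  proof (rule continuous_on_coordinatewise_then_product)
    have "regular_map Smooth k (Suc n) ?Eb (collar_lift N h 0 0)"
      by (rule regular_map_subset[OF collar_lift_regular[OF h]]) auto
    then have "continuous_on ?Eb (collar_lift N h 0 0)" by (rule regular_map_continuous_on)
    then have c: "continuous_on ?Eb (\<lambda>x. collar_lift N h 0 0 x i)" for i
      by (rule continuous_on_product_then_coordinatewise)
    fix i
    show "continuous_on ?Eb (\<lambda>x. ?g x i)"
    proof (cases "i = n")
      case True
      then show ?thesis
        by (auto intro!: continuous_intros continuous_on_product_then_coordinatewise[OF continuous_on_id])
    next
      case False
      then show ?thesis using c[of i] by (simp add: collar_lift_def)
    qed
  qed
  then have "continuous_on ?Eb (\<lambda>x. \<psi> (?g x))"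
    by (rule continuous_on_compose2[OF regular_map_continuous_on[OF \<psi>_regular]]) (use gC in blast)
  then have "openin (top_of_set ?Eb) (?Eb \<inter> (\<lambda>x. \<psi> (?g x)) -` (V \<inter> W))"
    by (rule continuous_openin_preimage[OF _ _ VW_open]) (use gC \<psi>_in in blast)
  moreover have "top_of_set ?Eb = subtopology (Euclidean_space k) ?Eb"
    unfolding subtopology_RR by (rule arg_cong[where f = top_of_set]) blast
  ultimately have "openin (Euclidean_space k) (?Eb \<inter> (\<lambda>x. \<psi> (?g x)) -` (V \<inter> W))"
    using openin_trans_full[OF _ Eb] by simp
  from openin_H[OF this] show ?thesis
  proof (rule back_subst[of "openin _"])
    show "?Eb \<inter> (\<lambda>x. \<psi> (?g x)) -` (V \<inter> W) \<inter> half_space = collar_img N N' h A"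
    proof (intro equalityI subsetI)
      fix x assume x: "x \<in> collar_img N N' h A"
      then have "x \<in> ?Eb" by (auto simp: collar_img_def half_space_def)
      then show "x \<in> ?Eb \<inter> (\<lambda>x. \<psi> (?g x)) -` (V \<inter> W) \<inter> half_space" using gC[of x] \<psi>_in x by (auto simp: collar_img_def)
    qed (auto simp: collar_img_def)
  qed
qed

lemma collar_dom_open:
  assumes h: "Ychart N N' h" and A: "A \<in> R"
  shows "openin Z (collar_dom N A)" "openin T {p \<in> topspace T. \<phi> p \<in> V \<and> foot (\<phi> p) \<in> N}"
proof -
  have AS: "A \<in> \<S>" "\<sigma> A \<in> \<S>" using A R(1) \<sigma>(1) by auto
  let ?O = "{p \<in> topspace T. \<phi> p \<in> V}"
  have "continuous_map (subtopology T ?O) (subtopology (Euclidean_space n) V) \<phi>"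
    unfolding continuous_map_in_subtopology using continuous_map_from_subtopology[OF phi_cont] by auto
  from continuous_map_compose[OF this regular_map_continuous_map[OF foot_regular]]
  have "openin (subtopology T ?O) {p \<in> topspace (subtopology T ?O). (foot \<circ> \<phi>) p \<in> N}"
    by (rule openin_continuous_map_preimage) (rule Ychart_facts(1)[OF h])
  from openin_trans_full[OF this V_open]
  show o: "openin T {p \<in> topspace T. \<phi> p \<in> V \<and> foot (\<phi> p) \<in> N}"
    by (rule back_subst[of "openin T"]) auto
  have "openin T ({p \<in> topspace T. \<phi> p \<in> V \<and> foot (\<phi> p) \<in> N} \<inter> (A \<union> \<sigma> A))"
    by (intro openin_Int openin_Un o sheet_open AS)
  then have "openin Z (M0 \<inter> ({p \<in> topspace T. \<phi> p \<in> V \<and> foot (\<phi> p) \<in> N} \<inter> (A \<union> \<sigma> A)))"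
    unfolding Z_def by (simp add: openin_subtopology_Int2)
  then show "openin Z (collar_dom N A)"
    by (rule back_subst[of "openin Z"]) (use M0_T in \<open>auto simp: collar_dom_def\<close>)
qed

text \<open>Coordinates agree on glued points because the sign multiplies the height, which vanishes
  there.\<close>

lemma collar_chart:
  assumes h: "Ychart N N' h" and A: "A \<in> R"
  shows "chart_upstairs (collar_dom N A) (collar_coord h A) (collar_img N N' h A) (collar_param N h A)"
  unfolding chart_upstairs_def
proof (intro conjI ballI impI)
  have AS: "A \<in> \<S>" "\<sigma> A \<in> \<S>" using A R(1) \<sigma>(1) by auto
  show "openin Z (collar_dom N A)" by (rule collar_dom_open[OF h A])
  show "openin (subtopology (Euclidean_space k) half_space) (collar_img N N' h A)" by (rule collar_img_open[OF h])
  show "continuous_map (subtopology (Euclidean_space k) (collar_img N N' h A)) Q (F \<circ> collar_param N h A)"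
    by (rule collar_param_cont[OF h A])
  show "collar_coord h A ` collar_dom N A \<subseteq> collar_img N N' h A" using collar_dom_facts(11)[OF h A] by blast
  show "collar_param N h A x \<in> collar_dom N A" "collar_coord h A (collar_param N h A x) = x" if "x \<in> collar_img N N' h A" for x
    using collar_img_facts(13,14)[OF h A that] .
  show "F (collar_param N h A (collar_coord h A p)) = F p" if "p \<in> collar_dom N A" for p using collar_dom_facts(12)[OF h A that] .
  {
    fix p q assume p: "p \<in> collar_dom N A" and q: "q \<in> topspace Z" "F q = F p"
    note f = collar_dom_facts[OF h A p]
    have qM: "q \<in> M0" using q topspace_Z by simp
    have "q \<in> collar_dom N A \<and> collar_coord h A q = collar_coord h A p"
    proof (cases "q = p")
      case False
      obtain A' where A': "A' = A \<or> A' = \<sigma> A" "p \<in> A'" "A' \<in> \<S>" using p AS by (auto simp: collar_dom_def)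
      then have q': "\<phi> p \<in> Y" "q \<in> \<sigma> A'" "\<phi> q = \<phi> p" using F_fibre[OF f(1) qM q(2) A'(3,2)] False by auto
      have "q \<in> A \<union> \<sigma> A" using q'(2) A'(1) \<sigma>(2)[OF AS(1)] by auto
      then have "q \<in> collar_dom N A" using q' qM p by (auto simp: collar_dom_def)
      moreover have "height (\<phi> p) = 0" using in_Y_iff[OF f(2)] q' by blast
      then have "collar_coord h A q = collar_coord h A p" using q'(3) by (simp add: collar_coord_def collar_fun_def cong: nat.case_cong)
      ultimately show ?thesis by blast
    qed (use p in simp)
  }
  then show "q \<in> collar_dom N A" "collar_coord h A q = collar_coord h A p" if "p \<in> collar_dom N A" "q \<in> topspace Z" "F q = F p" for p q
    using that by blast+
  have DM: "collar_dom N A \<subseteq> M0" by (auto simp: collar_dom_def)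
  have tD: "topspace (subtopology T (collar_dom N A)) = collar_dom N A" using DM M0_T by auto
  have "continuous_map (subtopology T (collar_dom N A)) (Euclidean_space k) (collar_coord h A)"
  proof (rule pasting_lemma[where I = "{A, \<sigma> A}" and T = "\<lambda>A'. collar_dom N A \<inter> A'"
        and f = "\<lambda>A'. collar_fun h (level A) (if A' = A then - 1 else 1) \<circ> \<phi>"])
    fix A' assume A': "A' \<in> {A, \<sigma> A}"
    then have "A' \<in> \<S>" using AS by auto
    then show "openin (subtopology T (collar_dom N A)) (collar_dom N A \<inter> A')"
      using sheet_open by (simp add: openin_subtopology_Int2)
    have "continuous_map (subtopology T (collar_dom N A \<inter> A')) (subtopology (Euclidean_space n) {w \<in> V. foot w \<in> N}) \<phi>"
      unfolding continuous_map_in_subtopology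
      using continuous_map_from_subtopology[OF phi_cont] by (auto simp: collar_dom_def)
    from continuous_map_compose[OF this regular_map_continuous_map[OF collar_fun_regular[OF h]]]
    show "continuous_map (subtopology (subtopology T (collar_dom N A)) (collar_dom N A \<inter> A')) (Euclidean_space k)
        (collar_fun h (level A) (if A' = A then - 1 else 1) \<circ> \<phi>)"
      by (simp add: subtopology_subtopology)
  next
    fix A1 A2 x assume "A1 \<in> {A, \<sigma> A}" "A2 \<in> {A, \<sigma> A}"
      "x \<in> topspace (subtopology T (collar_dom N A)) \<inter> (collar_dom N A \<inter> A1) \<inter> (collar_dom N A \<inter> A2)"
    then have "A1 = A2" using sheet_disjoint[of A1 A2 x] AS by blast
    then show "(collar_fun h (level A) (if A1 = A then - 1 else 1) \<circ> \<phi>) x = (collar_fun h (level A) (if A2 = A then - 1 else 1) \<circ> \<phi>) x"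
      by simp
  next
    fix x assume "x \<in> topspace (subtopology T (collar_dom N A))"
    then have x: "x \<in> collar_dom N A" using tD by blast
    show "\<exists>A'. A' \<in> {A, \<sigma> A} \<and> x \<in> collar_dom N A \<inter> A' \<and> collar_coord h A x = (collar_fun h (level A) (if A' = A then - 1 else 1) \<circ> \<phi>) x"
    proof (cases "x \<in> A")
      case True
      then show ?thesis using x by (intro exI[of _ A]) (simp add: collar_coord_def side_def)
    next
      case False
      then show ?thesis using x collar_dom_facts(8)[OF h A x] by (intro exI[of _ "\<sigma> A"]) (simp add: collar_coord_def side_def)
    qed
  qed
  then show "continuous_map (subtopology Z (collar_dom N A)) (Euclidean_space k) (collar_coord h A)"
    unfolding Z_def subtopology_subtopology using DM by (simp add: Int_absorb1)
qed


subsection \<open>Coordinate changes\<close>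

lemma interior_img_facts:
  assumes "(D, c) \<in> \<A>" "x \<in> interior_img D c b"
  shows "x \<in> RR k" "interior_param D c b x \<in> D" "interior_param D c b x \<in> topspace T" "shift (- b) x \<in> c ` D"
    "c (interior_param D c b x) = shift (- b) x" "(inv_into D c \<circ> shift (- b)) x = interior_param D c b x"
proof -
  show "x \<in> RR k" and im: "shift (- b) x \<in> c ` D" using assms(2) by (auto simp: interior_img_def)
  show "interior_param D c b x \<in> D" "c (interior_param D c b x) = shift (- b) x"
    using inv_into_into[OF im] f_inv_into_f[OF im] by (simp_all add: interior_param_def)
  then show "interior_param D c b x \<in> topspace T" using chart_facts(1)[OF assms(1)] openin_subset by blast
qed (simp add: interior_param_def)

lemma interior_interior:
  assumes C: "(D, c) \<in> \<A>" and C': "(D', c') \<in> \<A>"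
  shows "regular_map Smooth k k {x \<in> interior_img D c b. interior_param D c b x \<in> interior_dom D' c' b'} (interior_coord c' b' \<circ> interior_param D c b)"
proof -
  let ?S = "{x \<in> interior_img D c b. interior_param D c b x \<in> interior_dom D' c' b'}"
  have S: "?S \<subseteq> RR k" using interior_img_facts(1)[OF C] by blast
  have 1: "regular_map Smooth k k ?S ((c' \<circ> inv_into D c) \<circ> shift (- b))"
  proof (rule regular_map_compose[OF regular_map_subset[OF shift_regular S] transition_regular[OF C C']], rule image_subsetI)
    fix x assume "x \<in> ?S"
    then have "x \<in> interior_img D c b" "interior_param D c b x \<in> D'" by (auto simp: interior_dom_def)
    then show "shift (- b) x \<in> c ` (D \<inter> D')" using interior_img_facts(2,5)[OF C] by (metis IntI image_eqI)
  qed
  have "regular_map Smooth k k ?S (shift b' \<circ> ((c' \<circ> inv_into D c) \<circ> shift (- b)))"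
    by (rule regular_map_compose[OF 1 shift_regular]) (use 1 in \<open>auto simp: regular_map_def\<close>)
  then show ?thesis by (simp add: interior_coord_def interior_param_def comp_assoc)
qed

text \<open>Over \<open>K\<close> the height is negative, so \<open>x 0\<close> stays away from the level, where the
  parametrization changes sheets. On either side it is the composite of the collar map, the
  smooth inverse of \<open>\<phi>\<close> on one sheet, and an analytic chart.\<close>

lemma collar_interior:
  assumes h: "Ychart N N' h" and A: "A \<in> R" and C: "(D, c) \<in> \<A>"
  shows "regular_map Smooth k k {x \<in> collar_img N N' h A. collar_param N h A x \<in> interior_dom D c b} (interior_coord c b \<circ> collar_param N h A)"
proof -
  let ?S = "{x \<in> collar_img N N' h A. collar_param N h A x \<in> interior_dom D c b}" and ?a = "level A"
  have AS: "A \<in> \<S>" "\<sigma> A \<in> \<S>" using A R(1) \<sigma>(1) by auto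
  have S: "?S \<subseteq> RR k" using collar_img_facts(1)[OF h A] by blast
  have piece: "regular_map Smooth k k S' (interior_coord c b \<circ> collar_param N h A)"
    if S': "S' \<subseteq> ?S" and A': "A' \<in> \<S>" and s: "\<bar>s\<bar> = 1"
      and e: "\<And>x. x \<in> S' \<Longrightarrow> collar_param N h A x \<in> A' \<and> \<phi> (collar_param N h A x) = \<psi> (collar_lift N h ?a s x)" for S' A' s
  proof -
    have g: "collar_lift N h ?a s x \<in> Cyl" if "x \<in> S'" for x
    proof (rule collar_lift_facts(4)[OF h])
      show "x \<in> RR k" "tail_coords x \<in> N'" "\<bar>s * (x 0 - ?a)\<bar> < 1"
        using that S' S s by (auto simp: collar_img_def abs_mult)
    qed
    have "regular_map Smooth k (Suc n) S' (collar_lift N h ?a s)"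
      by (rule regular_map_subset[OF collar_lift_regular[OF h]]) (use S' S in \<open>auto simp: collar_img_def\<close>)
    then have "regular_map Smooth k n S' (\<psi> \<circ> collar_lift N h ?a s)"
      by (rule regular_map_compose[OF _ \<psi>_regular]) (use g in blast)
    then have 1: "regular_map Smooth k k S' ((c \<circ> lift A') \<circ> (\<psi> \<circ> collar_lift N h ?a s))"
    proof (rule regular_map_compose[OF _ sheet_regular[OF A' C]], intro image_subsetI)
      fix x assume x: "x \<in> S'"
      then have "collar_param N h A x \<in> A' \<inter> D" using e S' by (auto simp: interior_dom_def)
      then show "(\<psi> \<circ> collar_lift N h ?a s) x \<in> \<phi> ` (A' \<inter> D)" using e[OF x] by (metis comp_apply imageI)
    qed
    have "regular_map Smooth k k S' (shift b \<circ> ((c \<circ> lift A') \<circ> (\<psi> \<circ> collar_lift N h ?a s)))"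
      by (rule regular_map_compose[OF 1 shift_regular]) (use 1 in \<open>auto simp: regular_map_def\<close>)
    then show ?thesis
    proof (rule regular_map_cong)
      fix x assume x: "x \<in> S'"
      have "collar_param N h A x = lift A' (\<psi> (collar_lift N h ?a s x))" using e[OF x] lift_phi[OF A'] by metis
      then show "(shift b \<circ> ((c \<circ> lift A') \<circ> (\<psi> \<circ> collar_lift N h ?a s))) x = (interior_coord c b \<circ> collar_param N h A) x"
        by (simp add: interior_coord_def)
    qed
  qed
  show ?thesis
  proof (rule regular_map_local[OF S])
    fix x assume x: "x \<in> ?S"
    then have xE: "x \<in> collar_img N N' h A" and xK: "\<phi> (collar_param N h A x) \<in> K" by (auto simp: interior_dom_def)
    have "height (\<phi> (collar_param N h A x)) < 0" using in_K_iff[OF collar_img_facts(8)[OF h A xE]] xK by blast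
    then have "x 0 \<noteq> ?a" using collar_img_facts(12)[OF h A xE] by auto
    then consider "x 0 > ?a" | "x 0 < ?a" by linarith
    then show "\<exists>P. openin (Euclidean_space k) P \<and> x \<in> P \<and> regular_map Smooth k k (?S \<inter> P) (interior_coord c b \<circ> collar_param N h A)"
    proof cases
      case 1
      have "regular_map Smooth k k (?S \<inter> {x \<in> RR k. ?a < x 0}) (interior_coord c b \<circ> collar_param N h A)"
        by (rule piece[of _ A "- 1"]) (use AS collar_img_facts(4)[OF h A] in auto)
      then show ?thesis using RR_open_halfspace(1) 1 x S by (intro exI[of _ "{x \<in> RR k. ?a < x 0}"]) auto
    next
      case 2
      have "regular_map Smooth k k (?S \<inter> {x \<in> RR k. x 0 < ?a}) (interior_coord c b \<circ> collar_param N h A)"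
      proof (rule piece)
        fix y assume "y \<in> ?S \<inter> {x \<in> RR k. x 0 < ?a}"
        then have y: "y \<in> collar_img N N' h A" "y 0 < ?a" by auto
        show "collar_param N h A y \<in> \<sigma> A \<and> \<phi> (collar_param N h A y) = \<psi> (collar_lift N h ?a 1 y)"
          using collar_img_facts(6)[OF h A y, THEN conjunct1] collar_img_facts(5)[OF h A y(1)] y(2) by simp
      qed (use AS in auto)
      then show ?thesis using RR_open_halfspace(2) 2 x S by (intro exI[of _ "{x \<in> RR k. x 0 < ?a}"]) auto
    qed
  qed
qed

text \<open>The sheets are open, so locally the sign in the collar coordinates is constant.\<close>

lemma interior_collar:
  assumes h: "Ychart N N' h" and A: "A \<in> R" and C: "(D, c) \<in> \<A>"
  shows "regular_map Smooth k k {x \<in> interior_img D c b. interior_param D c b x \<in> collar_dom N A} (collar_coord h A \<circ> interior_param D c b)"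
proof -
  let ?S = "{x \<in> interior_img D c b. interior_param D c b x \<in> collar_dom N A}" and ?a = "level A"
  have AS: "A \<in> \<S>" "\<sigma> A \<in> \<S>" using A R(1) \<sigma>(1) by auto
  have S: "?S \<subseteq> RR k" using interior_img_facts(1)[OF C] by blast
  show ?thesis
  proof (rule regular_map_local[OF S])
    fix x assume x: "x \<in> ?S"
    define A' where "A' = (if interior_param D c b x \<in> A then A else \<sigma> A)"
    define s :: real where "s = (if A' = A then - 1 else 1)"
    define P where "P = {y \<in> topspace (Euclidean_space k). shift (- b) y \<in> c ` (D \<inter> A')}"
    have A': "A' \<in> \<S>" "interior_param D c b x \<in> A'" "A' = A \<or> A' = \<sigma> A \<and> \<sigma> A \<noteq> A"
      using x AS collar_dom_facts(8)[OF h A, of "interior_param D c b x"] by (auto simp: A'_def)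
    have "continuous_map (Euclidean_space k) (Euclidean_space k) (shift (- b))"
      using regular_map_continuous_map[OF shift_regular] by simp
    then have "openin (Euclidean_space k) P" unfolding P_def
      by (rule openin_continuous_map_preimage) (rule chart_image_open[OF C sheet_open[OF A'(1)]])
    moreover have "x \<in> P" unfolding P_def using x A'(2) interior_img_facts(1,2,5)[OF C, of x b] by (auto intro: image_eqI[where x = "interior_param D c b x"] sym)
    moreover have "regular_map Smooth k k (?S \<inter> P) (collar_coord h A \<circ> interior_param D c b)"
    proof -
      have "regular_map Smooth k n (?S \<inter> P) ((\<phi> \<circ> inv_into D c) \<circ> shift (- b))"
        by (rule regular_map_compose[OF regular_map_subset[OF shift_regular] phi_chart_regular[OF C]])
          (use S interior_img_facts(4)[OF C] in auto)
      then have "regular_map Smooth k k (?S \<inter> P) (collar_fun h ?a s \<circ> ((\<phi> \<circ> inv_into D c) \<circ> shift (- b)))"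
        by (rule regular_map_compose[OF _ collar_fun_regular[OF h]]) (auto simp: collar_dom_def interior_param_def)
      then show ?thesis
      proof (rule regular_map_cong)
        fix y assume y: "y \<in> ?S \<inter> P"
        then have yE: "y \<in> interior_img D c b" by blast
        obtain p where p: "p \<in> D" "p \<in> A'" "shift (- b) y = c p" using y by (auto simp: P_def)
        then have yp: "interior_param D c b y = p" using chart_facts(3)[OF C] by (simp add: interior_param_def)
        have "side A p = s"
        proof (cases "A' = A")
          case True
          then show ?thesis using p(2) by (simp add: s_def side_def)
        next
          case False
          then show ?thesis using A'(3) p(2) side_other[OF A, of p] by (simp add: s_def)
        qed
        then have "side A (interior_param D c b y) = s" using yp by simp
        then show "(collar_fun h ?a s \<circ> ((\<phi> \<circ> inv_into D c) \<circ> shift (- b))) y = (collar_coord h A \<circ> interior_param D c b) y"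
          by (simp add: collar_coord_def interior_param_def)
      qed
    qed
    ultimately show "\<exists>P. openin (Euclidean_space k) P \<and> x \<in> P \<and> regular_map Smooth k k (?S \<inter> P) (collar_coord h A \<circ> interior_param D c b)"
      by blast
  qed
qed

text \<open>As \<open>R\<close> contains one sheet of each pair, overlapping collar charts belong to the same pair
  and differ only in the chart of \<open>Y\<close>. Coordinate \<open>0\<close> is preserved, so the transition is
  smooth also across the level.\<close>

lemma collar_collar:
  assumes h: "Ychart N N' h" and A: "A \<in> R" and h1: "Ychart N1 N1' h1" and A1: "A1 \<in> R"
  shows "regular_map Smooth k k {x \<in> collar_img N N' h A. collar_param N h A x \<in> collar_dom N1 A1} (collar_coord h1 A1 \<circ> collar_param N h A)"
proof (cases "{x \<in> collar_img N N' h A. collar_param N h A x \<in> collar_dom N1 A1} = {}")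
  case True
  show ?thesis unfolding True by (simp add: regular_map_def)
next
  case False
  let ?S = "{x \<in> collar_img N N' h A. collar_param N h A x \<in> collar_dom N1 A1}"
  have AS: "A \<in> \<S>" "\<sigma> A \<in> \<S>" "A1 \<in> \<S>" "\<sigma> A1 \<in> \<S>" using A A1 R(1) \<sigma>(1) by auto
  have "A1 = A"
  proof -
    obtain x where x: "x \<in> collar_img N N' h A" "collar_param N h A x \<in> collar_dom N1 A1" using False by blast
    then have "collar_param N h A x \<in> A \<union> \<sigma> A" "collar_param N h A x \<in> A1 \<union> \<sigma> A1"
      using collar_img_facts(13)[OF h A x(1)] by (auto simp: collar_dom_def)
    then consider "A = A1" | "A = \<sigma> A1" | "\<sigma> A = A1" | "\<sigma> A = \<sigma> A1" using sheet_disjoint AS by blast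
    then show ?thesis using R(3) A A1 \<sigma>(2) AS by cases metis+
  qed
  have S: "?S \<subseteq> RR k" using collar_img_facts(1)[OF h A] by blast
  have x: "(collar_coord h1 A1 \<circ> collar_param N h A) x 0 = x 0" "tail_coords ((collar_coord h1 A1 \<circ> collar_param N h A) x) = h1 (inv_into N h (tail_coords x))"
      "(collar_coord h1 A1 \<circ> collar_param N h A) x \<in> RR k" "inv_into N h (tail_coords x) \<in> N1" "tail_coords x \<in> N'" if x: "x \<in> ?S" for x
  proof -
    have xE: "x \<in> collar_img N N' h A" and xD: "collar_param N h A x \<in> collar_dom N1 A" using x \<open>A1 = A\<close> by auto
    note f = collar_dom_facts[OF h1 A xD]
    have "collar_coord h A (collar_param N h A x) 0 = x 0" using collar_img_facts(14)[OF h A xE] by simp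
    then show "(collar_coord h1 A1 \<circ> collar_param N h A) x 0 = x 0" using \<open>A1 = A\<close> by (simp add: collar_coord_def collar_fun_def)
    show "tail_coords ((collar_coord h1 A1 \<circ> collar_param N h A) x) = h1 (inv_into N h (tail_coords x))" "inv_into N h (tail_coords x) \<in> N1"
      using f(4,10) collar_img_facts(9)[OF h A xE] \<open>A1 = A\<close> by simp_all
    show "(collar_coord h1 A1 \<circ> collar_param N h A) x \<in> RR k" using f(11) \<open>A1 = A\<close> by (auto simp: collar_img_def half_space_def)
    show "tail_coords x \<in> N'" by (rule collar_img_facts(3)[OF h A xE])
  qed
  have "regular_map Smooth k n ?S (inv_into N h \<circ> tail_coords)"
    by (rule regular_map_compose[OF regular_map_subset[OF tail_coords_regular S] Ychart_facts(4)[OF h]]) (use x(5) in blast)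
  then have hh: "regular_map Smooth k n ?S (h1 \<circ> (inv_into N h \<circ> tail_coords))"
    by (rule regular_map_compose[OF _ Ychart_facts(3)[OF h1]]) (use x(4) in auto)
  have "smooth_on k ?S (\<lambda>x. (collar_coord h1 A1 \<circ> collar_param N h A) x i)" if i: "i < k" for i
  proof (cases i)
    case 0
    show ?thesis by (rule smooth_on_cong[OF smooth_on_affine[OF S, of 0 1 0]]) (use x(1) in \<open>simp add: 0\<close>)
  next
    case (Suc l)
    then have "smooth_on k ?S (\<lambda>x. (h1 \<circ> (inv_into N h \<circ> tail_coords)) x l)"
      using hh i j_le_n unfolding regular_map_smooth_iff by simp
    then show ?thesis
    proof (rule smooth_on_cong)
      fix y assume "y \<in> ?S"
      from x(2)[OF this] have "tail_coords ((collar_coord h1 A1 \<circ> collar_param N h A) y) l = h1 (inv_into N h (tail_coords y)) l" by (rule fun_cong)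
      then show "(h1 \<circ> (inv_into N h \<circ> tail_coords)) y l = (collar_coord h1 A1 \<circ> collar_param N h A) y i" by (simp add: tail_coords_def Suc)
    qed
  qed
  then show ?thesis unfolding regular_map_smooth_iff using S x(3) by blast
qed

subsection \<open>The glued manifold\<close>

definition glued_chart where
  "glued_chart D c E P \<longleftrightarrow>
     (\<exists>D0 c0 b. (D0, c0) \<in> \<A> \<and> D = interior_dom D0 c0 b \<and> c = interior_coord c0 b \<and> E = interior_img D0 c0 b \<and> P = interior_param D0 c0 b) \<or>
     (\<exists>N N' h A. Ychart N N' h \<and> A \<in> R \<and> D = collar_dom N A \<and> c = collar_coord h A \<and> E = collar_img N N' h A \<and> P = collar_param N h A)"

definition glued_atlas where
  "glued_atlas = {(F ` D, descend c) | D c E P. glued_chart D c E P}"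

lemma glued_chart_upstairs: "glued_chart D c E P \<Longrightarrow> chart_upstairs D c E P"
  unfolding glued_chart_def using interior_chart collar_chart by blast

lemma glued_chart_transition:
  assumes "glued_chart D c E P" "glued_chart D' c' E' P'"
  shows "regular_map Smooth k k {x \<in> E. P x \<in> D'} (c' \<circ> P)"
  using assms interior_interior interior_collar collar_interior collar_collar
  unfolding glued_chart_def by (elim disjE exE conjE) simp_all

lemma Ychart_at: assumes "y \<in> Y" shows "\<exists>N N' h. Ychart N N' h \<and> y \<in> N"
  using Y_submanifold assms unfolding submanifold_def Ychart_def by (metis Int_commute)

text \<open>Over \<open>K\<close>, translating an analytic chart so that coordinate \<open>0\<close> of the given point becomes
  \<open>1\<close> puts the point into an interior chart.\<close>

lemma glued_chart_at:
  assumes p: "p \<in> M0" shows "\<exists>D c E P. glued_chart D c E P \<and> p \<in> D"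
proof (cases "\<phi> p \<in> K")
  case True
  obtain D c where C: "(D, c) \<in> \<A>" "p \<in> D" using atlas_cover p M0_T by blast
  have "p \<in> interior_dom D c (1 - c p 0)" using C True by (simp add: interior_dom_def)
  then show ?thesis using C unfolding glued_chart_def by blast
next
  case False
  then have pB: "p \<in> B" and pY: "\<phi> p \<in> Y" using p by (auto simp: M0_def B_def)
  obtain A where A: "A \<in> \<S>" "p \<in> A" using B_sheet[OF pB] by blast
  have V: "\<phi> p \<in> V" using pY Y_V by blast
  obtain N N' h where h: "Ychart N N' h" "foot (\<phi> p) \<in> N" using Ychart_at[OF foot_Y[OF V]] by blast
  obtain A1 where A1: "A1 \<in> R" "p \<in> A1 \<union> \<sigma> A1"
  proof (cases "A \<in> R")
    case False
    then have "\<sigma> A \<in> R" "p \<in> \<sigma> (\<sigma> A)" using R(2) \<sigma>(2) A by auto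
    then show ?thesis using that by blast
  qed (use that A in blast)
  have "p \<in> collar_dom N A1" using p V h A1 by (simp add: collar_dom_def)
  then show ?thesis using h A1 unfolding glued_chart_def by blast
qed

lemma topspace_Q: "topspace Q = F ` M0"
  using quotient_imp_surjective_map[OF Q(4)] topspace_Z by simp

lemma glued_manifold: "smooth_manifold_with_boundary j Q glued_atlas"
proof -
  have half_space: "{x \<in> RR (Suc j). 0 \<le> x 0} = half_space" by (simp add: half_space_def)
  have "\<forall>C\<in>glued_atlas. chart_on k half_space Q C"
    unfolding glued_atlas_def using chart_on_descend[OF glued_chart_upstairs] by blast
  moreover have "\<forall>C\<in>glued_atlas. \<forall>C'\<in>glued_atlas. compatible_charts Smooth k C C'"
  proof (intro ballI)
    fix C C' assume "C \<in> glued_atlas" "C' \<in> glued_atlas"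
    then obtain D c E P D' c' E' P' where C: "C = (F ` D, descend c)" "glued_chart D c E P"
      "C' = (F ` D', descend c')" "glued_chart D' c' E' P'" unfolding glued_atlas_def by blast
    show "compatible_charts Smooth k C C'"
      unfolding C(1,3) using glued_chart_upstairs C(2,4) glued_chart_transition
      by (intro compatible_descend) blast+
  qed
  moreover have "(\<Union>(D, c)\<in>glued_atlas. D) = topspace Q"
  proof (intro equalityI subsetI)
    fix m assume "m \<in> (\<Union>(D, c)\<in>glued_atlas. D)"
    then obtain D c E P where "glued_chart D c E P" "m \<in> F ` D" unfolding glued_atlas_def by blast
    then show "m \<in> topspace Q" using chart_upstairsD(2)[OF glued_chart_upstairs] topspace_Z topspace_Q by blast
  next
    fix m assume "m \<in> topspace Q"
    then obtain p where p: "p \<in> M0" "m = F p" using topspace_Q by blast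
    then obtain D c E P where D: "glued_chart D c E P" "p \<in> D" using glued_chart_at by blast
    then have "(F ` D, descend c) \<in> glued_atlas" unfolding glued_atlas_def by blast
    then show "m \<in> (\<Union>(D, c)\<in>glued_atlas. D)" using p D by blast
  qed
  ultimately show ?thesis
    unfolding smooth_manifold_with_boundary_def manifold_modelled_on_def half_space using Q by blast
qed

lemma A0_S: "A0 \<in> \<S>" using A0(1) R(1) by blast
lemma level_A0: "level A0 = 0" using A0(2) by (simp add: level_def)

lemma interior_positive:
  assumes "(D, c) \<in> \<A>" "p \<in> interior_dom D c b" shows "interior_coord c b p 0 > 0" "p \<notin> B"
  using assms K_Y by (auto simp: interior_dom_def interior_coord_def shift_0 B_def)

text \<open>Coordinate \<open>0\<close> differs from the level by less than \<open>1\<close>, so it can vanish only at level \<open>0\<close>,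
  that is, on the unpaired sheet.\<close>

lemma collar_zero:
  assumes h: "Ychart N N' h" and A: "A \<in> R" and p: "p \<in> collar_dom N A"
  shows "collar_coord h A p 0 = 0 \<longleftrightarrow> p \<in> A0 \<inter> B"
proof -
  note f = collar_dom_facts[OF h A p]
  have AS: "A \<in> \<S>" "\<sigma> A \<in> \<S>" using A R(1) \<sigma>(1) by auto
  have B: "p \<in> B \<longleftrightarrow> height (\<phi> p) = 0" using in_Y_iff[OF f(2)] f(1) by (auto simp: B_def M0_def)
  show ?thesis
  proof (cases "\<sigma> A = A")
    case True
    then have "A = A0" "p \<in> A" using A0(3) A f(8) by auto
    then show ?thesis using f(9) B level_A0 by (auto simp: side_def)
  next
    case False
    then have "collar_coord h A p 0 > 0" using f(6,7,9) by (auto simp: level_def side_def)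
    moreover have "p \<notin> A0"
    proof
      assume "p \<in> A0"
      then have "A0 = A \<or> A0 = \<sigma> A" using sheet_disjoint A0_S AS p by (auto simp: collar_dom_def)
      then show False using False A0(2) \<sigma>(2)[OF AS(1)] by metis
    qed
    ultimately show ?thesis by auto
  qed
qed

lemma glued_boundary: "manifold_boundary glued_atlas = F ` (A0 \<inter> B)"
proof (intro equalityI subsetI)
  fix m assume "m \<in> manifold_boundary glued_atlas"
  then obtain D c E P p where D: "glued_chart D c E P" "p \<in> D" "m = F p" "descend c (F p) 0 = 0"
    unfolding manifold_boundary_def glued_atlas_def by blast
  then have z: "c p 0 = 0" using descend_F[OF glued_chart_upstairs] by simp
  from D(1) show "m \<in> F ` (A0 \<inter> B)" unfolding glued_chart_def
  proof (elim disjE exE conjE)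
    fix D0 c0 b assume "(D0, c0) \<in> \<A>" "D = interior_dom D0 c0 b" "c = interior_coord c0 b"
    then show ?thesis using interior_positive(1) D(2) z by fastforce
  next
    fix N N' h A assume "Ychart N N' h" "A \<in> R" "D = collar_dom N A" "c = collar_coord h A"
    then show ?thesis using collar_zero D(2,3) z by blast
  qed
next
  fix m assume "m \<in> F ` (A0 \<inter> B)"
  then obtain p where p: "p \<in> A0" "p \<in> B" "m = F p" by blast
  then obtain D c E P where D: "glued_chart D c E P" "p \<in> D" using glued_chart_at B_M0 by blast
  have "c p 0 = 0" using D(1) unfolding glued_chart_def
  proof (elim disjE exE conjE)
    fix D0 c0 b assume "(D0, c0) \<in> \<A>" "D = interior_dom D0 c0 b"
    then show ?thesis using interior_positive(2) D(2) p by blast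
  next
    fix N N' h A assume "Ychart N N' h" "A \<in> R" "D = collar_dom N A" "c = collar_coord h A"
    then show ?thesis using collar_zero D(2) p by blast
  qed
  then have "descend c (F p) 0 = 0" using descend_F[OF glued_chart_upstairs[OF D(1)] D(2)] by simp
  moreover have "(F ` D, descend c) \<in> glued_atlas" using D(1) unfolding glued_atlas_def by blast
  ultimately show "m \<in> manifold_boundary glued_atlas"
    unfolding manifold_boundary_def using D(2) p(3) by blast
qed

definition glued_phi where "glued_phi = \<phi> \<circ> inv_into M0 F"

lemma glued_phi_F: assumes "p \<in> M0" shows "glued_phi (F p) = \<phi> p"
proof -
  have "F p \<in> F ` M0" using assms by blast
  from F_phi[OF assms inv_into_into[OF this] f_inv_into_f[OF this]] show ?thesis by (simp add: glued_phi_def)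
qed

text \<open>On \<open>A0\<close> the map \<open>\<phi>\<close> is a diffeomorphism onto \<open>W\<close>, and nothing is glued to \<open>A0 \<inter> B\<close>. The
  inverse of a boundary chart followed by \<open>\<phi>\<close> is the inverse of a chart of \<open>Y\<close> followed by the
  collar map at height zero.\<close>

lemma boundary_iso: "manifold_iso_onto Smooth k Q glued_atlas (F ` (A0 \<inter> B)) n Y glued_phi"
proof -
  let ?S = "F ` (A0 \<inter> B)"
  have secY: "lift A0 w \<in> A0 \<inter> B" "\<phi> (lift A0 w) = w" if "w \<in> Y" for w
    using that lift_in[OF A0_S] phi_lift[OF A0_S] Y_W sheet_sub[OF A0_S] by (auto simp: B_def)
  have S_eq: "?S = (F \<circ> lift A0) ` Y"
  proof (intro equalityI subsetI)
    fix m assume "m \<in> ?S"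
    then obtain p where p: "p \<in> A0" "p \<in> B" "m = F p" by blast
    then have "p = lift A0 (\<phi> p)" "\<phi> p \<in> Y" using lift_phi[OF A0_S] by (auto simp: B_def)
    then show "m \<in> (F \<circ> lift A0) ` Y" using p by (metis comp_apply imageI)
  qed (use secY in auto)
  have gp: "glued_phi ((F \<circ> lift A0) w) = w" if "w \<in> Y" for w
    using glued_phi_F[of "lift A0 w"] secY[OF that] B_M0 by auto
  have SQ: "?S \<subseteq> topspace Q" using topspace_Q B_M0 by blast
  have tY: "topspace (subtopology (Euclidean_space n) Y) = Y" using Y_RR by (rule topspace_subtopology_RR)
  have "continuous_map (subtopology (Euclidean_space n) Y) T (lift A0)"
    using continuous_map_from_subtopology_mono[OF lift_cont[OF A0_S] Y_W] .
  then have "continuous_map (subtopology (Euclidean_space n) Y) Q (F \<circ> lift A0)"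
    by (rule into_Q_cont) (unfold tY, use secY(1) B_M0 in blast)
  then have "continuous_map (subtopology (Euclidean_space n) Y) (subtopology Q ?S) (F \<circ> lift A0)"
    unfolding continuous_map_in_subtopology tY S_eq by blast
  moreover have "compact_space (subtopology (Euclidean_space n) Y)"
    using Y_compact by (rule compact_space_subtopology)
  moreover have "Hausdorff_space (subtopology Q ?S)" using Q(1) by (rule Hausdorff_space_subtopology)
  moreover have "(F \<circ> lift A0) ` topspace (subtopology (Euclidean_space n) Y) = topspace (subtopology Q ?S)"
    unfolding tY using SQ S_eq by (simp add: Int_absorb1)
  moreover have "inj_on (F \<circ> lift A0) (topspace (subtopology (Euclidean_space n) Y))"
    unfolding tY using gp by (metis inj_onI)
  ultimately have "homeomorphic_map (subtopology (Euclidean_space n) Y) (subtopology Q ?S) (F \<circ> lift A0)"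
    by (rule continuous_imp_homeomorphic_map)
  then obtain g where g: "homeomorphic_maps (subtopology (Euclidean_space n) Y) (subtopology Q ?S) (F \<circ> lift A0) g"
    using homeomorphic_map_maps by blast
  then have "homeomorphic_map (subtopology Q ?S) (subtopology (Euclidean_space n) Y) g"
    using homeomorphic_maps_sym homeomorphic_map_maps by blast
  moreover have "g m = glued_phi m" if m: "m \<in> topspace (subtopology Q ?S)" for m
  proof -
    have "m \<in> ?S" using m by simp
    then obtain w where w: "w \<in> Y" "m = (F \<circ> lift A0) w" using S_eq by blast
    then have "g m = w" using g tY unfolding homeomorphic_maps_def by auto
    then show ?thesis using gp w by simp
  qed
  ultimately have homeo: "homeomorphic_map (subtopology Q ?S) (subtopology (Euclidean_space n) Y) glued_phi"
    by (rule homeomorphic_map_eq)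
  have inj: "inj_on glued_phi ?S" unfolding S_eq
    by (rule inj_on_inverseI[where g = "F \<circ> lift A0"]) (use gp in auto)
  have charts: "regular_map Smooth k n (descend c ` (?S \<inter> F ` D)) (glued_phi \<circ> inv_into (F ` D) (descend c)) \<and>
      regular_map Smooth n k (glued_phi ` (?S \<inter> F ` D)) (descend c \<circ> inv_into ?S glued_phi)"
    if G: "glued_chart D c E P" for D c E P
  proof (cases "?S \<inter> F ` D = {}")
    case True
    then show ?thesis by (simp add: regular_map_def)
  next
    case False
    note U = glued_chart_upstairs[OF G]
    have rep: "p \<in> D" if "p \<in> A0 \<inter> B" "F p \<in> F ` D" for p
      using that saturated[OF U] B_M0 topspace_Z by blast
    then obtain p where p: "p \<in> A0" "p \<in> B" "p \<in> D" using False by blast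
    obtain N N' h A where h: "Ychart N N' h" and A: "A \<in> R"
      and e: "D = collar_dom N A" "c = collar_coord h A" "E = collar_img N N' h A" "P = collar_param N h A"
      using G interior_positive(2) p unfolding glued_chart_def by blast
    have "collar_coord h A p 0 = 0" using collar_zero[OF h A] p e by blast
    have AA0: "A = A0"
    proof (rule ccontr)
      assume "A \<noteq> A0"
      then have "\<sigma> A \<noteq> A" using A0(3) A by blast
      moreover have "p \<in> collar_dom N A" using p e by simp
      ultimately show False using \<open>collar_coord h A p 0 = 0\<close> collar_dom_facts(6,7,9)[OF h A] by (fastforce simp: level_def side_def split: if_splits)
    qed
    have "descend c ` (?S \<inter> F ` D) \<subseteq> E" using descend_image[OF U] by blast
    moreover have "regular_map Smooth k n E (glued_phi \<circ> inv_into (F ` D) (descend c))"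
    proof -
      have "regular_map Smooth k (Suc n) E (collar_lift N h 0 (- 1))"
        by (rule regular_map_subset[OF collar_lift_regular[OF h]]) (auto simp: e(3) collar_img_def half_space_def)
      then have "regular_map Smooth k n E (\<psi> \<circ> collar_lift N h 0 (- 1))"
        by (rule regular_map_compose[OF _ \<psi>_regular])
          (use collar_lift_facts(4)[OF h] in \<open>auto simp: e(3) collar_img_def half_space_def AA0 level_A0\<close>)
      then show ?thesis
      proof (rule regular_map_cong)
        fix x assume x: "x \<in> E"
        then have xE: "x \<in> collar_img N N' h A" using e by simp
        note f = collar_img_facts[OF h A xE]
        have "inv_into (F ` D) (descend c) x = F (collar_param N h A x)" using descend_inverse[OF U x] e by simp
        moreover have "collar_param N h A x \<in> M0" using f(13) by (simp add: collar_dom_def)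
        moreover have "\<phi> (collar_param N h A x) = \<psi> (collar_lift N h 0 (- 1) x)" using f(2,4) by (simp add: AA0 level_A0)
        ultimately show "(\<psi> \<circ> collar_lift N h 0 (- 1)) x = (glued_phi \<circ> inv_into (F ` D) (descend c)) x"
          using glued_phi_F by simp
      qed
    qed
    ultimately have 1: "regular_map Smooth k n (descend c ` (?S \<inter> F ` D)) (glued_phi \<circ> inv_into (F ` D) (descend c))"
      by (metis regular_map_subset)
    have w: "w \<in> V \<and> foot w \<in> N \<and> collar_fun h 0 (- 1) w = (descend c \<circ> inv_into ?S glued_phi) w"
      if w: "w \<in> glued_phi ` (?S \<inter> F ` D)" for w
    proof -
      obtain q where q: "q \<in> A0" "q \<in> B" "F q \<in> F ` D" "w = glued_phi (F q)" using w by blast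
      then have qD: "q \<in> D" and qM: "q \<in> M0" using rep B_M0 by blast+
      then have wq: "w = \<phi> q" using q glued_phi_F by simp
      have "inv_into ?S glued_phi w = F q" using q inj inv_into_f_f by (metis IntI imageI)
      then have "(descend c \<circ> inv_into ?S glued_phi) w = c q" using descend_F[OF U qD] by simp
      also have "\<dots> = collar_fun h 0 (- 1) w" using q(1) by (simp add: e(2) collar_coord_def AA0 level_A0 side_def wq)
      finally show ?thesis using qD wq by (auto simp: e(1) collar_dom_def)
    qed
    have "regular_map Smooth n k (glued_phi ` (?S \<inter> F ` D)) (collar_fun h 0 (- 1))"
      by (rule regular_map_subset[OF collar_fun_regular[OF h]]) (use w in blast)
    then have "regular_map Smooth n k (glued_phi ` (?S \<inter> F ` D)) (descend c \<circ> inv_into ?S glued_phi)"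
      by (rule regular_map_cong) (use w in blast)
    then show ?thesis using 1 by blast
  qed
  show ?thesis unfolding manifold_iso_onto_def
  proof (intro conjI homeo ballI)
    fix C assume "C \<in> glued_atlas"
    then obtain D c E P where "C = (F ` D, descend c)" "glued_chart D c E P" unfolding glued_atlas_def by blast
    then show "case C of (D, c) \<Rightarrow> regular_map Smooth k n (c ` (?S \<inter> D)) (glued_phi \<circ> inv_into D c) \<and>
        regular_map Smooth n k (glued_phi ` (?S \<inter> D)) (c \<circ> inv_into ?S glued_phi)"
      using charts by simp
  qed
qed

lemma Y_bounds: "bounds n j Y"
  unfolding bounds_def
  using glued_manifold Q(3) boundary_iso glued_boundary by (intro exI[of _ Q] exI[of _ glued_atlas] exI[of _ glued_phi]) simp

end

theorem (in glued_preimage) bounds_Y: "bounds n j Y"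
proof -
  obtain F :: "'p \<Rightarrow> nat \<Rightarrow> real" and Q where
    "Hausdorff_space Q" "second_countable Q" "compact_space Q" "quotient_map Z Q F"
    "\<And>p q. p \<in> M0 \<Longrightarrow> q \<in> M0 \<Longrightarrow> F p = F q \<longleftrightarrow> q = p \<or> (p \<in> B \<and> q = \<tau> p)"
    using glued_space by metis
  then interpret glued_quotient n j T \<A> \<phi> K Y W V \<psi> \<S> R \<sigma> A0 F Q
    by unfold_locales
  show ?thesis by (rule Y_bounds)
qed

section \<open>Sheets and the degree\<close>

text \<open>Remove one element, split the rest into two halves, and match the halves by a bijection.\<close>

lemma odd_set_almost_pairing:
  assumes "finite S" "odd (card S)"
  shows "\<exists>\<sigma> R a. (\<forall>x\<in>S. \<sigma> x \<in> S \<and> \<sigma> (\<sigma> x) = x \<and> (x \<in> R \<or> \<sigma> x \<in> R)) \<and> R \<subseteq> S \<and>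
    (\<forall>x\<in>R. \<sigma> x \<in> R \<longrightarrow> \<sigma> x = x) \<and> a \<in> R \<and> \<sigma> a = a \<and> (\<forall>x\<in>R. \<sigma> x = x \<longrightarrow> x = a)"
proof -
  have "S \<noteq> {}" using assms(2) by auto
  then obtain a where a: "a \<in> S" by blast
  obtain e where e: "card (S - {a}) = 2 * e" using assms a by (auto elim!: oddE)
  obtain P where P: "P \<subseteq> S - {a}" "card P = e" "finite P"
    using obtain_subset_with_card_n[of e "S - {a}"] e by auto
  define P' where "P' = S - {a} - P"
  have "card P' = e" "finite P'" using card_Diff_subset[OF P(3,1)] e P(2) assms(1) by (auto simp: P'_def)
  then obtain b where b: "bij_betw b P P'" using finite_same_card_bij P by metis
  define \<sigma> where "\<sigma> x = (if x \<in> P then b x else if x \<in> P' then inv_into P b x else x)" for x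
  have disj: "P \<inter> P' = {}" "a \<notin> P" "a \<notin> P'" and S: "S = insert a (P \<union> P')" using P a by (auto simp: P'_def)
  have bP: "b x \<in> P'" "inv_into P b (b x) = x" if "x \<in> P" for x
    using b that by (auto simp: bij_betw_def)
  have bP': "inv_into P b x \<in> P" "b (inv_into P b x) = x" if "x \<in> P'" for x
    using b that by (auto simp: bij_betw_def inv_into_into f_inv_into_f)
  show ?thesis
  proof (intro exI[of _ \<sigma>] exI[of _ "insert a P"] exI[of _ a] conjI ballI impI)
    show "\<sigma> x \<in> S" "\<sigma> (\<sigma> x) = x" "x \<in> insert a P \<or> \<sigma> x \<in> insert a P" if "x \<in> S" for x
      using that bP[of x] bP'[of x] disj unfolding S \<sigma>_def by auto
    show "\<sigma> x = x" if "x \<in> insert a P" "\<sigma> x \<in> insert a P" for x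
      using that bP[of x] disj unfolding \<sigma>_def by (auto split: if_splits)
    show "x = a" if "x \<in> insert a P" "\<sigma> x = x" for x
      using that bP[of x] disj unfolding \<sigma>_def by (auto split: if_splits)
    show "\<sigma> a = a" using disj by (simp add: \<sigma>_def)
  qed (use S in auto)
qed

text \<open>The neighbourhood that witnesses smoothness of a point witnesses it for all points of \<open>X\<close> in
  it.\<close>

lemma smooth_part_open: "openin (subtopology (Euclidean_space n) X) (smooth_part n k X)"
proof (subst openin_subopen, intro ballI)
  fix x assume "x \<in> smooth_part n k X"
  then obtain N where x: "x \<in> X" and N: "openin (Euclidean_space n) N" "x \<in> N" "submanifold Analytic n k (X \<inter> N)"
    unfolding smooth_part_def smooth_point_def by blast
  then have "X \<inter> N \<subseteq> smooth_part n k X" unfolding smooth_part_def smooth_point_def by blast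
  moreover have "openin (subtopology (Euclidean_space n) X) (X \<inter> N)"
    using N(1) by (rule openin_subtopology_Int2)
  ultimately show "\<exists>T. openin (subtopology (Euclidean_space n) X) T \<and> x \<in> T \<and> T \<subseteq> smooth_part n k X"
    using x N(2) by blast
qed

lemma openin_smooth_part_imp_openin:
  assumes "openin (subtopology (Euclidean_space n) (smooth_part n k X)) G"
  shows "openin (subtopology (Euclidean_space n) X) G"
proof -
  have "smooth_part n k X \<subseteq> X" by (auto simp: smooth_part_def smooth_point_def)
  then have "subtopology (subtopology (Euclidean_space n) X) (smooth_part n k X)
      = subtopology (Euclidean_space n) (smooth_part n k X)"
    by (simp add: subtopology_subtopology Int_absorb1)
  then show ?thesis using assms openin_trans_full smooth_part_open by metis
qed

lemma regular_on_manifold_continuous_map: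
  assumes man: "analytic_manifold k T \<A>" and \<phi>: "regular_on_manifold Analytic k T \<A> n \<phi>"
  shows "continuous_map T (Euclidean_space n) \<phi>"
proof (rule pasting_lemma[where I = \<A> and T = fst and f = "\<lambda>_. \<phi>"])
  fix C assume C: "C \<in> \<A>"
  obtain D c where Dc: "C = (D, c)" by fastforce
  have ch: "chart_on k (RR k) T (D, c)"
    using man C Dc unfolding analytic_manifold_def manifold_modelled_on_def by blast
  then show D: "openin T (fst C)" by (simp add: chart_on_def Dc)
  have h: "homeomorphic_map (subtopology T D) (subtopology (Euclidean_space k) (c ` D)) c"
    using ch by (simp add: chart_on_def)
  have DT: "D \<subseteq> topspace T" using D openin_subset Dc by fastforce
  have "regular_map Smooth k n (c ` D) (\<phi> \<circ> inv_into D c)"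
    using \<phi> C Dc regular_map_analytic_imp_smooth unfolding regular_on_manifold_def by fastforce
  from continuous_map_compose[OF homeomorphic_imp_continuous_map[OF h] regular_map_continuous_map[OF this]]
  have "continuous_map (subtopology T D) (Euclidean_space n) (\<phi> \<circ> inv_into D c \<circ> c)" by (simp add: comp_assoc)
  then have "continuous_map (subtopology T D) (Euclidean_space n) \<phi>"
  proof (rule continuous_map_eq)
    fix p assume "p \<in> topspace (subtopology T D)"
    then have "inv_into D c (c p) = p"
      using homeomorphic_imp_injective_map[OF h] DT by (intro inv_into_f_f) (auto simp: Int_absorb1)
    then show "(\<phi> \<circ> inv_into D c \<circ> c) p = \<phi> p" by simp
  qed
  then show "continuous_map (subtopology T (fst C)) (Euclidean_space n) \<phi>" by (simp add: Dc)
next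
  fix p assume "p \<in> topspace T"
  then show "\<exists>C. C \<in> \<A> \<and> p \<in> fst C \<and> \<phi> p = \<phi> p"
    using man unfolding analytic_manifold_def manifold_modelled_on_def by fastforce
qed auto

lemma connected_clopen_subset_eq:
  assumes conn: "connected_space (subtopology P A)" "connected_space (subtopology P A')"
    and A: "openin P A" "closedin P A" and A': "openin P A'" "closedin P A'" and p: "p \<in> A" "p \<in> A'"
  shows "A = A'"
proof -
  have "C \<subseteq> C'" if "connected_space (subtopology P C)" "openin P C'" "closedin P C'" "p \<in> C" "p \<in> C'" "openin P C" for C C'
  proof -
    have "openin (subtopology P C) (C \<inter> C')" "closedin (subtopology P C) (C \<inter> C')"
      using that by (simp_all add: openin_subtopology_Int2 closedin_subtopology_Int_closed)
    then have "C \<inter> C' = {} \<or> C \<inter> C' = topspace (subtopology P C)"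
      using that(1) unfolding connected_space_clopen_in by blast
    then show ?thesis using that openin_subset[OF that(6)] by auto
  qed
  then show ?thesis using assms by (metis subset_antisym)
qed

text \<open>Sheets are connected, being homeomorphic to \<open>W\<close>, and both open and closed over \<open>U\<close>; so two
  sheets that meet coincide. Hence the finite family given by the smoothing section consists
  of all sheets.\<close>

lemma sheet_family:
  assumes \<Gamma>: "global_smoothing_section n k X T \<A> \<phi> U"
    and W: "W \<in> connected_components_of (subtopology (Euclidean_space n) U)"
  defines "\<S> \<equiv> sheets n k T \<A> \<phi> U W"
  shows "finite \<S>" "\<And>A A' p. A \<in> \<S> \<Longrightarrow> A' \<in> \<S> \<Longrightarrow> p \<in> A \<Longrightarrow> p \<in> A' \<Longrightarrow> A = A'"
    "\<Union>\<S> = preimage_on T \<phi> W"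
    "\<S> \<noteq> {}"
proof -
  let ?P = "subtopology T (preimage_on T \<phi> U)"
  have tP: "topspace ?P = preimage_on T \<phi> U" by (auto simp: preimage_on_def)
  have WU: "W \<subseteq> RR n \<inter> U" "W \<noteq> {}" "connectedin (subtopology (Euclidean_space n) U) W"
    using connected_components_of_subset[OF W] nonempty_connected_components_of[OF W]
      connectedin_connected_components_of[OF W] by auto
  have connW: "connected_space (subtopology (Euclidean_space n) W)"
    using WU by (simp add: connectedin_def subtopology_subtopology Int_absorb1)
  have A: "openin ?P A \<and> closedin ?P A \<and> connected_space (subtopology ?P A) \<and> \<phi> ` A = W" if "A \<in> \<S>" for A
  proof -
    have o: "openin ?P A" "closedin ?P A" and h: "homeomorphic_map (subtopology T A) (subtopology (Euclidean_space n) W) \<phi>"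
      using that unfolding \<S>_def sheets_def manifold_iso_onto_def by auto
    have sub: "A \<subseteq> preimage_on T \<phi> U" using openin_subset[OF o(1)] tP by simp
    then have "subtopology ?P A = subtopology T A" by (simp add: subtopology_subtopology Int_absorb1)
    moreover have "connected_space (subtopology T A)"
      using homeomorphic_connected_space[OF homeomorphic_map_imp_homeomorphic_space[OF h]] connW by blast
    moreover have "\<phi> ` A = W"
      using homeomorphic_imp_surjective_map[OF h] sub WU(1) by (auto simp: preimage_on_def Int_absorb1 subset_iff)
    ultimately show ?thesis using o by simp
  qed
  show disj: "A = A'" if "A \<in> \<S>" "A' \<in> \<S>" "p \<in> A" "p \<in> A'" for A A' p
    using connected_clopen_subset_eq[of ?P A A' p] A that by blast
  obtain \<S>0 where \<S>0: "finite \<S>0" "\<S>0 \<noteq> {}" "\<S>0 \<subseteq> \<S>" "preimage_on T \<phi> W = \<Union>\<S>0"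
    using \<Gamma> W unfolding global_smoothing_section_def \<S>_def by blast
  have "\<S> \<subseteq> \<S>0"
  proof
    fix A1 assume A1: "A1 \<in> \<S>"
    then have "A1 \<noteq> {}" using A WU(2) by blast
    then obtain p where p: "p \<in> A1" by blast
    then have "p \<in> preimage_on T \<phi> W"
      using A[OF A1] openin_subset[of ?P A1] tP by (auto simp: preimage_on_def)
    then obtain A2 where "A2 \<in> \<S>0" "p \<in> A2" using \<S>0(4) by blast
    then show "A1 \<in> \<S>0" using disj A1 p \<S>0(3) by blast
  qed
  then have "\<S> = \<S>0" using \<S>0(3) by blast
  then show "finite \<S>" "\<Union>\<S> = preimage_on T \<phi> W" "\<S> \<noteq> {}" using \<S>0 by auto
qed

text \<open>The image of the closed set \<open>X' - \<phi>\<^sup>-\<^sup>1(W)\<close> under the proper map \<open>\<phi>\<close> is closed. Every point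
  of \<open>U\<close> lies in the image of \<open>\<phi>\<close>, as each component of \<open>U\<close> carries a sheet, so this image
  cuts out of \<open>U\<close> exactly the complement of \<open>W\<close>.\<close>

lemma component_open:
  assumes \<Gamma>: "global_smoothing_section n k X T \<A> \<phi> U"
    and W: "W \<in> connected_components_of (subtopology (Euclidean_space n) U)"
    and U: "openin (subtopology (Euclidean_space n) X) U"
    and pre: "openin T (preimage_on T \<phi> W)"
  shows "openin (subtopology (Euclidean_space n) X) W"
proof -
  have WU: "W \<subseteq> RR n \<inter> U" using connected_components_of_subset[OF W] by simp
  have "proper_map T (Euclidean_space n) \<phi>" using \<Gamma> by (simp add: global_smoothing_section_def)
  then have "closed_map T (Euclidean_space n) \<phi>" by (rule proper_imp_closed_map)
  moreover have "closedin T (topspace T - preimage_on T \<phi> W)"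
    by (rule closedin_diff[OF closedin_topspace pre])
  ultimately have "closedin (Euclidean_space n) (\<phi> ` (topspace T - preimage_on T \<phi> W))"
    by (simp add: closed_map_def)
  then have "openin (Euclidean_space n) (RR n - \<phi> ` (topspace T - preimage_on T \<phi> W))" by blast
  then have "openin (subtopology (Euclidean_space n) X) (X \<inter> (RR n - \<phi> ` (topspace T - preimage_on T \<phi> W)))"
    by (rule openin_subtopology_Int2)
  from openin_Int[OF U this] show ?thesis
  proof (rule back_subst[of "openin _"])
    show "U \<inter> (X \<inter> (RR n - \<phi> ` (topspace T - preimage_on T \<phi> W))) = W"
    proof (intro equalityI subsetI)
      fix w assume "w \<in> W"
      then show "w \<in> U \<inter> (X \<inter> (RR n - \<phi> ` (topspace T - preimage_on T \<phi> W)))"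
        using WU openin_subset[OF U] by (auto simp: preimage_on_def)
    next
      fix u assume u: "u \<in> U \<inter> (X \<inter> (RR n - \<phi> ` (topspace T - preimage_on T \<phi> W)))"
      then have "u \<in> topspace (subtopology (Euclidean_space n) U)" by auto
      then obtain W' where W': "W' \<in> connected_components_of (subtopology (Euclidean_space n) U)" "u \<in> W'"
        unfolding Union_connected_components_of[symmetric] by (elim UnionE)
      obtain A where A: "A \<in> sheets n k T \<A> \<phi> U W'" using sheet_family(4)[OF \<Gamma> W'(1)] by blast
      then have h: "homeomorphic_map (subtopology T A) (subtopology (Euclidean_space n) W') \<phi>"
        unfolding sheets_def manifold_iso_onto_def by auto
      have "u \<in> \<phi> ` topspace (subtopology T A)"
        using homeomorphic_imp_surjective_map[OF h] W'(2) u by auto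
      then obtain p where "p \<in> topspace T" "u = \<phi> p" by auto
      then show "u \<in> W" using u by (auto simp: preimage_on_def)
    qed
  qed
qed

theorem theorem2p3:
  fixes n k :: nat
    and X U W :: "(nat \<Rightarrow> real) set"
    and T :: "'p topology"
    and \<A> :: "'p chart set"
    and \<phi> :: "'p \<Rightarrow> nat \<Rightarrow> real"
  assumes "closedin (Euclidean_space n) X"
    and "subanalytic n X"
    and "subanalytic_dim n X = int k"
    and "global_smoothing_section n k X T \<A> \<phi> U"
    and "W \<in> connected_components_of (subtopology (Euclidean_space n) U)"
    and "\<exists>Y. nonbounding_equator n k X Y \<and> Y \<subseteq> W"
  shows "even (degree_over n k T \<A> \<phi> U W)"
proof (rule ccontr)
  assume odd: "\<not> even (degree_over n k T \<A> \<phi> U W)"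
  let ?X = "subtopology (Euclidean_space n) X"
  obtain Y where equator: "nonbounding_equator n k X Y" and YW: "Y \<subseteq> W" using assms(6) by blast
  obtain j where k: "k = Suc j" and Y: "compactin (Euclidean_space n) Y" "submanifold Smooth n j Y" "\<not> bounds n j Y"
    using equator unfolding nonbounding_equator_def by blast
  from equator[unfolded nonbounding_equator_def, THEN conjunct2, THEN conjunct2]
  obtain \<psi> V K where "V = \<psi> ` cylinder n Y {-1<..<1} \<and>
      openin (subtopology (Euclidean_space n) (smooth_part n k X)) V \<and> Y \<subseteq> V \<and>
      regular_iso Smooth (Suc n) n (cylinder n Y {-1<..<1}) V \<psi> \<and> \<psi> ` cylinder n Y {0} = Y \<and>
      openin ?X K \<and> compactin ?X (?X closure_of K) \<and> ?X closure_of K - K = Y \<and>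
      K \<inter> V = \<psi> ` cylinder n Y {-1<..<0}"
    by (elim exE) (rule that)
  then have V: "openin (subtopology (Euclidean_space n) (smooth_part n k X)) V" "Y \<subseteq> V"
      and \<psi>: "regular_iso Smooth (Suc n) n (cylinder n Y {-1<..<1}) V \<psi>" "\<psi> ` cylinder n Y {0} = Y"
      and K: "openin ?X K" "compactin ?X (?X closure_of K)" "?X closure_of K - K = Y"
        "K \<inter> V = \<psi> ` cylinder n Y {-1<..<0}"
    by - (elim conjE, assumption)+
  define \<S> where "\<S> = sheets n k T \<A> \<phi> U W"
  note \<Gamma> = assms(4)[unfolded global_smoothing_section_def]
  have man: "analytic_manifold k T \<A>" and reg: "regular_on_manifold Analytic k T \<A> n \<phi>"
    and proper: "proper_map T (Euclidean_space n) \<phi>" and \<phi>X: "\<phi> ` topspace T \<subseteq> X"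
    using \<Gamma> by blast+
  have cont: "continuous_map T (Euclidean_space n) \<phi>"
    by (rule regular_on_manifold_continuous_map[OF man reg])
  then have contX: "continuous_map T ?X \<phi>" using \<phi>X by (simp add: continuous_map_in_subtopology image_subset_iff)
  have openP: "openin T {p \<in> topspace T. \<phi> p \<in> G}" if "openin ?X G" for G
    by (rule openin_continuous_map_preimage[OF contX that])
  have UX: "openin ?X U" and VX: "openin ?X V"
    using \<Gamma> V openin_smooth_part_imp_openin by blast+
  have openU: "openin T (preimage_on T \<phi> U)" unfolding preimage_on_def by (rule openP[OF UX])
  note fam = sheet_family[OF assms(4,5), folded \<S>_def]
  have sheet: "openin T A" "manifold_iso_onto Analytic k T \<A> A n W \<phi>" if "A \<in> \<S>" for A
    using that openin_trans_full[OF _ openU] unfolding \<S>_def sheets_def by blast+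
  have WX: "openin ?X W"
  proof (rule component_open[OF assms(4,5) UX])
    show "openin T (preimage_on T \<phi> W)" unfolding fam(3)[symmetric] using sheet(1) by blast
  qed
  have VR: "V \<subseteq> RR n" "V \<subseteq> X" using openin_subset[OF VX] by auto
  have KY: "?X closure_of K = K \<union> Y"
  proof -
    have "K \<subseteq> ?X closure_of K" using openin_subset[OF K(1)] by (rule closure_of_subset)
    then show ?thesis using K(3) by blast
  qed
  have compact: "compactin T {p \<in> topspace T. \<phi> p \<in> K \<union> Y}"
  proof (rule compactin_proper_map_preimage[OF proper])
    show "compactin (Euclidean_space n) (K \<union> Y)" using K(2) unfolding KY by (simp add: compactin_subtopology)
  qed
  have VW: "openin (top_of_set V) (V \<inter> W)"
  proof -
    have "openin (subtopology ?X V) (V \<inter> W)" using WX by (rule openin_subtopology_Int2)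
    moreover have "subtopology ?X V = top_of_set V"
      using VR by (simp add: subtopology_subtopology subtopology_RR Int_absorb1)
    ultimately show ?thesis by simp
  qed
  have WR: "W \<subseteq> RR n" using connected_components_of_subset[OF assms(5)] by auto
  have "odd (card \<S>)" using odd by (simp add: degree_over_def \<S>_def)
  from odd_set_almost_pairing[OF fam(1) this] obtain \<sigma> R A0 where
    "(\<forall>A\<in>\<S>. \<sigma> A \<in> \<S> \<and> \<sigma> (\<sigma> A) = A \<and> (A \<in> R \<or> \<sigma> A \<in> R)) \<and> R \<subseteq> \<S> \<and>
      (\<forall>A\<in>R. \<sigma> A \<in> R \<longrightarrow> \<sigma> A = A) \<and> A0 \<in> R \<and> \<sigma> A0 = A0 \<and> (\<forall>A\<in>R. \<sigma> A = A \<longrightarrow> A = A0)"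
    by (elim exE) (rule that)
  note pairing = this
  have \<sigma>: "\<And>A. A \<in> \<S> \<Longrightarrow> \<sigma> A \<in> \<S>" "\<And>A. A \<in> \<S> \<Longrightarrow> \<sigma> (\<sigma> A) = A" "R \<subseteq> \<S>"
    "\<And>A. A \<in> \<S> \<Longrightarrow> A \<in> R \<or> \<sigma> A \<in> R" "\<And>A. A \<in> R \<Longrightarrow> \<sigma> A \<in> R \<Longrightarrow> \<sigma> A = A"
    "A0 \<in> R" "\<sigma> A0 = A0" "\<And>A. A \<in> R \<Longrightarrow> \<sigma> A = A \<Longrightarrow> A = A0"
    using pairing by simp_all
  have "glued_preimage n j T \<A> \<phi> K Y W V \<psi> \<S> R \<sigma> A0"
  proof
    show "analytic_manifold (Suc j) T \<A>" "regular_on_manifold Analytic (Suc j) T \<A> n \<phi>"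
      using man reg k by simp_all
    show "openin T {p \<in> topspace T. \<phi> p \<in> K}" "openin T {p \<in> topspace T. \<phi> p \<in> V}"
      by (rule openP, fact)+
    show "K \<inter> Y = {}" using K(3) by blast
    show "manifold_iso_onto Analytic (Suc j) T \<A> A n W \<phi>" if "A \<in> \<S>" for A using sheet(2)[OF that] k by simp
    show "A = A'" if "A \<in> \<S>" "A' \<in> \<S>" "p \<in> A" "p \<in> A'" for A A' p using fam(2) that by blast
    show "\<exists>A\<in>\<S>. p \<in> A" if "p \<in> topspace T" "\<phi> p \<in> W" for p
      using that fam(3) by (auto simp: preimage_on_def)
  qed (fact cont compact Y YW WR sheet(1) \<psi> V(2) VW K(4) \<sigma>)+
  then have "bounds n j Y" by (rule glued_preimage.bounds_Y)
  with Y(3) show False by blast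
qed

end
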